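(* Let $T=(T(s),s>0)$ be a $1$-SSA non-decreasing process with no drift, finite rate $\theta>0$ and generic jump $J$. For each fixed time $s>0$ and $t\ge 0$, the future of $T$ after time $s$, conditional on $T(s)=t$, can be constructed as follows: "Hold": $T$ stays at level $t$ until the random time $H_s$ with $H_s\overset{d}{=}s\beta^{-1}$ for $\beta\sim$ beta$(\theta,1)$, i.e. $$\frac{d}{dx}\mathbb{P}(H_s\le x)=\theta x^{-\theta-1}s^{\theta}1(x>s);$$ "Jump": at time $H_s$, $T$ jumps up by $H_sJ$, where $J$ is a copy of the generic jump independent of $H_s$, i.e. for $y\ge0$ $$\mathbb{P}(T(H_s)-T(H_s-)>y\mid H_s=s')=\mathbb{P}(s'J>y)=\mathbb{P}(J>y/s');$$ then repeat (with fresh independent variables), conditioning on $T(s')=t'$ for $s'=H_s$, $t'=t+H_sJ$. Thus, for a fixed starting time $S_1=s$, with $T_1=T(s)$, and for $n\ge1$, $S_{n+1}$ the time of the first jump of $T$ strictly after $S_n$ and $T_{n+1}=T(S_{n+1})$, the sequence $((S_n,T_n),n\ge1)$ is a homogeneous Markov process with state space $(0,\infty)^2$, with the transitions from $(s,t)$ to $(H_s,t+H_sJ)$ specified by the hold and jump laws above, and with entrance law given by $T_1=T(s)\overset{d}{=}sT(1)$. Moreover, apart from this entrance law, the same description applies with the fixed time $s$ replaced by any stopping time $\sigma$ relative to the filtration of $T$, on the event $\{0<\sigma<\infty\}$.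
   Context: A stochastic process $T=(T(s),s>0)$ is $1$-self-similar additive ($1$-SSA) if (i) for all $c>0$, $(T(cs),s>0)$ and $(cT(s),s>0)$ have the same finite-dimensional distributions; and (ii) $T$ has independent increments, is stochastically continuous, has càdlàg paths, and $\lim_{s\to0+}T(s)=0$. For a non-decreasing $1$-SSA process, "no drift" means that $T(s)$ is the sum of its jumps up to time $s$; in that case there is a unique right-continuous non-increasing function $k:(0,\infty)\to[0,\infty)$, the key function of $T$, with $\int_0^\infty (x\wedge 1)\frac{k(x)}{x}\,dx<\infty$ and $\log \mathbb{E}e^{-uT(1)}=\int_0^\infty (e^{-ux}-1)\frac{k(x)}{x}\,dx$ for $u\ge 0$. $T$ has finite rate $\theta<\infty$ if its set of jump times $\{s>0:T(s)>T(s-)\}$ is a Poisson point process on $(0,\infty)$ with intensity measure $\theta s^{-1}ds$; then $\theta=k(0+)$. The generic jump of $T$ is a positive random variable $J$ with $\mathbb{P}(J>x)=k(x)/\theta$ for $x>0$; the normalized jumps $(T(S)-T(S-))/S$ over jump times $S$ of $T$ are i.i.d. copies of $J$, independent of the jump times. The beta$(\theta,1)$ distribution has density $\theta u^{\theta-1}$ on $(0,1)$. *)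

theory Defs
  imports "HOL-Probability.Probability" "HOL-Probability.Stopping_Time"
begin

section \<open>Self-similar additive processes\<close>

text \<open>
  A process indexed by the times \<open>s > 0\<close> is a function \<open>T :: real \<Rightarrow> 'a \<Rightarrow> real\<close>; its values at
  times \<open>s \<le> 0\<close> are junk and are never used below.
\<close>

definition self_similar1 :: "'a measure \<Rightarrow> (real \<Rightarrow> 'a \<Rightarrow> real) \<Rightarrow> bool" where
  "self_similar1 M T \<longleftrightarrow>
     (\<forall>c>0. \<forall>I. finite I \<and> I \<subseteq> {0<..} \<longrightarrow>
        distr M (\<Pi>\<^sub>M s\<in>I. borel) (\<lambda>\<omega>. \<lambda>s\<in>I. T (c * s) \<omega>)
      = distr M (\<Pi>\<^sub>M s\<in>I. borel) (\<lambda>\<omega>. \<lambda>s\<in>I. c * T s \<omega>))"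

text \<open>
  As is usual for additive processes, \<open>T(t\<^sub>0)\<close> counts as the increment over \<open>(0, t\<^sub>0]\<close>
  (recall \<open>T(0+) = 0\<close>).
\<close>
definition independent_increments :: "'a measure \<Rightarrow> (real \<Rightarrow> 'a \<Rightarrow> real) \<Rightarrow> bool" where
  "independent_increments M T \<longleftrightarrow>
     (\<forall>(n::nat) t. 0 < t 0 \<and> (\<forall>i<n. t i < t (Suc i)) \<longrightarrow>
        prob_space.indep_vars M (\<lambda>_. borel)
          (\<lambda>i \<omega>. if i = 0 then T (t 0) \<omega> else T (t i) \<omega> - T (t (i - 1)) \<omega>) {..n})"

definition stochastically_continuous :: "'a measure \<Rightarrow> (real \<Rightarrow> 'a \<Rightarrow> real) \<Rightarrow> bool" where
  "stochastically_continuous M T \<longleftrightarrow>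
     (\<forall>s>0. \<forall>e>0. ((\<lambda>u. measure M {\<omega>\<in>space M. e < \<bar>T u \<omega> - T s \<omega>\<bar>}) \<longlongrightarrow> 0) (at s))"

definition cadlag_paths :: "'a measure \<Rightarrow> (real \<Rightarrow> 'a \<Rightarrow> real) \<Rightarrow> bool" where
  "cadlag_paths M T \<longleftrightarrow>
     (\<forall>\<omega>\<in>space M. \<forall>s>0. continuous (at_right s) (\<lambda>u. T u \<omega>) \<and>
        (\<exists>l. ((\<lambda>u. T u \<omega>) \<longlongrightarrow> l) (at_left s)))"

definition SSA1 :: "'a measure \<Rightarrow> (real \<Rightarrow> 'a \<Rightarrow> real) \<Rightarrow> bool" where
  "SSA1 M T \<longleftrightarrow>
     (\<forall>s>0. T s \<in> borel_measurable M) \<and>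
     self_similar1 M T \<and> independent_increments M T \<and> stochastically_continuous M T \<and>
     cadlag_paths M T \<and> (AE \<omega> in M. ((\<lambda>s. T s \<omega>) \<longlongrightarrow> 0) (at_right 0))"

definition nondecreasing_paths :: "'a measure \<Rightarrow> (real \<Rightarrow> 'a \<Rightarrow> real) \<Rightarrow> bool" where
  "nondecreasing_paths M T \<longleftrightarrow> (\<forall>\<omega>\<in>space M. mono_on {0<..} (\<lambda>s. T s \<omega>))"

section \<open>Jumps, rate and generic jump\<close>

definition jump_size :: "(real \<Rightarrow> 'a \<Rightarrow> real) \<Rightarrow> 'a \<Rightarrow> real \<Rightarrow> real" where
  "jump_size T \<omega> s = (if 0 < s then T s \<omega> - Lim (at_left s) (\<lambda>u. T u \<omega>) else 0)"

definition jump_times :: "(real \<Rightarrow> 'a \<Rightarrow> real) \<Rightarrow> 'a \<Rightarrow> real set" where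
  "jump_times T \<omega> = {s. 0 < s \<and> 0 < jump_size T \<omega> s}"

definition no_drift :: "'a measure \<Rightarrow> (real \<Rightarrow> 'a \<Rightarrow> real) \<Rightarrow> bool" where
  "no_drift M T \<longleftrightarrow> (AE \<omega> in M. \<forall>s>0. (jump_size T \<omega> has_sum T s \<omega>) {0<..s})"

definition poisson_point_process :: "'a measure \<Rightarrow> 'b measure \<Rightarrow> ('a \<Rightarrow> 'b set) \<Rightarrow> bool" where
  "poisson_point_process M \<mu> X \<longleftrightarrow>
     (let N = (\<lambda>A \<omega>. emeasure (count_space UNIV) (X \<omega> \<inter> A)) in
      (\<forall>A\<in>sets \<mu>. N A \<in> borel_measurable M) \<and>
      (\<forall>A\<in>sets \<mu>. emeasure \<mu> A < \<infinity> \<longrightarrow>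
         (\<forall>n::nat. measure M {\<omega>\<in>space M. N A \<omega> = of_nat n}
            = measure \<mu> A ^ n / fact n * exp (- measure \<mu> A))) \<and>
      (\<forall>A\<in>sets \<mu>. emeasure \<mu> A = \<infinity> \<longrightarrow> (AE \<omega> in M. N A \<omega> = \<infinity>)) \<and>
      (\<forall>(n::nat) A. A ` {..<n} \<subseteq> sets \<mu> \<and> disjoint_family_on A {..<n} \<longrightarrow>
         prob_space.indep_vars M (\<lambda>_. borel) (\<lambda>i. N (A i)) {..<n}))"

definition finite_rate :: "'a measure \<Rightarrow> (real \<Rightarrow> 'a \<Rightarrow> real) \<Rightarrow> real \<Rightarrow> bool" where
  "finite_rate M T \<theta> \<longleftrightarrow>
     poisson_point_process M
       (density (restrict_space lborel {0<..}) (\<lambda>s. ennreal (\<theta> / s))) (jump_times T)"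

definition key_function :: "'a measure \<Rightarrow> (real \<Rightarrow> 'a \<Rightarrow> real) \<Rightarrow> (real \<Rightarrow> real) \<Rightarrow> bool" where
  "key_function M T k \<longleftrightarrow>
     (\<forall>x>0. 0 \<le> k x \<and> continuous (at_right x) k) \<and>
     antimono_on {0<..} k \<and>
     (\<integral>\<^sup>+x\<in>{0<..}. ennreal (min x 1 * (k x / x)) \<partial>lborel) < \<infinity> \<and>
     (\<forall>u\<ge>0. ln (\<integral>\<omega>. exp (- u * T 1 \<omega>) \<partial>M)
        = (LINT x:{0<..}|lborel. (exp (- u * x) - 1) * (k x / x)))"

definition generic_jump ::
  "'a measure \<Rightarrow> (real \<Rightarrow> 'a \<Rightarrow> real) \<Rightarrow> real \<Rightarrow> 'b measure \<Rightarrow> ('b \<Rightarrow> real) \<Rightarrow> bool" where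
  "generic_jump M T \<theta> N J \<longleftrightarrow>
     prob_space N \<and> J \<in> borel_measurable N \<and> (AE \<eta> in N. 0 < J \<eta>) \<and>
     (\<exists>k. key_function M T k \<and> (\<forall>x>0. measure N {\<eta>\<in>space N. x < J \<eta>} = k x / \<theta>))"

section \<open>The natural filtration\<close>

definition past :: "'a measure \<Rightarrow> (real \<Rightarrow> 'a \<Rightarrow> real) \<Rightarrow> ennreal \<Rightarrow> 'a measure" where
  "past M T t = sigma (space M)
     (\<Union>u\<in>{u. 0 < u \<and> ennreal u \<le> t}. sets (vimage_algebra (space M) (T u) borel))"

text \<open>
  Time \<open>0\<close> gets the germ field, so that \<^const>\<open>stopping_time\<close> for this filtration amounts to
  \<open>{\<sigma> \<le> t} \<in> \<F>\<^sub>t\<close> for all \<open>t > 0\<close>. Otherwise \<open>\<F>\<^sub>0\<close> would be trivial, and a stopping time could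
  not vanish on one part of the sample space only.
\<close>
definition natural_filtration :: "'a measure \<Rightarrow> (real \<Rightarrow> 'a \<Rightarrow> real) \<Rightarrow> ennreal \<Rightarrow> 'a measure" where
  "natural_filtration M T t =
     (if t = 0 then sigma (space M) (\<Inter>u\<in>{0<..}. sets (past M T u)) else past M T t)"

lemma filtration_natural_filtration: "filtration (space M) (natural_filtration M T)"
proof
  have gen: "(\<Union>u\<in>{u. 0 < u \<and> ennreal u \<le> t}. sets (vimage_algebra (space M) (T u) borel))
      \<subseteq> Pow (space M)" for t
    using sets.sets_into_space by fastforce
  have sp: "space (past M T t) = space M" for t
    unfolding past_def using gen by (rule space_measure_of)
  have germ: "(\<Inter>u\<in>{0<..}. sets (past M T u)) \<subseteq> Pow (space M)"
    using sets.sets_into_space[of _ "past M T 1"] sp[of 1] by fastforce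
  show "space (natural_filtration M T t) = space M" for t
    using sp germ by (simp add: natural_filtration_def space_measure_of)
  have mono: "sets (past M T i) \<subseteq> sets (past M T j)" if "i \<le> j" for i j
    unfolding past_def using gen that
    by (subst (1 2) sets_measure_of, simp, simp)
       (rule sigma_sets_mono', auto intro: order_trans)
  show "sets (natural_filtration M T i) \<subseteq> sets (natural_filtration M T j)" if "i \<le> j" for i j
  proof (cases "i = 0 \<and> j \<noteq> 0")
    case True
    have "(\<Inter>u\<in>{0<..}. sets (past M T u)) \<subseteq> sets (past M T j)"
      using True by (intro INF_lower) (simp add: zero_less_iff_neq_zero)
    from sets.sigma_sets_subset[OF this]
    have "sigma_sets (space M) (\<Inter>u\<in>{0<..}. sets (past M T u)) \<subseteq> sets (past M T j)"
      by (simp add: sp)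
    then show ?thesis
      using True germ by (simp add: natural_filtration_def)
  next
    case False
    then show ?thesis
      using that mono by (auto simp: natural_filtration_def)
  qed
qed

section \<open>The hold-jump construction\<close>

definition beta1_law :: "real \<Rightarrow> real measure" where
  "beta1_law \<theta> = density lborel (\<lambda>u. ennreal (\<theta> * u powr (\<theta> - 1)) * indicator {0<..<1} u)"

definition hold_law :: "real \<Rightarrow> real \<Rightarrow> real measure" where
  "hold_law \<theta> s = distr (beta1_law \<theta>) borel (\<lambda>b. s / b)"

text \<open>Transition from \<open>(s, t)\<close> to \<open>(H\<^sub>s, t + H\<^sub>s J)\<close>, where \<open>D\<close> is the law of \<open>J\<close>.\<close>
definition hold_jump_kernel :: "real \<Rightarrow> real measure \<Rightarrow> real \<times> real \<Rightarrow> (real \<times> real) measure" where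
  "hold_jump_kernel \<theta> D = (\<lambda>(s, t). distr (hold_law \<theta> s \<Otimes>\<^sub>M D) borel (\<lambda>(h, j). (h, t + h * j)))"

text \<open>The \<open>n\<close>-th round uses the fresh pair \<open>w n = (\<beta>, J)\<close>.\<close>
primrec hold_jump_chain :: "(nat \<Rightarrow> real \<times> real) \<Rightarrow> real \<times> real \<Rightarrow> nat \<Rightarrow> real \<times> real" where
  "hold_jump_chain w x 0 = x"
| "hold_jump_chain w x (Suc n) =
     (let (s, t) = hold_jump_chain w x n; (b, j) = w n; h = s / b in (h, t + h * j))"

text \<open>Level at time \<open>u\<close>: the second component of the last state whose time is at most \<open>u\<close>.\<close>
definition hold_jump_path :: "(nat \<Rightarrow> real \<times> real) \<Rightarrow> real \<times> real \<Rightarrow> real \<Rightarrow> real" where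
  "hold_jump_path w x u = snd (hold_jump_chain w x (LEAST n. u < fst (hold_jump_chain w x (Suc n))))"

text \<open>Law of the constructed future \<open>v \<mapsto> T(s + v)\<close>, \<open>v \<ge> 0\<close>, started from \<open>T(s) = t\<close>.\<close>
definition hold_jump_law :: "real \<Rightarrow> real measure \<Rightarrow> real \<times> real \<Rightarrow> (real \<Rightarrow> real) measure" where
  "hold_jump_law \<theta> D x =
     distr (\<Pi>\<^sub>M n\<in>(UNIV :: nat set). beta1_law \<theta> \<Otimes>\<^sub>M D) (\<Pi>\<^sub>M v\<in>{0..}. borel)
       (\<lambda>w. \<lambda>v\<in>{0..}. hold_jump_path w x (fst x + v))"

section \<open>Conditional laws and Markov chains\<close>

definition has_cond_law ::
  "'a measure \<Rightarrow> 'a measure \<Rightarrow> 'b measure \<Rightarrow> ('a \<Rightarrow> 'b) \<Rightarrow> ('a \<Rightarrow> 'b measure) \<Rightarrow> bool" where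
  "has_cond_law P G N X Q \<longleftrightarrow> X \<in> P \<rightarrow>\<^sub>M N \<and>
     (\<forall>B\<in>sets N. AE \<omega> in P.
        real_cond_exp P G (indicator (X -` B \<inter> space P)) \<omega> = measure (Q \<omega>) B)"

text \<open>
  \<open>N\<close> is an ambient measurable space, \<open>E\<close> the state space; the chain need only stay in \<open>E\<close>
  almost surely.
\<close>
definition homogeneous_markov_chain ::
  "'a measure \<Rightarrow> 'b measure \<Rightarrow> 'b set \<Rightarrow> ('b \<Rightarrow> 'b measure) \<Rightarrow> (nat \<Rightarrow> 'a \<Rightarrow> 'b) \<Rightarrow> bool" where
  "homogeneous_markov_chain P N E K X \<longleftrightarrow>
     K \<in> restrict_space N E \<rightarrow>\<^sub>M prob_algebra N \<and> (\<forall>x\<in>E. measure (K x) E = 1) \<and>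
     (\<forall>n. X n \<in> P \<rightarrow>\<^sub>M N \<and> (AE \<omega> in P. X n \<omega> \<in> E)) \<and>
     (\<forall>n. has_cond_law P
        (vimage_algebra (space P) (\<lambda>\<omega>. \<lambda>i\<in>{..n}. X i \<omega>) (\<Pi>\<^sub>M i\<in>{..n}. N))
        N (X (Suc n)) (\<lambda>\<omega>. K (X n \<omega>)))"

section \<open>The future of a process after a random time\<close>

definition level :: "(real \<Rightarrow> 'a \<Rightarrow> real) \<Rightarrow> 'a \<Rightarrow> real \<Rightarrow> real" where
  "level T \<omega> s = (if 0 < s then T s \<omega> else 0)"

text \<open>
  The first jump strictly after \<open>s\<close>; the value \<open>s\<close> is a dummy for paths without such a jump,
  which at finite rate \<open>\<theta> > 0\<close> form a null set.
\<close>
definition first_jump :: "(real \<Rightarrow> 'a \<Rightarrow> real) \<Rightarrow> 'a \<Rightarrow> real \<Rightarrow> real" where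
  "first_jump T \<omega> s =
     (if jump_times T \<omega> \<inter> {s<..} = {} then s else Inf (jump_times T \<omega> \<inter> {s<..}))"

text \<open>Numbered from \<open>0\<close>: \<open>jump_chain T \<tau> n\<close> is \<open>(S\<^sub>n\<^sub>+\<^sub>1, T\<^sub>n\<^sub>+\<^sub>1)\<close> with \<open>S\<^sub>1 = \<tau>\<close>.\<close>
definition jump_chain :: "(real \<Rightarrow> 'a \<Rightarrow> real) \<Rightarrow> ('a \<Rightarrow> real) \<Rightarrow> nat \<Rightarrow> 'a \<Rightarrow> real \<times> real" where
  "jump_chain T \<tau> n \<omega> = (let S = (first_jump T \<omega> ^^ n) (\<tau> \<omega>) in (S, level T \<omega> S))"

text \<open>
  Hold-jump description, under \<open>P\<close> and conditionally on the sigma-algebra \<open>G\<close>, of the future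
  of \<open>T\<close> after the time \<open>\<tau>\<close>. The jump law is conditional on \<open>G\<close> and the hold time \<open>H\<close> jointly.
\<close>
definition hold_jump_description ::
  "'a measure \<Rightarrow> (real \<Rightarrow> 'a \<Rightarrow> real) \<Rightarrow> real \<Rightarrow> 'b measure \<Rightarrow> ('b \<Rightarrow> real)
     \<Rightarrow> 'a measure \<Rightarrow> ('a \<Rightarrow> real) \<Rightarrow> bool" where
  "hold_jump_description P T \<theta> N J G \<tau> \<longleftrightarrow>
     (let H = (\<lambda>\<omega>. first_jump T \<omega> (\<tau> \<omega>));
          GH = sigma (space P) (sets G \<union> sets (vimage_algebra (space P) H borel))
      in
       (AE \<omega> in P. 0 < \<tau> \<omega> \<and> \<tau> \<omega> < H \<omega> \<and> H \<omega> \<in> jump_times T \<omega> \<and>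
          (\<forall>u. \<tau> \<omega> \<le> u \<and> u < H \<omega> \<longrightarrow> T u \<omega> = T (\<tau> \<omega>) \<omega>)) \<and>
       has_cond_law P G borel H (\<lambda>\<omega>. hold_law \<theta> (\<tau> \<omega>)) \<and>
       (\<forall>y\<ge>0. {\<omega>\<in>space P. y < jump_size T \<omega> (H \<omega>)} \<in> sets P \<and>
          (AE \<omega> in P.
             real_cond_exp P GH (indicator {\<omega>\<in>space P. y < jump_size T \<omega> (H \<omega>)}) \<omega>
               = measure N {\<eta>\<in>space N. y < H \<omega> * J \<eta>} \<and>
             measure N {\<eta>\<in>space N. y < H \<omega> * J \<eta>} = measure N {\<eta>\<in>space N. y / H \<omega> < J \<eta>})) \<and>
       has_cond_law P G (\<Pi>\<^sub>M v\<in>{0..}. borel)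
         (\<lambda>\<omega>. \<lambda>v\<in>{0..}. level T \<omega> (\<tau> \<omega> + v))
         (\<lambda>\<omega>. hold_jump_law \<theta> (distr N borel J) (\<tau> \<omega>, level T \<omega> (\<tau> \<omega>))))"

end

theory Submission
  imports Defs
begin

text \<open>
  By self-similarity \<open>T(u)\<close> has Laplace transform \<open>exp (- \<psi>(l u))\<close>, and since \<open>P(J > x) = k(x) / \<theta>\<close>, Fubini gives
  \<open>d/dr \<psi>(l r) = \<theta>/r (1 - E exp (- l r J))\<close>. Together with independent increments this determines the joint
  Laplace transform of the increments of \<open>T\<close> after a fixed time, and, by dyadic approximation from the right,
  after a stopping time. On the side of the hold-jump chain \<open>S\<^sub>n\<close>, the same expression \<open>V(s)\<close> satisfies the
  one-step equation \<open>V(s) = E [exp (- l(S\<^sub>1) S\<^sub>1 J) V(S\<^sub>1)]\<close>; iterating it and using \<open>S\<^sub>n \<longrightarrow> \<infinity>\<close> shows that the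
  hold-jump path has the same increments in law. Hence, conditionally on the past, the future of \<open>T\<close> and the
  hold-jump path have the same law. The sequence of jump times and levels is the same measurable functional of
  both paths, so the laws of the hold, of the jump and the Markov property carry over from the chain.
\<close>

section \<open>Uniqueness of Laplace transforms\<close>

text \<open>The hypotheses treat jump times and jump sizes separately: \<open>finite_rate\<close>
  concerns the set of times, the key function the law of \<open>T 1\<close>, and neither gives the
  joint law of a jump and its time. The proof therefore compares laws of increments, which can be
  computed on both sides. Conditioning is built in by comparing joint laws of (\<omega>, path) on
  the product of \<open>G\<close> with path space: equality of these measures is equality of
  conditional laws given \<open>G\<close>.

  The one-step equation is a cancellation. Moving the starting time s changes log V(s) at rate
  \<theta>/s (1 - c(s)), with c(s) the mean factor contributed by a jump at time s. Hence - s powr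
  (- \<theta>) V(s) has derivative \<theta> s powr (- \<theta> - 1) c(s) V(s): up to a constant,
  hold density times jump factor times the value of what is left.

  Paths have uncountably many coordinates, but an event of the product space depends on countably
  many. Jump times and levels are therefore read off at rational times, which is correct for
  right-continuous step paths only; the Poisson structure of the jump times and the absence of drift
  give T this form.\<close>

lemma moments_determine_distribution:
  assumes "real_distribution \<mu>" "real_distribution \<nu>"
    and "AE x in \<mu>. \<bar>x\<bar> \<le> 1" "AE x in \<nu>. \<bar>x\<bar> \<le> 1"
    and eq: "\<And>k::nat. (\<integral>x. x ^ k \<partial>\<mu>) = (\<integral>x. x ^ k \<partial>\<nu>)"
  shows "\<mu> = \<nu>"
proof (rule Levy_uniqueness)
  show "real_distribution \<mu>" "real_distribution \<nu>" by fact+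
  \<comment> \<open>The characteristic function is compared with its Taylor polynomial, whose
    coefficients are moments. For a law on [-1, 1] the n-th absolute moment is at most 1, so the
    remainder is at most 2 |t|^n / n!. Equal moments give both laws the same polynomials.\<close>
  have *: "integrable M (\<lambda>x. x ^ k)" "cmod (char M t - (\<Sum>k \<le> n. ((\<i> * t)^k / fact k) * (\<integral>x. x ^ k \<partial>M)))
       \<le> 2 * \<bar>t\<bar> ^ n / fact n"
    if "real_distribution M" "AE x in M. \<bar>x\<bar> \<le> 1" for M t and n k :: nat
  proof -
    interpret real_distribution M by fact
    have int: "integrable M (\<lambda>x. x ^ k)" "integrable M (\<lambda>x. \<bar>x\<bar> ^ k)" for k
      using that(2) by (auto intro!: integrable_const_bound[where B=1] simp: power_abs power_le_one elim!: eventually_mono)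
    show "integrable M (\<lambda>x. x ^ k)" by fact
    have "expectation (\<lambda>x. \<bar>x\<bar> ^ n) \<le> expectation (\<lambda>x. 1)"
      using that(2) by (intro integral_mono_AE int) (auto simp: power_le_one elim!: eventually_mono)
    then have "expectation (\<lambda>x. \<bar>x\<bar> ^ n) \<le> 1" using prob_space by simp
    then have "(2*\<bar>t\<bar>^n / fact n) * expectation (\<lambda>x. \<bar>x\<bar>^n) \<le> 2*\<bar>t\<bar>^n / fact n"
      by (intro mult_left_le) auto
    then show "cmod (char M t - (\<Sum>k \<le> n. ((\<i> * t)^k / fact k) * (\<integral>x. x ^ k \<partial>M)))
       \<le> 2 * \<bar>t\<bar> ^ n / fact n"
      by (rule order_trans[OF char_approx1[OF int(1)]])
  qed
  show "char \<mu> = char \<nu>"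
  proof
    fix t
    have "cmod (char \<mu> t - char \<nu> t) \<le> 4 * (\<bar>t\<bar> ^ n / fact n)" for n
    proof -
      have "cmod (char \<mu> t - char \<nu> t) \<le>
        cmod (char \<mu> t - (\<Sum>k \<le> n. ((\<i> * t)^k / fact k) * (\<integral>x. x ^ k \<partial>\<mu>))) +
        cmod (char \<nu> t - (\<Sum>k \<le> n. ((\<i> * t)^k / fact k) * (\<integral>x. x ^ k \<partial>\<nu>)))"
        using norm_triangle_ineq4[of "char \<mu> t - (\<Sum>k \<le> n. ((\<i> * t)^k / fact k) * (\<integral>x. x ^ k \<partial>\<nu>))"
            "char \<nu> t - (\<Sum>k \<le> n. ((\<i> * t)^k / fact k) * (\<integral>x. x ^ k \<partial>\<nu>))"]
        unfolding eq by simp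
      also have "\<dots> \<le> 4 * (\<bar>t\<bar> ^ n / fact n)"
        using *(2)[OF assms(1,3), where t=t and n=n] *(2)[OF assms(2,4), where t=t and n=n] by simp
      finally show ?thesis .
    qed
    moreover have "(\<lambda>n. 4 * (\<bar>t\<bar> ^ n / fact n)) \<longlonglongrightarrow> 4 * 0"
      using summable_LIMSEQ_zero[OF summable_exp[of "\<bar>t\<bar>"]]
      by (intro tendsto_intros) (simp add: divide_inverse mult.commute)
    ultimately have "cmod (char \<mu> t - char \<nu> t) \<le> 4 * 0"
      by (intro LIMSEQ_le_const) auto
    then show "char \<mu> t = char \<nu> t" by simp
  qed
qed

text \<open>The weight \<open>h\<close> is normalised to a probability and pushed forward by exp (-
  Z), almost surely into (0, 1]. There the k-th moment is the weighted Laplace transform of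
  \<open>Z\<close> at \<open>k\<close>, and - ln recovers the events of \<open>Z\<close>. The weight
  later carries the conditioning event and the other coordinates.\<close>

lemma tilted_law:
  fixes Z :: "'a \<Rightarrow> real" and h :: "'a \<Rightarrow> ennreal"
  assumes [measurable]: "h \<in> borel_measurable M" "Z \<in> borel_measurable M" "B \<in> sets borel"
    and h: "(\<integral>\<^sup>+x. h x \<partial>M) = c" and c: "c \<noteq> 0" "c \<noteq> \<infinity>" and Z: "AE x in M. 0 \<le> Z x"
  obtains \<mu> where "real_distribution \<mu>" "AE x in \<mu>. \<bar>x\<bar> \<le> 1"
    "\<And>k::nat. (\<integral>x. x ^ k \<partial>\<mu>) = enn2real ((\<integral>\<^sup>+x. h x * ennreal (exp (- (k * Z x))) \<partial>M) / c)"
    "emeasure \<mu> ((\<lambda>x. - ln x) -` B) * c = (\<integral>\<^sup>+x. h x * indicator B (Z x) \<partial>M)"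
proof
  define L where "L = distr (density M (\<lambda>x. h x / c)) borel (\<lambda>x. exp (- Z x))"
  have "emeasure (density M (\<lambda>x. h x / c)) (space M) = (\<integral>\<^sup>+x. h x / c \<partial>M)"
    by (subst emeasure_density) (auto intro!: nn_integral_cong)
  also have "\<dots> = 1"
    by (subst nn_integral_divide) (use c in \<open>auto simp: h ennreal_divide_self less_top\<close>)
  finally have 1: "prob_space (density M (\<lambda>x. h x / c))"
    by (intro prob_spaceI) simp
  then show "real_distribution L"
    by (auto simp: L_def real_distribution_def real_distribution_axioms_def intro!: prob_space.prob_space_distr)
  then interpret L: real_distribution L .
  have pos: "AE x in L. 0 < x \<and> x \<le> 1"
    unfolding L_def using Z by (subst AE_distr_iff) (auto simp: AE_density elim!: eventually_mono)
  then show "AE x in L. \<bar>x\<bar> \<le> 1" by eventually_elim auto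
  show "(\<integral>x. x ^ k \<partial>L) = enn2real ((\<integral>\<^sup>+x. h x * ennreal (exp (- (k * Z x))) \<partial>M) / c)" for k :: nat
  proof -
    have "AE x in L. 0 \<le> x ^ k" using pos by eventually_elim simp
    then have "(\<integral>x. x ^ k \<partial>L) = enn2real (\<integral>\<^sup>+x. ennreal (x ^ k) \<partial>L)"
      by (intro integral_eq_nn_integral) (auto simp: L_def)
    also have "(\<integral>\<^sup>+x. ennreal (x ^ k) \<partial>L) = (\<integral>\<^sup>+x. h x * ennreal (exp (- (k * Z x))) / c \<partial>M)"
      unfolding L_def by (subst nn_integral_distr, simp, simp, subst nn_integral_density)
        (auto intro!: nn_integral_cong simp: exp_of_nat_mult[symmetric] divide_ennreal_def ac_simps)
    also have "\<dots> = (\<integral>\<^sup>+x. h x * ennreal (exp (- (k * Z x))) \<partial>M) / c"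
      by (rule nn_integral_divide) simp
    finally show ?thesis .
  qed
  have [measurable]: "(\<lambda>x::real. - ln x) -` B \<in> sets borel"
    by (intro measurable_sets_borel[of _ borel]) auto
  have "emeasure L ((\<lambda>x. - ln x) -` B) = (\<integral>\<^sup>+x. indicator ((\<lambda>x. - ln x) -` B) x \<partial>L)"
    by (intro nn_integral_indicator[symmetric]) (auto simp: L_def)
  also have "\<dots> = (\<integral>\<^sup>+x. h x * indicator B (Z x) / c \<partial>M)"
    unfolding L_def by (subst nn_integral_distr, simp, measurable, subst nn_integral_density)
      (auto intro!: nn_integral_cong simp: divide_ennreal_def ac_simps indicator_def)
  also have "\<dots> = (\<integral>\<^sup>+x. h x * indicator B (Z x) \<partial>M) / c"
    by (rule nn_integral_divide) simp
  finally show "emeasure L ((\<lambda>x. - ln x) -` B) * c = (\<integral>\<^sup>+x. h x * indicator B (Z x) \<partial>M)"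
    using c by (simp add: ennreal_divide_times ennreal_divide_self less_top)
qed

text \<open>Integer arguments \<open>m\<close> suffice, since they are the moments of the bounded
  variable exp (- X). Both tilted laws have the same normalising constant, by the case m = 0 of the
  hypothesis; if it vanishes there is nothing to normalise and both sides are 0.\<close>

lemma laplace_unique:
  fixes X :: "'a \<Rightarrow> real" and Y :: "'b \<Rightarrow> real" and f :: "'a \<Rightarrow> ennreal" and g :: "'b \<Rightarrow> ennreal"
  assumes [measurable]: "X \<in> borel_measurable P" "f \<in> borel_measurable P"
      "Y \<in> borel_measurable Q" "g \<in> borel_measurable Q"
    and X0: "AE x in P. 0 \<le> X x" and Y0: "AE y in Q. 0 \<le> Y y"
    and fin: "(\<integral>\<^sup>+x. f x \<partial>P) < \<infinity>"
    and eq: "\<And>m::nat. (\<integral>\<^sup>+x. f x * ennreal (exp (- (m * X x))) \<partial>P) = (\<integral>\<^sup>+y. g y * ennreal (exp (- (m * Y y))) \<partial>Q)"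
    and [measurable]: "B \<in> sets borel"
  shows "(\<integral>\<^sup>+x. f x * indicator B (X x) \<partial>P) = (\<integral>\<^sup>+y. g y * indicator B (Y y) \<partial>Q)"
proof -
  define c where "c = (\<integral>\<^sup>+x. f x \<partial>P)"
  have cg: "(\<integral>\<^sup>+x. g x \<partial>Q) = c" using eq[of 0] by (simp add: c_def)
  show ?thesis
  proof (cases "c = 0")
    case True
    then have "AE x in P. f x = 0" "AE x in Q. g x = 0"
      using cg nn_integral_0_iff_AE[of f P] nn_integral_0_iff_AE[of g Q] by (auto simp: c_def)
    then have "AE x in P. f x * indicator B (X x) = 0" "AE x in Q. g x * indicator B (Y x) = 0"
      by (auto elim!: eventually_mono)
    then show ?thesis
      using nn_integral_0_iff_AE[of "\<lambda>x. f x * indicator B (X x)" P] nn_integral_0_iff_AE[of "\<lambda>x. g x * indicator B (Y x)" Q] by simp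
  next
    case False
    have c: "c \<noteq> \<infinity>" using fin by (simp add: c_def)
    obtain \<mu> where 1: "real_distribution \<mu>" "AE x in \<mu>. \<bar>x\<bar> \<le> 1"
      "\<And>k::nat. (\<integral>x. x ^ k \<partial>\<mu>) = enn2real ((\<integral>\<^sup>+x. f x * ennreal (exp (- (k * X x))) \<partial>P) / c)"
      "emeasure \<mu> ((\<lambda>x. - ln x) -` B) * c = (\<integral>\<^sup>+x. f x * indicator B (X x) \<partial>P)"
      using tilted_law[OF assms(2,1,9) c_def[symmetric] False c X0] by blast
    obtain \<nu> where 2: "real_distribution \<nu>" "AE x in \<nu>. \<bar>x\<bar> \<le> 1"
      "\<And>k::nat. (\<integral>x. x ^ k \<partial>\<nu>) = enn2real ((\<integral>\<^sup>+x. g x * ennreal (exp (- (k * Y x))) \<partial>Q) / c)"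
      "emeasure \<nu> ((\<lambda>x. - ln x) -` B) * c = (\<integral>\<^sup>+x. g x * indicator B (Y x) \<partial>Q)"
      using tilted_law[OF assms(4,3,9) cg False c Y0] by blast
    have "\<mu> = \<nu>"
      by (rule moments_determine_distribution[OF 1(1) 2(1) 1(2) 2(2)]) (simp only: 1(3) 2(3) eq)
    then show ?thesis
      using 1(4) 2(4) by simp
  qed
qed

text \<open>Coordinates are exchanged one at a time. With the exponentials of the first
  \<open>n\<close> variables as weight, uniqueness in the last one replaces its exponential by an
  indicator; this indicator then joins the weight for the induction hypothesis, which is why
  \<open>f\<close> and \<open>g\<close> are arbitrary.\<close>

lemma laplace_unique_multi:
  fixes X :: "nat \<Rightarrow> 'a \<Rightarrow> real" and Y :: "nat \<Rightarrow> 'b \<Rightarrow> real"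
  assumes X[measurable]: "\<And>i. i < n \<Longrightarrow> X i \<in> borel_measurable P" "f \<in> borel_measurable P"
    and Y[measurable]: "\<And>i. i < n \<Longrightarrow> Y i \<in> borel_measurable Q" "g \<in> borel_measurable Q"
    and X0: "\<And>i. i < n \<Longrightarrow> AE x in P. 0 \<le> X i x" and Y0: "\<And>i. i < n \<Longrightarrow> AE y in Q. 0 \<le> Y i y"
    and fin: "(\<integral>\<^sup>+x. f x \<partial>P) < \<infinity>"
    and eq: "\<And>m::nat \<Rightarrow> nat. (\<integral>\<^sup>+x. f x * ennreal (exp (- (\<Sum>i<n. m i * X i x))) \<partial>P)
          = (\<integral>\<^sup>+y. g y * ennreal (exp (- (\<Sum>i<n. m i * Y i y))) \<partial>Q)"
    and B: "\<And>i. i < n \<Longrightarrow> B i \<in> sets borel"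
  shows "(\<integral>\<^sup>+x. f x * (\<Prod>i<n. indicator (B i) (X i x)) \<partial>P) = (\<integral>\<^sup>+y. g y * (\<Prod>i<n. indicator (B i) (Y i y)) \<partial>Q)"
  using assms
proof (induction n arbitrary: f g)
  case 0
  from 0(8)[of "\<lambda>_. 0"] show ?case by simp
next
  case (Suc n)
  have [measurable]: "f \<in> borel_measurable P" "g \<in> borel_measurable Q" "X n \<in> borel_measurable P"
    "Y n \<in> borel_measurable Q" "B n \<in> sets borel" using Suc.prems by auto
  have [measurable]: "\<And>i. i < n \<Longrightarrow> X i \<in> borel_measurable P" "\<And>i. i < n \<Longrightarrow> Y i \<in> borel_measurable Q"
    using Suc.prems by auto
  have fin: "(\<integral>\<^sup>+x. f x * h x \<partial>P) < \<infinity>" if "AE x in P. h x \<le> 1" for h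
  proof -
    have "(\<integral>\<^sup>+x. f x * h x \<partial>P) \<le> (\<integral>\<^sup>+x. f x \<partial>P)"
      using that by (intro nn_integral_mono_AE) (auto elim!: eventually_mono intro!: mult_left_le)
    then show ?thesis using Suc.prems(7) by auto
  qed
  have X0: "AE x in P. 0 \<le> (\<Sum>i<n. m i * X i x)" for m :: "nat \<Rightarrow> nat"
  proof -
    have "AE x in P. \<forall>i\<in>{..<n}. 0 \<le> X i x"
      using Suc.prems(5) by (subst AE_ball_countable) auto
    then show ?thesis by (auto elim!: eventually_mono intro!: sum_nonneg)
  qed
  have "(\<integral>\<^sup>+x. (f x * indicator (B n) (X n x)) * (\<Prod>i<n. indicator (B i) (X i x)) \<partial>P) =
     (\<integral>\<^sup>+y. (g y * indicator (B n) (Y n y)) * (\<Prod>i<n. indicator (B i) (Y i y)) \<partial>Q)"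
  proof (rule Suc.IH)
    show "(\<integral>\<^sup>+x. f x * indicator (B n) (X n x) \<partial>P) < \<infinity>"
      by (intro fin) (auto simp: indicator_def)
    fix m :: "nat \<Rightarrow> nat"
    have "(\<integral>\<^sup>+x. (f x * ennreal (exp (- (\<Sum>i<n. m i * X i x)))) * indicator (B n) (X n x) \<partial>P) =
      (\<integral>\<^sup>+y. (g y * ennreal (exp (- (\<Sum>i<n. m i * Y i y)))) * indicator (B n) (Y n y) \<partial>Q)"
    proof (rule laplace_unique)
      show "(\<integral>\<^sup>+x. f x * ennreal (exp (- (\<Sum>i<n. m i * X i x))) \<partial>P) < \<infinity>"
        using X0[of m] by (intro fin) (auto elim!: eventually_mono)
      fix k :: nat
      from Suc.prems(8)[of "m(n := k)"]
      show "(\<integral>\<^sup>+x. f x * ennreal (exp (- (\<Sum>i<n. m i * X i x))) * ennreal (exp (- (k * X n x))) \<partial>P) =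
         (\<integral>\<^sup>+x. g x * ennreal (exp (- (\<Sum>i<n. m i * Y i x))) * ennreal (exp (- (k * Y n x))) \<partial>Q)"
        by (simp add: mult.assoc ennreal_mult[symmetric] exp_add[symmetric] add.commute)
    qed (use Suc.prems in auto)
    then show "(\<integral>\<^sup>+x. (f x * indicator (B n) (X n x)) * ennreal (exp (- (\<Sum>i<n. m i * X i x))) \<partial>P) =
      (\<integral>\<^sup>+y. (g y * indicator (B n) (Y n y)) * ennreal (exp (- (\<Sum>i<n. m i * Y i y))) \<partial>Q)"
      by (simp add: ac_simps)
  qed (use Suc.prems in auto)
  then show ?case by (simp add: ac_simps)
qed

section \<open>The hold-jump chain\<close>

lemma powr_beta_integral:
  fixes \<theta> c :: real
  assumes "0 < \<theta>" "0 \<le> c"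
  shows "(\<integral>\<^sup>+u\<in>{0..c}. ennreal (\<theta> * u powr (\<theta> - 1)) \<partial>lborel) = ennreal (c powr \<theta>)"
proof -
  have "((\<lambda>u. \<theta> * u powr (\<theta> - 1)) has_integral \<theta> * (c powr (\<theta> - 1 + 1) / (\<theta> - 1 + 1))) {0..c}"
    using assms by (intro has_integral_mult_right has_integral_powr_from_0) auto
  with assms show ?thesis
    by (subst nn_integral_has_integral_lebesgue'[where I="c powr \<theta>"]) auto
qed

lemma emeasure_beta1_lessThan:
  assumes "0 < \<theta>" "0 \<le> c" "c \<le> 1"
  shows "emeasure (beta1_law \<theta>) {0<..<c} = ennreal (c powr \<theta>)"
proof -
  have "emeasure (beta1_law \<theta>) {0<..<c}
      = (\<integral>\<^sup>+u. ennreal (\<theta> * u powr (\<theta> - 1)) * indicator {0<..<1} u * indicator {0<..<c} u \<partial>lborel)"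
    unfolding beta1_law_def by (subst emeasure_density) auto
  also have "\<dots> = (\<integral>\<^sup>+u\<in>{0..c}. ennreal (\<theta> * u powr (\<theta> - 1)) \<partial>lborel)"
    using AE_lborel_singleton[of 0] AE_lborel_singleton[of c] assms
    by (intro nn_integral_cong_AE) (auto elim!: eventually_elim2 simp: indicator_def)
  finally show ?thesis using powr_beta_integral[OF assms(1,2)] by simp
qed

lemma AE_beta1: "AE b in beta1_law \<theta>. 0 < b \<and> b < 1"
  unfolding beta1_law_def by (subst AE_density) (auto simp: indicator_def)

lemma sets_beta1 [measurable_cong, simp]: "sets (beta1_law \<theta>) = sets borel"
  and space_beta1 [simp]: "space (beta1_law \<theta>) = UNIV"
  by (auto simp: beta1_law_def)

lemma prob_space_beta1: "0 < \<theta> \<Longrightarrow> prob_space (beta1_law \<theta>)"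
proof (rule prob_spaceI)
  assume \<theta>: "0 < \<theta>"
  have "emeasure (beta1_law \<theta>) (space (beta1_law \<theta>)) = emeasure (beta1_law \<theta>) {0<..<1}"
    using AE_beta1[of \<theta>] by (intro emeasure_eq_AE) auto
  then show "emeasure (beta1_law \<theta>) (space (beta1_law \<theta>)) = 1"
    using emeasure_beta1_lessThan[of \<theta> 1] \<theta> by simp
qed

lemma emeasure_hold_law:
  assumes "0 < \<theta>" "0 < s"
  shows "emeasure (hold_law \<theta> s) {x<..} = ennreal ((s / max s x) powr \<theta>)"
proof -
  have "emeasure (hold_law \<theta> s) {x<..} = emeasure (beta1_law \<theta>) ((\<lambda>b. s / b) -` {x<..})"
    unfolding hold_law_def by (subst emeasure_distr) auto
  also have "\<dots> = emeasure (beta1_law \<theta>) {0<..<s / max s x}"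
  proof (rule emeasure_eq_AE)
    show "AE b in beta1_law \<theta>. (b \<in> (\<lambda>b. s / b) -` {x<..}) = (b \<in> {0<..<s / max s x})"
      using AE_beta1
    proof eventually_elim
      fix b :: real assume b: "0 < b \<and> b < 1"
      \<comment> \<open>Since b < 1, the value s / b exceeds s in any case, so the threshold may be
        raised to \<open>max s x\<close>. The quotient s / max s x then lies in (0, 1], where the
        beta distribution function is a power.\<close>
      have "(x < s / b) = (max s x < s / b)"
        using b assms by (auto simp: field_simps)
      also have "\<dots> = (b < s / max s x)"
        using b assms by (auto simp: field_simps max_def)
      finally show "(b \<in> (\<lambda>b. s / b) -` {x<..}) = (b \<in> {0<..<s / max s x})" using b by auto
    qed
    show "(\<lambda>b. s / b) -` {x<..} \<in> sets (beta1_law \<theta>)"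
      by (simp, intro measurable_sets_borel[of _ borel]) auto
  qed auto
  also have "\<dots> = ennreal ((s / max s x) powr \<theta>)"
    using assms by (intro emeasure_beta1_lessThan) auto
  finally show ?thesis .
qed

text \<open>Measures on the line that are finite and equal on all half-lines (x, \<infinity>)
  coincide; both tails here are (s / max s x) powr \<theta>.\<close>

lemma hold_law_density:
  assumes "0 < \<theta>" "0 < s"
  shows "hold_law \<theta> s =
    density lborel (\<lambda>x. ennreal (\<theta> * x powr (- \<theta> - 1) * s powr \<theta>) * indicator {s<..} x)" (is "_ = ?D")
proof (rule measure_eqI_lessThan)
  show "emeasure (hold_law \<theta> s) {x<..} < \<infinity>" for x
    using assms by (simp add: emeasure_hold_law)
  show "emeasure (hold_law \<theta> s) {x<..} = emeasure ?D {x<..}" for x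
  proof -
    define m where "m = max s x"
    have m: "0 < m" "s \<le> m" "x \<le> m" "x < s \<longrightarrow> m = s" "s \<le> x \<longrightarrow> m = x" using assms by (auto simp: m_def)
    have "((\<lambda>x. \<theta> * s powr \<theta> * x powr (- \<theta> - 1)) has_integral \<theta> * s powr \<theta> * (- (m powr (- \<theta> - 1 + 1)) / (- \<theta> - 1 + 1))) {m..}"
      using assms m by (intro has_integral_mult_right has_integral_powr_to_inf) auto
    also have "\<theta> * s powr \<theta> * (- (m powr (- \<theta> - 1 + 1)) / (- \<theta> - 1 + 1)) = (s / m) powr \<theta>"
      using assms m by (simp add: powr_divide powr_minus field_simps)
    finally have int: "((\<lambda>x. \<theta> * s powr \<theta> * x powr (- \<theta> - 1)) has_integral (s / m) powr \<theta>) {m..}" .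
    have "emeasure ?D {x<..} = (\<integral>\<^sup>+x'. ennreal (\<theta> * x' powr (- \<theta> - 1) * s powr \<theta>) * indicator {s<..} x' * indicator {x<..} x' \<partial>lborel)"
      by (subst emeasure_density) auto
    also have "\<dots> = (\<integral>\<^sup>+x\<in>{m..}. ennreal (\<theta> * s powr \<theta> * x powr (- \<theta> - 1)) \<partial>lborel)"
      using AE_lborel_singleton[of m] m
      by (intro nn_integral_cong_AE) (auto elim!: eventually_mono simp: indicator_def ac_simps)
    also have "\<dots> = (s / m) powr \<theta>"
      using assms by (intro nn_integral_has_integral_lebesgue'[OF _ int]) auto
    finally show ?thesis using assms by (simp add: emeasure_hold_law m_def)
  qed
qed (auto simp: hold_law_def)

lemma nn_integral_beta1_hold:
  assumes "0 < \<theta>" "0 < s" and [measurable]: "f \<in> borel_measurable borel"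
  shows "(\<integral>\<^sup>+b. f (s / b) \<partial>beta1_law \<theta>)
    = (\<integral>\<^sup>+x\<in>{s<..}. ennreal (\<theta> * x powr (- \<theta> - 1) * s powr \<theta>) * f x \<partial>lborel)"
proof -
  have "(\<integral>\<^sup>+b. f (s / b) \<partial>beta1_law \<theta>) = (\<integral>\<^sup>+x. f x \<partial>hold_law \<theta> s)"
    unfolding hold_law_def by (subst nn_integral_distr) auto
  then show ?thesis
    unfolding hold_law_density[OF assms(1,2)] by (subst (asm) nn_integral_density) (auto simp: ac_simps)
qed

text \<open>The mean is below 1. This makes the products of successive beta variables summable in
  mean and so drives the hold times to infinity.\<close>

lemma nn_integral_beta1_id:
  assumes "0 < \<theta>"
  shows "(\<integral>\<^sup>+b. ennreal b \<partial>beta1_law \<theta>) = ennreal (\<theta> / (\<theta> + 1))"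
proof -
  have "(\<integral>\<^sup>+b. ennreal b \<partial>beta1_law \<theta>)
      = (\<integral>\<^sup>+u. ennreal (\<theta> * u powr (\<theta> - 1)) * indicator {0<..<1} u * ennreal u \<partial>lborel)"
    unfolding beta1_law_def by (subst nn_integral_density) auto
  \<comment> \<open>Up to the factor \<theta> / (\<theta> + 1), u times the beta density is the
    density of beta(\<theta> + 1, 1); the endpoints form a null set.\<close>
  also have "\<dots> = (\<integral>\<^sup>+u. ennreal (\<theta> / (\<theta> + 1)) * (ennreal ((\<theta> + 1) * u powr (\<theta> + 1 - 1)) * indicator {0..1} u) \<partial>lborel)"
    using AE_lborel_singleton[of 0] AE_lborel_singleton[of 1]
  proof (intro nn_integral_cong_AE, eventually_elim)
    fix u :: real assume "u \<noteq> 0" "u \<noteq> 1"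
    moreover have "\<theta> * u powr (\<theta> - 1) * u = \<theta> / (\<theta> + 1) * ((\<theta> + 1) * u powr (\<theta> + 1 - 1))" if "0 < u"
      using that assms by (simp add: powr_diff)
    ultimately show "ennreal (\<theta> * u powr (\<theta> - 1)) * indicator {0<..<1} u * ennreal u =
      ennreal (\<theta> / (\<theta> + 1)) * (ennreal ((\<theta> + 1) * u powr (\<theta> + 1 - 1)) * indicator {0..1} u)"
      using assms by (auto simp: indicator_def ennreal_mult[symmetric] simp del: add_diff_cancel_right')
  qed
  also have "\<dots> = ennreal (\<theta> / (\<theta> + 1))"
    using powr_beta_integral[of "\<theta> + 1" 1] assms by (subst nn_integral_cmult) auto
  finally show ?thesis .
qed

text \<open>The recursion adds the last round. This version peels off the first one, as needed to
  exploit that the remaining rounds are an independent copy of all rounds.\<close>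

lemma hold_jump_chain_Suc:
  "hold_jump_chain w (s, t) (Suc n) = hold_jump_chain (\<lambda>i. w (Suc i)) (s / fst (w 0), t + s / fst (w 0) * snd (w 0)) n"
  by (induction n) (auto simp: Let_def split: prod.splits)

lemma fst_hold_jump_chain: "fst (hold_jump_chain w x n) = fst x / (\<Prod>i<n. fst (w i))"
  by (induction n) (auto simp: Let_def split: prod.splits)

lemma snd_hold_jump_chain:
  "snd (hold_jump_chain w x n) = snd x + (\<Sum>i<n. fst (hold_jump_chain w x (Suc i)) * snd (w i))"
  by (induction n) (auto simp: Let_def split: prod.splits)

text \<open>Times do not see the initial level and levels are merely shifted by it, so the chain can
  be analysed from level 0.\<close>

lemma fst_hold_jump_chain_0: "fst (hold_jump_chain w (s, t) n) = fst (hold_jump_chain w (s, 0) n)"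
  by (simp add: fst_hold_jump_chain)

lemma snd_hold_jump_chain_0: "snd (hold_jump_chain w (s, t) n) = t + snd (hold_jump_chain w (s, 0) n)"
  by (simp add: snd_hold_jump_chain fst_hold_jump_chain del: hold_jump_chain.simps)

lemma hold_jump_path_0: "hold_jump_path w (s, t) u = t + hold_jump_path w (s, 0) u"
  unfolding hold_jump_path_def by (subst snd_hold_jump_chain_0) (simp add: fst_hold_jump_chain del: hold_jump_chain.simps)

section \<open>Sequences of independent rounds\<close>

locale hold_jump = D: prob_space D for D :: "real measure" +
  fixes \<theta> :: real
  assumes \<theta>: "0 < \<theta>" and sets_D [measurable_cong, simp]: "sets D = sets borel" and D_pos: "AE j in D. 0 < j"
begin

lemma space_D [simp]: "space D = UNIV"
  using sets_eq_imp_space_eq[OF sets_D] by simp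

sublocale B: prob_space "beta1_law \<theta>" by (rule prob_space_beta1[OF \<theta>])
sublocale BD: pair_prob_space "beta1_law \<theta>" D ..
sublocale W: sequence_space "beta1_law \<theta> \<Otimes>\<^sub>M D" ..

abbreviation "step_law \<equiv> beta1_law \<theta> \<Otimes>\<^sub>M D"

abbreviation "W \<equiv> \<Pi>\<^sub>M n\<in>(UNIV :: nat set). step_law"

text \<open>The times of the chain are the starting time divided by these products, so their
  convergence to 0 says that the construction covers the whole half-line.\<close>

definition good :: "(nat \<Rightarrow> real \<times> real) \<Rightarrow> bool" where
  "good w \<longleftrightarrow> (\<forall>i. 0 < fst (w i) \<and> fst (w i) < 1 \<and> 0 < snd (w i)) \<and> (\<lambda>n. \<Prod>i<n. fst (w i)) \<longlonglongrightarrow> 0"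

text \<open>The sequence of rounds is a first round followed by an independent copy of the whole
  sequence. Inductions along the chain rest on this decomposition.\<close>

lemma nn_integral_W:
  assumes [measurable]: "f \<in> borel_measurable W"
  shows "(\<integral>\<^sup>+w. f w \<partial>W) = (\<integral>\<^sup>+p. (\<integral>\<^sup>+w. f (case_nat p w) \<partial>W) \<partial>step_law)"
proof -
  have "(\<integral>\<^sup>+w. f w \<partial>W) = (\<integral>\<^sup>+w. f w \<partial>distr (step_law \<Otimes>\<^sub>M W) W (\<lambda>(s, \<omega>). case_nat s \<omega>))"
    by (simp add: W.PiM_iter)
  also have "\<dots> = (\<integral>\<^sup>+z. f (case_nat (fst z) (snd z)) \<partial>(step_law \<Otimes>\<^sub>M W))"
    by (subst nn_integral_distr) (auto simp: case_prod_beta)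
  also have "\<dots> = (\<integral>\<^sup>+p. (\<integral>\<^sup>+w. f (case_nat p w) \<partial>W) \<partial>step_law)"
    by (subst W.nn_integral_fst[symmetric]) auto
  finally show ?thesis .
qed

lemma nn_integral_prod_W:
  "(\<integral>\<^sup>+w. (\<Prod>i<n. ennreal (fst (w i))) \<partial>W) = ennreal (\<theta> / (\<theta> + 1)) ^ n"
proof (induction n)
  case 0 then show ?case by (simp add: W.P.emeasure_space_1)
next
  case (Suc n)
  have "(\<integral>\<^sup>+w. (\<Prod>i<Suc n. ennreal (fst (w i))) \<partial>W)
    = (\<integral>\<^sup>+p. (\<integral>\<^sup>+w. ennreal (fst p) * (\<Prod>i<n. ennreal (fst (w i))) \<partial>W) \<partial>step_law)"
    by (subst nn_integral_W) (auto simp del: prod.lessThan_Suc simp: prod.lessThan_Suc_shift)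
  also have "\<dots> = (\<integral>\<^sup>+p. ennreal (fst p) * ennreal (\<theta> / (\<theta> + 1)) ^ n \<partial>step_law)"
    by (subst nn_integral_cmult) (auto simp: Suc)
  also have "\<dots> = (\<integral>\<^sup>+b. (\<integral>\<^sup>+j. ennreal b * ennreal (\<theta> / (\<theta> + 1)) ^ n \<partial>D) \<partial>beta1_law \<theta>)"
    by (subst D.nn_integral_fst[symmetric]) auto
  also have "\<dots> = ennreal (\<theta> / (\<theta> + 1)) ^ Suc n"
    using nn_integral_beta1_id[OF \<theta>] by (simp add: D.emeasure_space_1[simplified] nn_integral_multc)
  finally show ?case .
qed

text \<open>The means of the products form a geometric series with ratio \<theta> / (\<theta> + 1) <
  1. The sum of the products is therefore almost surely finite, and its terms tend to 0.\<close>

lemma AE_good: "AE w in W. good w"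
proof -
  have "AE p in step_law. 0 < fst p \<and> fst p < 1 \<and> 0 < snd p"
  proof (rule BD.AE_pair_measure)
    show "AE b in beta1_law \<theta>. AE j in D. 0 < fst (b, j) \<and> fst (b, j) < 1 \<and> 0 < snd (b, j)"
      using AE_beta1 by eventually_elim (use D_pos in auto)
  qed measurable
  then have "AE w in W. 0 < fst (w i) \<and> fst (w i) < 1 \<and> 0 < snd (w i)" for i
    by (intro AE_PiM_component) (auto intro: W.prob_space)
  then have 1: "AE w in W. \<forall>i. 0 < fst (w i) \<and> fst (w i) < 1 \<and> 0 < snd (w i)"
    by (simp add: AE_all_countable)
  have "(\<integral>\<^sup>+w. (\<Sum>n. \<Prod>i<n. ennreal (fst (w i))) \<partial>W) = (\<Sum>n. ennreal ((\<theta> / (\<theta> + 1)) ^ n))"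
    using \<theta> by (subst nn_integral_suminf) (auto simp: nn_integral_prod_W ennreal_power)
  also have "\<dots> < \<infinity>"
    using \<theta> by (subst suminf_ennreal2) (auto intro!: summable_geometric)
  finally have "AE w in W. (\<Sum>n. \<Prod>i<n. ennreal (fst (w i))) \<noteq> \<infinity>"
    by (intro nn_integral_PInf_AE) auto
  with 1 show ?thesis
  proof eventually_elim
    fix w :: "nat \<Rightarrow> real \<times> real" assume w: "\<forall>i. 0 < fst (w i) \<and> fst (w i) < 1 \<and> 0 < snd (w i)"
      and fin: "(\<Sum>n. \<Prod>i<n. ennreal (fst (w i))) \<noteq> \<infinity>"
    have "(\<Prod>i<n. ennreal (fst (w i))) = ennreal (\<Prod>i<n. fst (w i))" for n
      using w by (subst prod_ennreal) (auto intro: less_imp_le)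
    then have "summable (\<lambda>n. \<Prod>i<n. fst (w i))"
      using fin w by (intro summable_suminf_not_top) (auto intro!: less_imp_le[OF prod_pos])
    then show "good w" using w by (auto simp: good_def dest: summable_LIMSEQ_zero)
  qed
qed

end

text \<open>\<open>\<Psi> l r\<close> stands for - log E exp (- l T(r)). The chain is analysed from
  its derivative in \<open>r\<close> alone: \<theta> / r is the intensity of jumps at time r, and
  the other factor is the mean of 1 - exp (- l r J).\<close>

locale hold_jump_exponent = hold_jump +
  fixes \<Psi> :: "real \<Rightarrow> real \<Rightarrow> real"
  assumes \<Psi>_deriv: "\<And>l r. 0 \<le> l \<Longrightarrow> 0 < r \<Longrightarrow>
     (\<Psi> l has_real_derivative \<theta> / r * (1 - (\<integral>j. exp (- (l * r * j)) \<partial>D))) (at r)"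
begin

lemma integrable_exp: "0 \<le> c \<Longrightarrow> integrable D (\<lambda>j. exp (- (c * j)))"
  using D_pos by (intro D.integrable_const_bound[where B=1]) (auto elim!: eventually_mono)

lemma integral_exp_le_1:
  assumes "0 \<le> c" shows "(\<integral>j. exp (- (c * j)) \<partial>D) \<le> 1"
proof -
  have "AE j in D. exp (- (c * j)) \<le> 1"
    using D_pos by eventually_elim (use assms in simp)
  then have "(\<integral>j. exp (- (c * j)) \<partial>D) \<le> (\<integral>j. 1 \<partial>D)"
    by (intro integral_mono_AE integrable_exp assms) auto
  then show ?thesis using D.prob_space by simp
qed

lemma \<Psi>_mono:
  assumes "0 \<le> l" "0 < r" "r \<le> r'" shows "\<Psi> l r \<le> \<Psi> l r'"
proof (rule DERIV_nonneg_imp_nondecreasing[OF assms(3)])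
  fix x assume "r \<le> x" "x \<le> r'"
  then show "\<exists>y. (\<Psi> l has_real_derivative y) (at x) \<and> 0 \<le> y"
    using \<Psi>_deriv[of l x] assms integral_exp_le_1[of "l * x"]
    by (intro exI[of _ "\<theta> / x * (1 - (\<integral>j. exp (- (l * x * j)) \<partial>D))"] conjI mult_nonneg_nonneg) (use \<theta> in auto)
qed

lemma \<Psi>_isCont: "0 \<le> l \<Longrightarrow> 0 < r \<Longrightarrow> isCont (\<Psi> l) r"
  using \<Psi>_deriv DERIV_isCont by blast

lemma \<Psi>_max_continuous:
  assumes "0 \<le> l" shows "continuous_on {0<..} (\<lambda>x. \<Psi> l (max x y))"
proof -
  have "continuous_on {0<..} (\<Psi> l)"
    using assms by (intro continuous_at_imp_continuous_on) (auto intro: \<Psi>_isCont)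
  then show ?thesis by (rule continuous_on_compose2) (auto intro!: continuous_intros)
qed

end

section \<open>Laplace functional of the increments over a time grid\<close>

locale hold_jump_steps = hold_jump_exponent +
  fixes n :: nat and u l :: "nat \<Rightarrow> real"
  assumes u_mono: "\<And>i k. i \<le> k \<Longrightarrow> u i \<le> u k" and u_pos: "0 < u 0" and l_nonneg: "\<And>i. 0 \<le> l i"
begin

lemma u_pos': "0 < u i" using u_mono[of 0 i] u_pos by simp

text \<open>The value that the Laplace functional of the grid increments, with weights
  \<open>l\<close>, is going to have for a process started at time \<open>x\<close>. Replacing grid
  points by their maximum with \<open>x\<close> cuts away the part of each interval before the
  start.\<close>

definition V :: "real \<Rightarrow> real" where
  "V x = exp (- (\<Sum>i<n. \<Psi> (l i) (max x (u (Suc i))) - \<Psi> (l i) (max x (u i))))"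

text \<open>The factor that a jump of height r j at time \<open>r\<close> contributes to this
  functional; it is 1 when \<open>r\<close> lies in none of the intervals (u_i, u_(i+1)].\<close>

definition e :: "real \<Rightarrow> real \<Rightarrow> real" where
  "e r j = exp (- (\<Sum>i<n. if u i < r \<and> r \<le> u (Suc i) then l i * r * j else 0))"

lemma V_pos: "0 < V x" by (simp add: V_def)

lemma V_le_1: "0 < x \<Longrightarrow> V x \<le> 1"
  unfolding V_def using u_pos' by (auto intro!: sum_nonneg \<Psi>_mono l_nonneg u_mono max.mono)

lemma V_eq_1: "u n \<le> x \<Longrightarrow> V x = 1"
proof -
  assume "u n \<le> x"
  then have "max x (u i) = x" if "i \<le> n" for i using u_mono[OF that] by (auto simp: max_def)
  then show ?thesis by (simp add: V_def)
qed

lemma e_measurable [measurable (raw)]: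
  assumes [measurable]: "f \<in> borel_measurable M" "g \<in> borel_measurable M"
  shows "(\<lambda>x. e (f x) (g x)) \<in> borel_measurable M"
  unfolding e_def by measurable

lemma e_pos: "0 < e r j" by (simp add: e_def)

lemma e_le_1: "0 < r \<Longrightarrow> 0 \<le> j \<Longrightarrow> e r j \<le> 1"
  unfolding e_def by (auto intro!: sum_nonneg l_nonneg mult_nonneg_nonneg)

lemma e_eq_1: "u n < r \<Longrightarrow> e r j = 1"
proof -
  assume "u n < r"
  then have "\<not> r \<le> u (Suc i)" if "i < n" for i using u_mono[of "Suc i" n] that by simp
  then show ?thesis unfolding e_def by (auto intro!: sum.neutral)
qed

lemma V_continuous: "continuous_on {0<..} V"
  unfolding V_def by (intro continuous_intros \<Psi>_max_continuous l_nonneg)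

text \<open>\<open>V\<close> is controlled only on (0, \<infinity>), where it is continuous.
  Composing with \<open>max 0\<close> extends it measurably to the line without changing it at
  positive times.\<close>

lemma V_measurable [measurable]: "(\<lambda>x. V (max 0 x)) \<in> borel_measurable borel"
proof -
  have "(\<lambda>x. if x \<in> {0<..} then V x else V 0) \<in> borel_measurable borel"
    by (intro borel_measurable_continuous_on_if V_continuous) auto
  also have "(\<lambda>x. if x \<in> {0<..} then V x else V 0) = (\<lambda>x. V (max 0 x))"
    by (auto simp: max_def)
  finally show ?thesis .
qed

definition c :: "real \<Rightarrow> real" where "c x = (\<integral>j. e x j \<partial>D)"

text \<open>Near \<open>x\<close> the clipped difference is constant, or \<Psi>(b) - \<Psi>(x), or
  0, according to the position of \<open>x\<close>; kinks can occur at \<open>a\<close> and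
  \<open>b\<close> only.\<close>

lemma \<Psi>_max_deriv:
  assumes "0 < x" "x \<noteq> a" "x \<noteq> b" "a \<le> b" "0 \<le> k"
  shows "((\<lambda>x. \<Psi> k (max x b) - \<Psi> k (max x a)) has_real_derivative
    (if a < x \<and> x \<le> b then - (\<theta> / x * (1 - (\<integral>j. exp (- (k * x * j)) \<partial>D))) else 0)) (at x)"
proof -
  consider "x < a" | "a < x" "x < b" | "b < x" using assms by linarith
  then show ?thesis
  proof cases
    case 1
    have "((\<lambda>x. \<Psi> k b - \<Psi> k a) has_real_derivative 0) (at x)" by simp
    then have "((\<lambda>x. \<Psi> k (max x b) - \<Psi> k (max x a)) has_real_derivative 0) (at x)"
      by (rule has_field_derivative_transform_within_open[where S="{..<a}"]) (use 1 assms in auto)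
    then show ?thesis using 1 by simp
  next
    case 2
    have "((\<lambda>x. \<Psi> k b - \<Psi> k x) has_real_derivative 0 - \<theta> / x * (1 - (\<integral>j. exp (- (k * x * j)) \<partial>D))) (at x)"
      using assms by (intro derivative_intros \<Psi>_deriv) auto
    then have "((\<lambda>x. \<Psi> k (max x b) - \<Psi> k (max x a)) has_real_derivative 0 - \<theta> / x * (1 - (\<integral>j. exp (- (k * x * j)) \<partial>D))) (at x)"
      by (rule has_field_derivative_transform_within_open[where S="{a<..<b}"]) (use 2 assms in auto)
    then show ?thesis using 2 by simp
  next
    case 3
    have "((\<lambda>x. 0) has_real_derivative 0) (at x)" by simp
    then have "((\<lambda>x. \<Psi> k (max x b) - \<Psi> k (max x a)) has_real_derivative 0) (at x)"
      by (rule has_field_derivative_transform_within_open[where S="{b<..}"]) (use 3 assms in auto)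
    then show ?thesis using 3 by simp
  qed
qed

text \<open>At most one of the intervals contains \<open>x\<close>, so the sum in the exponent has at most one term.\<close>
lemma sum_one_interval:
  assumes "i < n" "u i < x" "x \<le> u (Suc i)"
  shows "(\<Sum>k<n. if u k < x \<and> x \<le> u (Suc k) then f k else 0) = (f i :: real)"
proof -
  have "(if u k < x \<and> x \<le> u (Suc k) then f k else 0) = (if k = i then f i else 0)" for k
    using assms u_mono[of "Suc k" i] u_mono[of "Suc i" k] by (cases k i rule: linorder_cases) auto
  then show ?thesis using assms by simp
qed

text \<open>If an interval contains \<open>x\<close>, both sides are the term of that interval. If
  none does, \<open>e x\<close> is constantly 1, so c x = 1 and both sides vanish.\<close>

lemma sum_interval_exp:
  "(\<Sum>i<n. if u i < x \<and> x \<le> u (Suc i) then \<theta> / x * (1 - (\<integral>j. exp (- (l i * x * j)) \<partial>D)) else 0) = \<theta> / x * (1 - c x)"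
proof (cases "\<exists>i<n. u i < x \<and> x \<le> u (Suc i)")
  case True
  then obtain i where i: "i < n" "u i < x" "x \<le> u (Suc i)" by auto
  show ?thesis
    unfolding c_def e_def sum_one_interval[OF i] ..
next
  case False
  then have 0: "(\<Sum>i<n. if u i < x \<and> x \<le> u (Suc i) then f i else 0) = (0 :: real)" for f
    by (intro sum.neutral) auto
  show ?thesis
    unfolding c_def e_def 0 using D.prob_space by simp
qed

lemma V_deriv:
  assumes "0 < x" "x \<notin> u ` {..n}"
  shows "(V has_real_derivative V x * (\<theta> / x * (1 - c x))) (at x)"
proof -
  have "((\<lambda>x. \<Sum>i<n. \<Psi> (l i) (max x (u (Suc i))) - \<Psi> (l i) (max x (u i))) has_real_derivative
    (\<Sum>i<n. if u i < x \<and> x \<le> u (Suc i) then - (\<theta> / x * (1 - (\<integral>j. exp (- (l i * x * j)) \<partial>D))) else 0)) (at x)"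
    using assms by (intro DERIV_sum \<Psi>_max_deriv l_nonneg u_mono) auto
  moreover have "(\<Sum>i<n. if u i < x \<and> x \<le> u (Suc i) then - (\<theta> / x * (1 - (\<integral>j. exp (- (l i * x * j)) \<partial>D))) else 0)
    = - (\<theta> / x * (1 - c x))"
    unfolding sum_interval_exp[symmetric] sum_negf[symmetric] by (intro sum.cong) auto
  ultimately have "((\<lambda>x. \<Sum>i<n. \<Psi> (l i) (max x (u (Suc i))) - \<Psi> (l i) (max x (u i))) has_real_derivative - (\<theta> / x * (1 - c x))) (at x)"
    by (simp only:)
  from DERIV_fun_exp[OF DERIV_minus[OF this]] show ?thesis
    unfolding V_def by simp
qed

lemma c_bounds: "0 < x \<Longrightarrow> 0 \<le> c x" "0 < x \<Longrightarrow> integrable D (e x)"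
  "0 < x \<Longrightarrow> (\<integral>\<^sup>+j. ennreal (e x j) \<partial>D) = ennreal (c x)"
proof -
  assume x: "0 < x"
  have "AE j in D. norm (e x j) \<le> 1"
    using D_pos by eventually_elim (use e_le_1 e_pos x in \<open>auto simp: less_imp_le abs_of_pos\<close>)
  then show int: "integrable D (e x)"
    by (intro D.integrable_const_bound[where B=1]) auto
  show "0 \<le> c x" unfolding c_def by (auto intro!: Bochner_Integration.integral_nonneg less_imp_le[OF e_pos])
  show "(\<integral>\<^sup>+j. ennreal (e x j) \<partial>D) = ennreal (c x)"
    unfolding c_def using int by (intro nn_integral_eq_integral) (auto intro!: less_imp_le[OF e_pos])
qed

text \<open>The analytic core of the one-step equation: the integrand has the explicit primitive
  \<open>F\<close>, because the term \<theta> / x in the logarithmic derivative of \<open>V\<close>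
  cancels against the derivative of x powr (- \<theta>).\<close>

lemma hold_integral_V:
  assumes s: "0 < s"
  shows "(\<integral>\<^sup>+x\<in>{s<..}. ennreal (\<theta> * x powr (- \<theta> - 1) * s powr \<theta>) * (ennreal (c x) * ennreal (V x)) \<partial>lborel) = ennreal (V s)"
    (is "?I = _")
proof -
  \<comment> \<open>Beyond \<open>R\<close> all grid points are passed, so \<open>c\<close> and
    \<open>V\<close> are 1 and the remaining integral is the tail (s / R) powr \<theta> of the hold
    law. The fundamental theorem is applied on the bounded interval [s, R].\<close>
  define R where "R = max s (u n)"
  have R: "s \<le> R" "u n \<le> R" "0 < R" using s by (auto simp: R_def)
  define f where "f x = \<theta> * x powr (- \<theta> - 1) * s powr \<theta> * c x * V x" for x
  define F where "F x = - (s powr \<theta> * x powr (- \<theta>) * V x)" for x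
  have c1: "c x = 1" if "u n < x" for x
    using that D.prob_space by (simp add: c_def e_eq_1)
  have "(f has_integral F R - F s) {s..R}"
  \<comment> \<open>\<open>V\<close> may have kinks at the grid points. They are finitely many and
    \<open>F\<close> is continuous, so this version of the theorem can leave them out.\<close>
  proof (rule fundamental_theorem_of_calculus_interior_strong[of "u ` {..n}"])
    show "continuous_on {s..R} F"
      unfolding F_def using s by (intro continuous_intros continuous_on_subset[OF V_continuous]) auto
    fix x assume x: "x \<in> {s<..<R} - u ` {..n}"
    have "(F has_real_derivative - (s powr \<theta> * (- \<theta> * x powr (- \<theta> - 1)) * V x + s powr \<theta> * x powr (- \<theta>) * (V x * (\<theta> / x * (1 - c x))))) (at x)"
      unfolding F_def using x s
      by (auto intro!: derivative_eq_intros V_deriv simp: algebra_simps)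
    also have "- (s powr \<theta> * (- \<theta> * x powr (- \<theta> - 1)) * V x + s powr \<theta> * x powr (- \<theta>) * (V x * (\<theta> / x * (1 - c x)))) = f x"
      unfolding f_def using x s by (simp add: powr_diff field_simps)
    finally show "(F has_vector_derivative f x) (at x)"
      by (simp add: has_real_derivative_iff_has_vector_derivative)
  qed (use R in auto)
  note FTC = this
  have f0: "0 \<le> f x" if "x \<in> {s..R}" for x
    using that \<theta> s by (auto simp: f_def intro!: mult_nonneg_nonneg c_bounds less_imp_le[OF V_pos])
  have "(\<integral>\<^sup>+x\<in>{s..R}. ennreal (f x) \<partial>lborel) = ennreal (F R - F s)"
    by (rule nn_integral_has_integral_lebesgue'[OF f0 FTC])
  moreover have "F R - F s = V s - (s / R) powr \<theta>"
    using s R by (simp add: F_def V_eq_1 powr_minus powr_divide field_simps)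
  ultimately have 1: "(\<integral>\<^sup>+x\<in>{s..R}. ennreal (f x) \<partial>lborel) = ennreal (V s - (s / R) powr \<theta>)" by simp
  have "((\<lambda>x. \<theta> * s powr \<theta> * x powr (- \<theta> - 1)) has_integral \<theta> * s powr \<theta> * (- (R powr (- \<theta> - 1 + 1)) / (- \<theta> - 1 + 1))) {R..}"
    using \<theta> R by (intro has_integral_mult_right has_integral_powr_to_inf) auto
  also have "\<theta> * s powr \<theta> * (- (R powr (- \<theta> - 1 + 1)) / (- \<theta> - 1 + 1)) = (s / R) powr \<theta>"
    using \<theta> s R by (simp add: powr_divide powr_minus field_simps)
  finally have 2: "(\<integral>\<^sup>+x\<in>{R..}. ennreal (\<theta> * s powr \<theta> * x powr (- \<theta> - 1)) \<partial>lborel) = ennreal ((s / R) powr \<theta>)"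
    using \<theta> by (intro nn_integral_has_integral_lebesgue') auto
  have "AE x in lborel. ennreal (\<theta> * x powr (- \<theta> - 1) * s powr \<theta>) * (ennreal (c x) * ennreal (V x)) * indicator {s<..} x
    = ennreal (f x) * indicator {s..R} x + ennreal (\<theta> * s powr \<theta> * x powr (- \<theta> - 1)) * indicator {R..} x"
    using AE_lborel_singleton[of s] AE_lborel_singleton[of R]
  proof eventually_elim
    fix x assume ne: "x \<noteq> s" "x \<noteq> R"
    have "0 < x \<Longrightarrow> ennreal (\<theta> * x powr (- \<theta> - 1) * s powr \<theta>) * (ennreal (c x) * ennreal (V x)) = ennreal (f x)"
      using \<theta> s c_bounds(1)[of x] V_pos[of x] unfolding f_def
      by (subst ennreal_mult[symmetric], simp, simp, subst ennreal_mult[symmetric]) (auto simp: ac_simps)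
    moreover have "f x = \<theta> * s powr \<theta> * x powr (- \<theta> - 1)" if "R < x"
      using that R by (simp add: f_def c1 V_eq_1)
    ultimately show "ennreal (\<theta> * x powr (- \<theta> - 1) * s powr \<theta>) * (ennreal (c x) * ennreal (V x)) * indicator {s<..} x
    = ennreal (f x) * indicator {s..R} x + ennreal (\<theta> * s powr \<theta> * x powr (- \<theta> - 1)) * indicator {R..} x"
      using ne R s by (auto simp: indicator_def)
  qed
  then have "?I = (\<integral>\<^sup>+x. ennreal (f x) * indicator {s..R} x + ennreal (\<theta> * s powr \<theta> * x powr (- \<theta> - 1)) * indicator {R..} x \<partial>lborel)"
    by (rule nn_integral_cong_AE)
  also have "\<dots> = (\<integral>\<^sup>+x\<in>{s..R}. ennreal (f x) \<partial>lborel) + (\<integral>\<^sup>+x\<in>{R..}. ennreal (\<theta> * s powr \<theta> * x powr (- \<theta> - 1)) \<partial>lborel)"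
  proof (rule nn_integral_add)
    \<comment> \<open>Measurability is available for \<open>V (max 0 x)\<close> rather than for
      \<open>V\<close>; on [s, R] the two agree, so the cut-off integrand can be rewritten.\<close>
    have eq: "(\<lambda>x. f x * indicator {s..R} x) = (\<lambda>x. \<theta> * x powr (- \<theta> - 1) * s powr \<theta> * c x * V (max 0 x) * indicator {s..R} x)"
      using s by (auto simp: f_def indicator_def max_def fun_eq_iff)
    have [measurable]: "c \<in> borel_measurable borel" unfolding c_def by measurable
    have "(\<lambda>x. f x * indicator {s..R} x) \<in> borel_measurable borel" unfolding eq by measurable
    then have "(\<lambda>x. ennreal (f x * indicator {s..R} x)) \<in> borel_measurable lborel" by simp
    also have "(\<lambda>x. ennreal (f x * indicator {s..R} x)) = (\<lambda>x. ennreal (f x) * indicator {s..R} x)"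
      by (auto simp: indicator_def)
    finally show "(\<lambda>x. ennreal (f x) * indicator {s..R} x) \<in> borel_measurable lborel" .
  qed auto
  also have "\<dots> = ennreal (V s)"
  proof -
    have "0 \<le> V s - (s / R) powr \<theta>"
      using has_integral_nonneg[OF FTC f0] \<open>F R - F s = V s - (s / R) powr \<theta>\<close> by simp
    then have "ennreal (V s - (s / R) powr \<theta>) + ennreal ((s / R) powr \<theta>) = ennreal (V s)"
      by (subst ennreal_plus[symmetric]) auto
    then show ?thesis unfolding 1 2 by simp
  qed
  finally show ?thesis .
qed

end

declare hold_jump_chain.simps(2) [simp del]

section \<open>Times and paths of the hold-jump construction\<close>

context hold_jump
begin

lemma W_component:
  "w \<in> M \<rightarrow>\<^sub>M W \<Longrightarrow> (\<lambda>z. w z i) \<in> M \<rightarrow>\<^sub>M borel \<Otimes>\<^sub>M borel"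
proof -
  assume w: "w \<in> M \<rightarrow>\<^sub>M W"
  have "(\<lambda>z. w z i) \<in> M \<rightarrow>\<^sub>M step_law"
    using measurable_compose[OF w measurable_component_singleton[of i]] by simp
  then show ?thesis by (simp cong: measurable_cong_sets)
qed

lemma measurable_hold_jump_chain [measurable (raw)]:
  assumes [measurable]: "w \<in> M \<rightarrow>\<^sub>M W" "x \<in> M \<rightarrow>\<^sub>M borel \<Otimes>\<^sub>M borel"
  shows "(\<lambda>z. hold_jump_chain (w z) (x z) n) \<in> M \<rightarrow>\<^sub>M borel \<Otimes>\<^sub>M borel"
proof (induction n)
  case 0 then show ?case by simp
next
  case (Suc n)
  note Suc[measurable] W_component[OF assms(1), measurable]
  have "(\<lambda>z. hold_jump_chain (w z) (x z) (Suc n)) =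
    (\<lambda>z. (fst (hold_jump_chain (w z) (x z) n) / fst (w z n), snd (hold_jump_chain (w z) (x z) n)
        + fst (hold_jump_chain (w z) (x z) n) / fst (w z n) * snd (w z n)))"
    by (auto simp: Let_def hold_jump_chain.simps(2) split: prod.splits)
  then show ?case by simp
qed

lemma measurable_hold_jump_path [measurable (raw)]:
  assumes [measurable]: "w \<in> M \<rightarrow>\<^sub>M W" "x \<in> M \<rightarrow>\<^sub>M borel \<Otimes>\<^sub>M borel" "v \<in> borel_measurable M"
  shows "(\<lambda>z. hold_jump_path (w z) (x z) (v z)) \<in> borel_measurable M"
  unfolding hold_jump_path_def
  by (rule measurable_compose_countable[where f="\<lambda>i z. snd (hold_jump_chain (w z) (x z) i)"])
     measurable

abbreviation S :: "(nat \<Rightarrow> real \<times> real) \<Rightarrow> real \<Rightarrow> nat \<Rightarrow> real" where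
  "S w s k \<equiv> fst (hold_jump_chain w (s, 0) k)"

lemma S_0: "S w s 0 = s" by simp

lemma S_case_nat: "S (case_nat p w) s (Suc k) = S w (s / fst p) k"
  by (simp only: fst_hold_jump_chain fst_conv prod.lessThan_Suc_shift) simp

lemma good_S:
  assumes "good w" "0 < s"
  shows S_pos: "0 < S w s k" and S_strict: "S w s k < S w s (Suc k)"
    and S_mono: "k \<le> k' \<Longrightarrow> S w s k \<le> S w s k'"
    and S_unbounded: "eventually (\<lambda>k. x < S w s k) sequentially"
proof -
  have b: "0 < fst (w i)" "fst (w i) < 1" for i using assms by (auto simp: good_def)
  have P: "0 < (\<Prod>i<k. fst (w i))" for k using b by (intro prod_pos) auto
  show pos: "0 < S w s k" for k using P assms by (simp add: fst_hold_jump_chain)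
  have "S w s (Suc k) = S w s k / fst (w k)" for k
    by (simp add: fst_hold_jump_chain)
  then show less: "S w s k < S w s (Suc k)" for k using pos[of k] b[of k] by (simp add: field_simps)
  show "k \<le> k' \<Longrightarrow> S w s k \<le> S w s k'"
    by (rule lift_Suc_mono_le) (use less in \<open>auto intro: less_imp_le\<close>)
  have "(\<lambda>n. \<Prod>i<n. fst (w i)) \<longlonglongrightarrow> 0" using assms by (simp add: good_def)
  \<comment> \<open>\<open>max x 1\<close> keeps the bound positive for every real \<open>x\<close>,
    so that the convergence of the products to 0 applies.\<close>
  then have "eventually (\<lambda>k. (\<Prod>i<k. fst (w i)) < s / max x 1) sequentially"
    using assms by (intro order_tendstoD(2)) auto
  then show "eventually (\<lambda>k. x < S w s k) sequentially"
  proof eventually_elim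
    fix k assume "(\<Prod>i<k. fst (w i)) < s / max x 1"
    then have "max x 1 < s / (\<Prod>i<k. fst (w i))" using P[of k] assms by (simp add: field_simps del: max_less_iff_conj)
    then show "x < S w s k" by (simp add: fst_hold_jump_chain)
  qed
qed

text \<open>The number \<open>m\<close> of summands does not depend on \<open>v\<close>; any
  \<open>m\<close> whose following time S_(m+1) lies beyond \<open>v\<close> will do. Thus sums of
  one length can serve all grid points at once.\<close>

lemma hold_jump_path_eq:
  assumes w: "good w" "0 < s" and v: "v < S w s (Suc m)"
  shows "hold_jump_path w (s, 0) v = (\<Sum>k<m. if S w s (Suc k) \<le> v then S w s (Suc k) * snd (w k) else 0)"
proof -
  define N where "N = (LEAST n. v < S w s (Suc n))"
  have N: "v < S w s (Suc N)" unfolding N_def using v by (rule LeastI)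
  have Nm: "N \<le> m" unfolding N_def using v by (rule Least_le)
  have iff: "S w s (Suc k) \<le> v \<longleftrightarrow> k < N" for k
  proof
    assume "k < N" then show "S w s (Suc k) \<le> v" unfolding N_def by (meson not_less_Least not_le)
  next
    assume "S w s (Suc k) \<le> v" then show "k < N"
      using N S_mono[OF w, of "Suc N" "Suc k"] by (meson Suc_le_mono leD leI order_trans)
  qed
  have "hold_jump_path w (s, 0) v = (\<Sum>k<N. S w s (Suc k) * snd (w k))"
    unfolding hold_jump_path_def N_def[symmetric] snd_hold_jump_chain by simp
  also have "\<dots> = (\<Sum>k<m. if k < N then S w s (Suc k) * snd (w k) else 0)"
    using Nm by (intro sum.mono_neutral_cong_left) auto
  finally show ?thesis by (simp only: iff)
qed

end

context hold_jump_steps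
begin

lemma measurable_e_W [measurable]:
  "(\<lambda>w. e (S w s (Suc k)) (snd (w k))) \<in> borel_measurable W"
  by measurable

lemma V_measurable2 [measurable (raw)]:
  "f \<in> borel_measurable M \<Longrightarrow> (\<lambda>x. V (max 0 (f x))) \<in> borel_measurable M"
  using measurable_compose[OF _ V_measurable] by blast

text \<open>Given the hold time x = s / \<beta>, integrating the jump factor over \<open>J\<close>
  leaves \<open>c x\<close>; what remains is the integral of c V against the hold density.\<close>

lemma one_step:
  assumes s: "0 < s"
  shows "(\<integral>\<^sup>+p. ennreal (e (s / fst p) (snd p)) * ennreal (V (max 0 (s / fst p))) \<partial>step_law) = ennreal (V s)"
proof -
  have [measurable]: "(\<lambda>p. V (max 0 (s / fst p))) \<in> borel_measurable step_law"
    by (rule V_measurable2) measurable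
  have [measurable]: "(\<lambda>p. e (s / fst p) (snd p)) \<in> borel_measurable step_law"
    by (rule e_measurable) measurable
  have "(\<integral>\<^sup>+p. ennreal (e (s / fst p) (snd p)) * ennreal (V (max 0 (s / fst p))) \<partial>step_law)
    = (\<integral>\<^sup>+b. \<integral>\<^sup>+j. ennreal (e (s / b) j) * ennreal (V (max 0 (s / b))) \<partial>D \<partial>beta1_law \<theta>)"
    by (subst D.nn_integral_fst[symmetric]) simp_all
  also have "\<dots> = (\<integral>\<^sup>+b. (\<lambda>x. (\<integral>\<^sup>+j. ennreal (e x j) \<partial>D) * ennreal (V (max 0 x))) (s / b) \<partial>beta1_law \<theta>)"
    by (intro nn_integral_cong) (simp add: nn_integral_multc)
  also have "\<dots> = (\<integral>\<^sup>+x\<in>{s<..}. ennreal (\<theta> * x powr (- \<theta> - 1) * s powr \<theta>) *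
      ((\<integral>\<^sup>+j. ennreal (e x j) \<partial>D) * ennreal (V (max 0 x))) \<partial>lborel)"
    by (rule nn_integral_beta1_hold[OF \<theta> s]) measurable
  also have "\<dots> = (\<integral>\<^sup>+x\<in>{s<..}. ennreal (\<theta> * x powr (- \<theta> - 1) * s powr \<theta>) * (ennreal (c x) * ennreal (V x)) \<partial>lborel)"
    using s by (intro nn_integral_cong) (auto simp: indicator_def c_bounds max_def)
  also have "\<dots> = ennreal (V s)" by (rule hold_integral_V[OF s])
  finally show ?thesis .
qed

text \<open>A martingale identity: the factors of the jumps made so far, times the value
  \<open>V\<close> at the time reached, keep their mean. The induction peels off the first round and
  uses the hypothesis at the starting time s / \<beta>, so \<open>s\<close> is generalised.\<close>

lemma many_steps:
  assumes s: "0 < s"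
  shows "(\<integral>\<^sup>+w. (\<Prod>k<m. ennreal (e (S w s (Suc k)) (snd (w k)))) * ennreal (V (max 0 (S w s m))) \<partial>W) = ennreal (V s)"
  using s
proof (induction m arbitrary: s)
  case 0 then show ?case by (simp add: W.P.emeasure_space_1)
next
  case (Suc m)
  let ?f = "\<lambda>m s w. (\<Prod>k<m. ennreal (e (S w s (Suc k)) (snd (w k)))) * ennreal (V (max 0 (S w s m)))"
  let ?e = "\<lambda>p. ennreal (e (s / fst p) (snd p))"
  have "(\<integral>\<^sup>+w. ?f (Suc m) s w \<partial>W)
    = (\<integral>\<^sup>+p. \<integral>\<^sup>+w. ?e p * ?f m (s / fst p) w \<partial>W \<partial>step_law)"
  proof (subst nn_integral_W)
    show "(\<lambda>w. ?f (Suc m) s w) \<in> borel_measurable W"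
      by measurable
  next
    show "(\<integral>\<^sup>+p. \<integral>\<^sup>+w. ?f (Suc m) s (case_nat p w) \<partial>W \<partial>step_law) =
     (\<integral>\<^sup>+p. \<integral>\<^sup>+w. ?e p * ?f m (s / fst p) w \<partial>W \<partial>step_law)"
      by (simp only: S_case_nat prod.lessThan_Suc_shift S_0 nat.case mult.assoc)
  qed
  also have "\<dots> = (\<integral>\<^sup>+p. ?e p * ennreal (V (max 0 (s / fst p))) \<partial>step_law)"
  proof (rule nn_integral_cong_AE)
    have "AE p in step_law. 0 < fst p"
    proof (rule BD.AE_pair_measure)
      show "AE b in beta1_law \<theta>. AE j in D. 0 < fst (b, j)"
        using AE_beta1 by eventually_elim auto
    qed measurable
    then show "AE p in step_law. (\<integral>\<^sup>+w. ?e p * ?f m (s / fst p) w \<partial>W)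
        = ?e p * ennreal (V (max 0 (s / fst p)))"
    proof eventually_elim
      fix p :: "real \<times> real" assume p: "0 < fst p"
      have "(\<integral>\<^sup>+w. ?e p * ?f m (s / fst p) w \<partial>W)
        = ?e p * ennreal (V (s / fst p))"
        using p Suc.prems
        by (subst nn_integral_cmult) (measurable, subst Suc.IH, auto)
      then show "(\<integral>\<^sup>+w. ?e p * ?f m (s / fst p) w \<partial>W)
        = ?e p * ennreal (V (max 0 (s / fst p)))" using p Suc.prems by (simp add: max_def)
    qed
  qed
  also have "\<dots> = ennreal (V s)" by (rule one_step[OF Suc.prems])
  finally show ?case .
qed

text \<open>Writing each path increment as the sum of the jumps in its interval and swapping the two
  sums groups the exponent by jumps instead of intervals. The bound on S_(m+1) guarantees that every
  jump up to the last grid point is among the first \<open>m\<close>.\<close>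

lemma prod_e_eq:
  assumes w: "good w" "0 < s" and m: "u n < S w s (Suc m)"
  shows "(\<Prod>k<m. ennreal (e (S w s (Suc k)) (snd (w k))))
    = ennreal (exp (- (\<Sum>i<n. l i * (hold_jump_path w (s, 0) (u (Suc i)) - hold_jump_path w (s, 0) (u i)))))"
proof -
  have path: "hold_jump_path w (s, 0) (u i) = (\<Sum>k<m. if S w s (Suc k) \<le> u i then S w s (Suc k) * snd (w k) else 0)"
    if "i \<le> n" for i
    using m u_mono[OF that] by (intro hold_jump_path_eq[OF w]) linarith
  have "(\<Sum>i<n. l i * (hold_jump_path w (s, 0) (u (Suc i)) - hold_jump_path w (s, 0) (u i)))
    = (\<Sum>i<n. \<Sum>k<m. if u i < S w s (Suc k) \<and> S w s (Suc k) \<le> u (Suc i) then l i * S w s (Suc k) * snd (w k) else 0)"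
  proof (rule sum.cong[OF refl])
    fix i assume "i \<in> {..<n}"
    then have i: "i < n" by simp
    have "l i * (hold_jump_path w (s, 0) (u (Suc i)) - hold_jump_path w (s, 0) (u i))
     = (\<Sum>k<m. l i * ((if S w s (Suc k) \<le> u (Suc i) then S w s (Suc k) * snd (w k) else 0) - (if S w s (Suc k) \<le> u i then S w s (Suc k) * snd (w k) else 0)))"
      using i by (simp only: path Suc_leI less_imp_le sum_distrib_left sum_subtractf[symmetric])
    also have "\<dots> = (\<Sum>k<m. if u i < S w s (Suc k) \<and> S w s (Suc k) \<le> u (Suc i) then l i * S w s (Suc k) * snd (w k) else 0)"
      using u_mono[of i "Suc i"] by (intro sum.cong) (auto)
    finally show "l i * (hold_jump_path w (s, 0) (u (Suc i)) - hold_jump_path w (s, 0) (u i)) = \<dots>" .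
  qed
  also have "\<dots> = (\<Sum>k<m. \<Sum>i<n. if u i < S w s (Suc k) \<and> S w s (Suc k) \<le> u (Suc i) then l i * S w s (Suc k) * snd (w k) else 0)"
    by (rule sum.swap)
  finally have eq: "(\<Sum>i<n. l i * (hold_jump_path w (s, 0) (u (Suc i)) - hold_jump_path w (s, 0) (u i))) = \<dots>" .
  show ?thesis
    unfolding eq e_def
    by (subst prod_ennreal) (simp_all only: sum_negf[symmetric] exp_sum[OF finite_lessThan] exp_ge_zero prod_nonneg)
qed

text \<open>Let \<open>m\<close> tend to infinity in the martingale identity. Once S_m has passed
  the last grid point, \<open>V\<close> is 1 and the collected factors form the whole functional, so
  the integrands, almost surely at most 1, are eventually equal to their limit.\<close>

lemma hold_jump_path_laplace:
  assumes s: "0 < s"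
  shows "(\<integral>\<^sup>+w. ennreal (exp (- (\<Sum>i<n. l i * (hold_jump_path w (s, 0) (u (Suc i)) - hold_jump_path w (s, 0) (u i))))) \<partial>W) = ennreal (V s)"
    (is "(\<integral>\<^sup>+w. ?L w \<partial>W) = _")
proof -
  let ?f = "\<lambda>m w. (\<Prod>k<m. ennreal (e (S w s (Suc k)) (snd (w k)))) * ennreal (V (max 0 (S w s m)))"
  have "(\<lambda>m. \<integral>\<^sup>+w. ?f m w \<partial>W) \<longlonglongrightarrow> (\<integral>\<^sup>+w. ?L w \<partial>W)"
  proof (rule nn_integral_dominated_convergence[where w="\<lambda>_. 1"])
    show "?f m \<in> borel_measurable W" for m by measurable
    show "?L \<in> borel_measurable W" by measurable
    show "(\<integral>\<^sup>+w. 1 \<partial>W) < \<infinity>" by (simp add: W.P.emeasure_space_1)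
    show "(\<lambda>_. 1) \<in> borel_measurable W" by simp
    show "AE w in W. ?f m w \<le> 1" for m
      using AE_good
    proof eventually_elim
      fix w assume w: "good w"
      have "0 < snd (w k)" for k using w by (auto simp: good_def)
      then have "ennreal (e (S w s (Suc k)) (snd (w k))) \<le> 1" for k
        using e_le_1[OF S_pos[OF w s], of "snd (w k)" "Suc k"] by (simp add: less_imp_le)
      then have "(\<Prod>k<m. ennreal (e (S w s (Suc k)) (snd (w k)))) \<le> 1"
        by (intro prod_le_1) (auto)
      moreover have "ennreal (V (max 0 (S w s m))) \<le> 1"
        using S_pos[OF w s, of m] V_le_1[of "max 0 (S w s m)"] by (simp add: ennreal_le_1)
      ultimately show "?f m w \<le> 1" using mult_mono[of _ 1 _ "1::ennreal"] by fastforce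
    qed
    show "AE w in W. (\<lambda>m. ?f m w) \<longlonglongrightarrow> ?L w"
      using AE_good
    proof eventually_elim
      fix w assume w: "good w"
      have "eventually (\<lambda>m. ?f m w = ?L w) sequentially"
        using S_unbounded[OF w s, of "u n"]
      proof eventually_elim
        fix m assume m: "u n < S w s m"
        then have "u n < S w s (Suc m)" using S_strict[OF w s, of m] by linarith
        from prod_e_eq[OF w s this] show "?f m w = ?L w"
          using m S_pos[OF w s, of m] by (simp add: V_eq_1 max_def)
      qed
      then show "(\<lambda>m. ?f m w) \<longlonglongrightarrow> ?L w" by (rule tendsto_eventually)
    qed
  qed
  then have "(\<lambda>m::nat. ennreal (V s)) \<longlonglongrightarrow> (\<integral>\<^sup>+w. ?L w \<partial>W)"
    by (simp only: many_steps[OF s])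
  then show ?thesis by (simp add: LIMSEQ_const_iff)
qed

end

section \<open>The Laplace exponent of the process\<close>

locale ssa = prob_space M for M :: "'a measure" +
  fixes T :: "real \<Rightarrow> 'a \<Rightarrow> real" and \<theta> :: real and N :: "'b measure" and J :: "'b \<Rightarrow> real" and k :: "real \<Rightarrow> real"
  assumes SSA: "SSA1 M T" and nondecreasing: "nondecreasing_paths M T" and no_drift: "no_drift M T"
    and rate_pos: "0 < \<theta>" and rate: "finite_rate M T \<theta>"
    and N: "prob_space N" and J [measurable]: "J \<in> borel_measurable N" and J_pos: "AE \<eta> in N. 0 < J \<eta>"
    and key: "key_function M T k" and tail: "\<And>x. 0 < x \<Longrightarrow> measure N {\<eta>\<in>space N. x < J \<eta>} = k x / \<theta>"
begin

definition D :: "real measure" where "D = distr N borel J"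

lemma hold_jump_D: "hold_jump D \<theta>"
proof -
  interpret N: prob_space N by (rule N)
  show ?thesis
  proof (intro hold_jump.intro hold_jump_axioms.intro)
    show "prob_space D" unfolding D_def by (rule N.prob_space_distr) simp
    show "AE j in D. 0 < j" unfolding D_def using J_pos by (subst AE_distr_iff) simp_all
  qed (simp_all add: rate_pos D_def)
qed

sublocale hold_jump D \<theta> by (rule hold_jump_D)

lemma T_measurable [measurable]: "0 < s \<Longrightarrow> T s \<in> borel_measurable M"
  using SSA by (auto simp: SSA1_def)

lemma T_mono: "\<omega> \<in> space M \<Longrightarrow> 0 < s \<Longrightarrow> s \<le> t \<Longrightarrow> T s \<omega> \<le> T t \<omega>"
  using nondecreasing by (auto simp: nondecreasing_paths_def mono_on_def)

lemma AE_T_nonneg: "AE \<omega> in M. \<forall>s>0. 0 \<le> T s \<omega>"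
proof -
  have "AE \<omega> in M. ((\<lambda>s. T s \<omega>) \<longlongrightarrow> 0) (at_right 0)" using SSA by (auto simp: SSA1_def)
  then show ?thesis using AE_space
  proof eventually_elim
    fix \<omega> assume lim: "((\<lambda>s. T s \<omega>) \<longlongrightarrow> 0) (at_right 0)" and \<omega>: "\<omega> \<in> space M"
    show "\<forall>s>0. 0 \<le> T s \<omega>"
    proof safe
      fix s :: real assume s: "0 < s"
      have "eventually (\<lambda>u. T u \<omega> \<le> T s \<omega>) (at_right 0)"
        unfolding eventually_at_right_field using s \<omega> by (intro exI[of _ s]) (auto intro!: T_mono)
      then show "0 \<le> T s \<omega>"
        using tendsto_upperbound[OF lim] by simp
    qed
  qed
qed

lemma k_eq: "0 < x \<Longrightarrow> k x = \<theta> * measure D {x<..}"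
proof -
  have "measure D {x<..} = measure N {\<eta>\<in>space N. x < J \<eta>}" 
    unfolding D_def by (subst measure_distr) (auto intro!: arg_cong[where f="measure N"])
  then show "0 < x \<Longrightarrow> k x = \<theta> * measure D {x<..}" using tail[of x] rate_pos by simp
qed

lemma tail_measurable [measurable]: "(\<lambda>x. measure D {x<..}) \<in> borel_measurable borel"
proof -
  have "mono (\<lambda>x. - measure D {x<..})"
    by (auto intro!: monoI D.finite_measure_mono)
  from borel_measurable_mono[OF this] have "(\<lambda>x. - (- measure D {x<..})) \<in> borel_measurable borel"
    by (rule borel_measurable_uminus)
  then show ?thesis by simp
qed

text \<open>By the key function formula this is - log E exp (- l T(1)). In place of
  \<open>k\<close>, whose values off (0, \<infinity>) are arbitrary, it uses \<theta> times the tail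
  of \<open>D\<close>, which is measurable on the whole line and ready for Fubini.\<close>

definition \<psi> :: "real \<Rightarrow> real" where
  "\<psi> l = (\<integral>x. indicator {0<..} x * ((1 - exp (- l * x)) * (\<theta> * measure D {x<..} / x)) \<partial>lborel)"

lemma integrable_\<psi>:
  assumes "0 \<le> l"
  shows "integrable lborel (\<lambda>x. indicator {0<..} x * ((1 - exp (- l * x)) * (\<theta> * measure D {x<..} / x)))"
proof (rule integrableI_nonneg)
  \<comment> \<open>Up to x = 1 the estimate is 1 - exp (- y) \<le> y, beyond it the trivial bound
    1. The factor \<open>max 1 l\<close> unites the two, so that the integrability condition on the
    key function, with its min x 1, applies.\<close>
  have bound: "1 - exp (- l * x) \<le> max 1 l * min x 1" if "0 < x" for x
  proof (cases "x \<le> 1")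
    case True
    have "1 - exp (- l * x) \<le> l * x" using exp_ge_add_one_self[of "- l * x"] by simp
    also have "\<dots> \<le> max 1 l * x" using that by (intro mult_right_mono) auto
    finally show ?thesis using True by simp
  next
    case False
    have "1 - exp (- l * x) \<le> 1" by simp
    then show ?thesis using False by (simp add: min_def le_max_iff_disj)
  qed
  have "(\<integral>\<^sup>+x. ennreal (indicator {0<..} x * ((1 - exp (- l * x)) * (\<theta> * measure D {x<..} / x))) \<partial>lborel)
    \<le> (\<integral>\<^sup>+x. ennreal (max 1 l) * (ennreal (min x 1 * (k x / x)) * indicator {0<..} x) \<partial>lborel)"
  proof (rule nn_integral_mono)
    fix x :: real
    show "ennreal (indicator {0<..} x * ((1 - exp (- l * x)) * (\<theta> * measure D {x<..} / x)))
      \<le> ennreal (max 1 l) * (ennreal (min x 1 * (k x / x)) * indicator {0<..} x)"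
    proof (cases "0 < x")
      case True
      have "(1 - exp (- l * x)) * (\<theta> * measure D {x<..} / x) \<le> (max 1 l * min x 1) * (\<theta> * measure D {x<..} / x)"
        using True rate_pos by (intro mult_right_mono bound) auto
      then have "ennreal ((1 - exp (- l * x)) * (\<theta> * measure D {x<..} / x)) \<le> ennreal (max 1 l * (min x 1 * (k x / x)))"
        using True by (intro ennreal_leI) (simp add: k_eq mult.assoc)
      also have "\<dots> = ennreal (max 1 l) * ennreal (min x 1 * (k x / x))"
        by (subst ennreal_mult') auto
      finally show ?thesis using True by simp
    qed simp
  qed
  also have "\<dots> = ennreal (max 1 l) * (\<integral>\<^sup>+x\<in>{0<..}. ennreal (min x 1 * (\<theta> * measure D {x<..} / x)) \<partial>lborel)"
    by (subst nn_integral_cmult[symmetric]) (auto intro!: nn_integral_cong simp: indicator_def k_eq)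
  also have "(\<integral>\<^sup>+x\<in>{0<..}. ennreal (min x 1 * (\<theta> * measure D {x<..} / x)) \<partial>lborel)
     = (\<integral>\<^sup>+x\<in>{0<..}. ennreal (min x 1 * (k x / x)) \<partial>lborel)"
    by (auto intro!: nn_integral_cong simp: indicator_def k_eq)
  finally show "(\<integral>\<^sup>+x. ennreal (indicator {0<..} x * ((1 - exp (- l * x)) * (\<theta> * measure D {x<..} / x))) \<partial>lborel) < \<infinity>"
    using key by (simp add: key_function_def ennreal_mult_less_top) (meson order.strict_trans1 ennreal_mult_less_top ennreal_less_top)
  show "AE x in lborel. 0 \<le> indicator {0<..} x * ((1 - exp (- l * x)) * (\<theta> * measure D {x<..} / x))"
    using rate_pos assms by (intro AE_I2) (auto simp: indicator_def)
qed measurable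

text \<open>For each j > 0, \<theta>/r (1 - exp (- l r j)) is the integral of \<theta> l exp (- l r
  x) over 0 < x < j. Integrating over j first turns the condition x < j into the tail of
  \<open>D\<close>.\<close>

lemma hazard_eq:
  assumes "0 \<le> l" "0 < r"
  shows "ennreal (\<theta> / r * (1 - (\<integral>j. exp (- (l * r * j)) \<partial>D)))
    = (\<integral>\<^sup>+x\<in>{0<..}. ennreal (\<theta> * measure D {x<..} * (l * exp (- l * r * x))) \<partial>lborel)"
proof -
  let ?h = "\<lambda>j. \<theta> / r * (1 - exp (- (l * r * j)))"
  have int: "integrable D (\<lambda>j. exp (- (l * r * j)))"
  proof (rule D.integrable_const_bound[where B=1])
    show "AE j in D. norm (exp (- (l * r * j))) \<le> 1"
      using D_pos by eventually_elim (use assms in simp)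
  qed simp
  have "ennreal (\<theta> / r * (1 - (\<integral>j. exp (- (l * r * j)) \<partial>D))) = ennreal (\<integral>j. ?h j \<partial>D)"
    using int D.prob_space by (simp add: Bochner_Integration.integral_diff)
  also have "\<dots> = (\<integral>\<^sup>+j. ennreal (?h j) \<partial>D)"
  proof (rule nn_integral_eq_integral[symmetric])
    show "AE j in D. 0 \<le> ?h j"
      using D_pos by eventually_elim (use assms rate_pos in simp)
  qed (use int in simp)
  also have "\<dots> = (\<integral>\<^sup>+j. \<integral>\<^sup>+x. ennreal (\<theta> * (l * exp (- l * r * x))) * (indicator {0<..} x * indicator {x<..} j) \<partial>lborel \<partial>D)"
  proof (rule nn_integral_cong_AE)
    show "AE j in D. ennreal (?h j) = (\<integral>\<^sup>+x. ennreal (\<theta> * (l * exp (- l * r * x))) * (indicator {0<..} x * indicator {x<..} j) \<partial>lborel)"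
      using D_pos
    proof eventually_elim
      fix j :: real assume j: "0 < j"
      have "(\<integral>\<^sup>+x. ennreal (\<theta> * (l * exp (- l * r * x))) * indicator {0..j} x \<partial>lborel)
        = ennreal ((- \<theta> / r * exp (- l * r * j)) - (- \<theta> / r * exp (- l * r * 0)))"
        using assms rate_pos j
        by (intro nn_integral_FTC_Icc) (auto intro!: derivative_eq_intros simp: field_simps)
      moreover have "(\<integral>\<^sup>+x. ennreal (\<theta> * (l * exp (- l * r * x))) * indicator {0..j} x \<partial>lborel)
        = (\<integral>\<^sup>+x. ennreal (\<theta> * (l * exp (- l * r * x))) * (indicator {0<..} x * indicator {x<..} j) \<partial>lborel)"
        using AE_lborel_singleton[of 0] AE_lborel_singleton[of j]
        by (intro nn_integral_cong_AE) (auto elim!: eventually_elim2 simp: indicator_def)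
      ultimately show "ennreal (?h j) = (\<integral>\<^sup>+x. ennreal (\<theta> * (l * exp (- l * r * x))) * (indicator {0<..} x * indicator {x<..} j) \<partial>lborel)"
        by (simp add: algebra_simps)
    qed
  qed
  also have "\<dots> = (\<integral>\<^sup>+x. \<integral>\<^sup>+j. ennreal (\<theta> * (l * exp (- l * r * x))) * (indicator {0<..} x * indicator {x<..} j) \<partial>D \<partial>lborel)"
  proof -
    interpret pair_sigma_finite D lborel ..
    have "(\<lambda>(j, x). ennreal (\<theta> * (l * exp (- l * r * x))) * (indicator {0<..} x * indicator {x<..} j)) =
        (\<lambda>(j, x). ennreal (\<theta> * (l * exp (- l * r * x))) * (if 0 < x \<and> x < j then 1 else 0))"
      by (auto simp: indicator_def)
    also have "\<dots> \<in> borel_measurable (D \<Otimes>\<^sub>M lborel)" by measurable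
    finally show ?thesis by (rule Fubini'[symmetric])
  qed
  also have "\<dots> = (\<integral>\<^sup>+x\<in>{0<..}. ennreal (\<theta> * measure D {x<..} * (l * exp (- l * r * x))) \<partial>lborel)"
  proof (rule nn_integral_cong)
    fix x :: real
    have "(\<integral>\<^sup>+j. ennreal (\<theta> * (l * exp (- l * r * x))) * (indicator {0<..} x * indicator {x<..} j) \<partial>D)
      = ennreal (\<theta> * (l * exp (- l * r * x))) * indicator {0<..} x * emeasure D {x<..}"
      by (subst nn_integral_cmult_indicator[symmetric]) (auto intro!: nn_integral_cong simp: mult.assoc)
    then show "(\<integral>\<^sup>+j. ennreal (\<theta> * (l * exp (- l * r * x))) * (indicator {0<..} x * indicator {x<..} j) \<partial>D)
      = ennreal (\<theta> * measure D {x<..} * (l * exp (- l * r * x))) * indicator {0<..} x"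
      using assms rate_pos
      by (auto simp: D.emeasure_eq_measure indicator_def ennreal_mult[symmetric] ac_simps)
  qed
  finally show ?thesis .
qed

text \<open>The difference exp (- l a x) - exp (- l b x) is the integral of l x exp (- l r x) over r
  in [a, b]. Its factor x cancels the 1/x in \<psi>, and Fubini leaves the inner integral evaluated
  in \<open>hazard_eq\<close>.\<close>

lemma \<psi>_diff:
  assumes l: "0 \<le> l" and ab: "0 < a" "a \<le> b"
  shows "ennreal (\<psi> (l * b) - \<psi> (l * a)) = (\<integral>\<^sup>+r\<in>{a..b}. ennreal (\<theta> / r * (1 - (\<integral>j. exp (- (l * r * j)) \<partial>D))) \<partial>lborel)"
    and "\<psi> (l * a) \<le> \<psi> (l * b)"
proof -
  have alg: "A * ((1 - eb) * C) - A * ((1 - ea) * C) = A * ((ea - eb) * C)" for A C ea eb :: real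
    by (simp add: algebra_simps)
  let ?g = "\<lambda>x. indicator {0<..} x * ((exp (- (l * a) * x) - exp (- (l * b) * x)) * (\<theta> * measure D {x<..} / x))"
  have g0: "0 \<le> ?g x" for x
  proof (cases "0 < x")
    case True
    then have "0 \<le> exp (- (l * a) * x) - exp (- (l * b) * x)" using assms by (simp add: mult_left_mono mult_right_mono)
    then show ?thesis using True rate_pos by (intro mult_nonneg_nonneg) auto
  qed simp
  have i: "integrable lborel (\<lambda>x. indicator {0<..} x * ((1 - exp (- (l * c) * x)) * (\<theta> * measure D {x<..} / x)))"
    if "0 < c" for c using l that by (intro integrable_\<psi>) auto
  have "\<psi> (l * b) - \<psi> (l * a) = (\<integral>x. indicator {0<..} x * ((1 - exp (- (l * b) * x)) * (\<theta> * measure D {x<..} / x))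
      - indicator {0<..} x * ((1 - exp (- (l * a) * x)) * (\<theta> * measure D {x<..} / x)) \<partial>lborel)"
    unfolding \<psi>_def using ab by (intro Bochner_Integration.integral_diff[symmetric] i) auto
  also have "\<dots> = (\<integral>x. ?g x \<partial>lborel)"
    by (simp only: alg)
  finally have eq: "\<psi> (l * b) - \<psi> (l * a) = (\<integral>x. ?g x \<partial>lborel)" .
  have "0 \<le> (\<integral>x. ?g x \<partial>lborel)" by (intro Bochner_Integration.integral_nonneg g0)
  then show "\<psi> (l * a) \<le> \<psi> (l * b)" using eq by simp
  have intg: "integrable lborel ?g"
  proof -
    have "integrable lborel (\<lambda>x. indicator {0<..} x * ((1 - exp (- (l * b) * x)) * (\<theta> * measure D {x<..} / x))
      - indicator {0<..} x * ((1 - exp (- (l * a) * x)) * (\<theta> * measure D {x<..} / x)))"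
      using ab by (intro Bochner_Integration.integrable_diff i) auto
    then show ?thesis by (simp only: alg)
  qed
  have "ennreal (\<psi> (l * b) - \<psi> (l * a)) = (\<integral>\<^sup>+x. ennreal (?g x) \<partial>lborel)"
    unfolding eq using g0 intg by (intro nn_integral_eq_integral[symmetric]) auto
  also have "\<dots> = (\<integral>\<^sup>+x. \<integral>\<^sup>+r. ennreal (\<theta> * measure D {x<..} * (l * exp (- l * r * x))) * indicator {0<..} x * indicator {a..b} r \<partial>lborel \<partial>lborel)"
  proof (rule nn_integral_cong)
    fix x :: real
    show "ennreal (?g x) = (\<integral>\<^sup>+r. ennreal (\<theta> * measure D {x<..} * (l * exp (- l * r * x))) * indicator {0<..} x * indicator {a..b} r \<partial>lborel)"
    proof (cases "0 < x")
      case True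
      have "(\<integral>\<^sup>+r. ennreal (\<theta> * measure D {x<..} * (l * exp (- l * r * x))) * indicator {a..b} r \<partial>lborel)
        = ennreal ((\<theta> * measure D {x<..} * (- exp (- l * b * x) / x)) - (\<theta> * measure D {x<..} * (- exp (- l * a * x) / x)))"
      proof (rule nn_integral_FTC_Icc)
        show "DERIV (\<lambda>r. \<theta> * measure D {x<..} * (- exp (- l * r * x) / x)) r :> \<theta> * measure D {x<..} * (l * exp (- l * r * x))" for r
          using True by (auto intro!: derivative_eq_intros)
      qed (use assms rate_pos in auto)
      then show ?thesis using True by (simp add: algebra_simps diff_divide_distrib)
    qed simp
  qed
  also have "\<dots> = (\<integral>\<^sup>+r. \<integral>\<^sup>+x. ennreal (\<theta> * measure D {x<..} * (l * exp (- l * r * x))) * indicator {0<..} x * indicator {a..b} r \<partial>lborel \<partial>lborel)"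
    by (rule lborel_pair.Fubini') measurable
  also have "\<dots> = (\<integral>\<^sup>+r\<in>{a..b}. ennreal (\<theta> / r * (1 - (\<integral>j. exp (- (l * r * j)) \<partial>D))) \<partial>lborel)"
  proof (intro nn_integral_cong)
    fix r :: real
    show "(\<integral>\<^sup>+x. ennreal (\<theta> * measure D {x<..} * (l * exp (- l * r * x))) * indicator {0<..} x * indicator {a..b} r \<partial>lborel)
      = ennreal (\<theta> / r * (1 - (\<integral>j. exp (- (l * r * j)) \<partial>D))) * indicator {a..b} r"
    proof (cases "r \<in> {a..b}")
      case True
      then show ?thesis using ab by (subst hazard_eq[OF l]) auto
    qed simp
  qed
  finally show "ennreal (\<psi> (l * b) - \<psi> (l * a)) = \<dots>" .
qed

lemma laplace_D_continuous:
  assumes "0 \<le> l" shows "continuous_on {0..} (\<lambda>r. \<integral>j. exp (- (l * r * j)) \<partial>D)"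
  unfolding continuous_on_eq_continuous_within
proof (intro ballI continuous_within_sequentiallyI)
  fix r and f :: "nat \<Rightarrow> real" assume f: "f \<longlonglongrightarrow> r" "\<forall>n. f n \<in> {0..}"
  show "(\<lambda>n. \<integral>j. exp (- (l * f n * j)) \<partial>D) \<longlonglongrightarrow> (\<integral>j. exp (- (l * r * j)) \<partial>D)"
  proof (rule integral_dominated_convergence[where w="\<lambda>_. 1"])
    show "AE j in D. norm (exp (- (l * f n * j))) \<le> 1" for n
      using D_pos by eventually_elim (use assms f in simp)
    show "AE j in D. (\<lambda>n. exp (- (l * f n * j))) \<longlonglongrightarrow> exp (- (l * r * j))"
      using f(1) by (intro AE_I2 tendsto_intros)
  qed auto
qed

text \<open>By \<open>\<psi>_diff\<close> the function is a primitive of a continuous rate, so the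
  fundamental theorem applies on any bracket of \<open>r\<close> away from 0. Going through the
  integral form avoids differentiating under the integral over x.\<close>

lemma \<psi>_deriv:
  assumes l: "0 \<le> l" and r: "0 < r"
  shows "((\<lambda>r. \<psi> (l * r)) has_real_derivative \<theta> / r * (1 - (\<integral>j. exp (- (l * r * j)) \<partial>D))) (at r)"
proof -
  let ?h = "\<lambda>r. \<theta> / r * (1 - (\<integral>j. exp (- (l * r * j)) \<partial>D))"
  define a b where "a = r / 2" and "b = 2 * r"
  have ab: "0 < a" "a < r" "r < b" using r by (auto simp: a_def b_def)
  have cont: "continuous_on {a..b} ?h"
    using ab by (intro continuous_intros continuous_on_subset[OF laplace_D_continuous[OF l]]) auto
  have h0: "0 \<le> ?h x" if "0 < x" for x
  proof -
    have "AE j in D. exp (- (l * x * j)) \<le> 1" 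
      using D_pos by eventually_elim (use that l in simp)
    then have "(\<integral>j. exp (- (l * x * j)) \<partial>D) \<le> (\<integral>j. 1 \<partial>D)"
      by (intro integral_mono_AE D.integrable_const_bound[where B=1]) auto
    then show ?thesis using that rate_pos D.prob_space by simp
  qed
  have eq: "\<psi> (l * x) = \<psi> (l * a) + integral {a..x} ?h" if "x \<in> {a..b}" for x
  proof -
    have HI: "(?h has_integral integral {a..x} ?h) {a..x}"
      using that by (intro integrable_integral integrable_continuous_real continuous_on_subset[OF cont]) auto
    have "(\<integral>\<^sup>+r\<in>{a..x}. ennreal (?h r) \<partial>lborel) = ennreal (integral {a..x} ?h)"
      by (rule nn_integral_has_integral_lebesgue'[OF h0 HI]) (use ab in simp)
    moreover have "0 \<le> integral {a..x} ?h"
      by (rule has_integral_nonneg[OF HI h0]) (use ab in simp)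
    moreover have "ennreal (\<psi> (l * x) - \<psi> (l * a)) = (\<integral>\<^sup>+r\<in>{a..x}. ennreal (?h r) \<partial>lborel)" "\<psi> (l * a) \<le> \<psi> (l * x)"
      using that ab by (simp_all add: \<psi>_diff l)
    ultimately show ?thesis by (simp add: ennreal_inj)
  qed
  have "((\<lambda>x. integral {a..x} ?h) has_real_derivative ?h r) (at r within {a..b})"
    using ab by (intro integral_has_real_derivative cont) auto
  moreover have "at r within {a..b} = at r"
    using ab by (intro at_within_interior) simp
  ultimately have "((\<lambda>x. integral {a..x} ?h) has_real_derivative ?h r) (at r)" by (simp only:)
  from DERIV_add[OF DERIV_const[of "\<psi> (l * a)"] this]
  have "((\<lambda>x. \<psi> (l * a) + integral {a..x} ?h) has_real_derivative ?h r) (at r)" by (simp only: add_0)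
  then show ?thesis
  proof (rule has_field_derivative_transform_within_open[where S="{a<..<b}"])
    fix x assume "x \<in> {a<..<b}"
    then show "\<psi> (l * a) + integral {a..x} ?h = \<psi> (l * x)" using eq[of x] by simp
  qed (use ab in auto)
qed

sublocale hold_jump_exponent D \<theta> "\<lambda>l r. \<psi> (l * r)"
  by unfold_locales (rule \<psi>_deriv)

lemma distr_T: "0 < s \<Longrightarrow> distr M borel (T s) = distr M borel (\<lambda>\<omega>. s * T 1 \<omega>)"
proof -
  assume s: "0 < s"
  have "self_similar1 M T" using SSA by (simp add: SSA1_def)
  then have "distr M (\<Pi>\<^sub>M s\<in>{1}. borel) (\<lambda>\<omega>. \<lambda>r\<in>{1}. T (s * r) \<omega>) = distr M (\<Pi>\<^sub>M s\<in>{1}. borel) (\<lambda>\<omega>. \<lambda>r\<in>{1}. s * T r \<omega>)"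
    using s unfolding self_similar1_def by (auto dest!: spec[of _ "{1}"])
  then have "distr (distr M (\<Pi>\<^sub>M s\<in>{1::real}. borel) (\<lambda>\<omega>. \<lambda>r\<in>{1}. T (s * r) \<omega>)) borel (\<lambda>f. f 1)
    = distr (distr M (\<Pi>\<^sub>M s\<in>{1::real}. borel) (\<lambda>\<omega>. \<lambda>r\<in>{1}. s * T r \<omega>)) borel (\<lambda>f. f 1)" by simp
  then show ?thesis
    using s by (subst (asm) (1 2) distr_distr) (auto simp: comp_def intro!: measurable_restrict)
qed

lemma laplace_T:
  assumes "0 \<le> l" "0 < s"
  shows "(\<integral>\<^sup>+\<omega>. ennreal (exp (- (l * T s \<omega>))) \<partial>M) = ennreal (exp (- \<psi> (l * s)))"
proof -
  define u where "u = l * s"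
  have u: "0 \<le> u" using assms by (simp add: u_def)
  have "AE \<omega> in M. norm (exp (- u * T 1 \<omega>)) \<le> 1"
    using AE_T_nonneg by eventually_elim (use u in auto)
  then have int: "integrable M (\<lambda>\<omega>. exp (- u * T 1 \<omega>))"
    by (intro integrable_const_bound[where B=1]) auto
  \<comment> \<open>The key function formula determines the logarithm of the expectation; positivity
    is what permits exponentiating back.\<close>
  have "0 < (\<integral>\<omega>. exp (- u * T 1 \<omega>) \<partial>M)"
  proof -
    have "(\<integral>\<omega>. exp (- u * T 1 \<omega>) \<partial>M) \<noteq> 0"
      using integral_nonneg_eq_0_iff_AE[OF int] by (auto simp: prob_space)
    moreover have "0 \<le> (\<integral>\<omega>. exp (- u * T 1 \<omega>) \<partial>M)" by (rule Bochner_Integration.integral_nonneg) simp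
    ultimately show ?thesis by linarith
  qed
  moreover have "ln (\<integral>\<omega>. exp (- u * T 1 \<omega>) \<partial>M) = - \<psi> u"
  proof -
    have "ln (\<integral>\<omega>. exp (- u * T 1 \<omega>) \<partial>M) = (LINT x:{0<..}|lborel. (exp (- u * x) - 1) * (k x / x))"
      using key u by (simp add: key_function_def)
    also have "\<dots> = (\<integral>x. - (indicator {0<..} x * ((1 - exp (- u * x)) * (\<theta> * measure D {x<..} / x))) \<partial>lborel)"
      unfolding set_lebesgue_integral_def
    proof (intro Bochner_Integration.integral_cong refl)
      have alg: "(e - 1) * C = - ((1 - e) * C)" for e C :: real by (simp add: algebra_simps)
      show "indicator {0<..} x *\<^sub>R ((exp (- u * x) - 1) * (k x / x)) =
        - (indicator {0<..} x * ((1 - exp (- u * x)) * (\<theta> * measure D {x<..} / x)))" for x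
        by (cases "0 < x") (simp_all add: k_eq alg)
    qed
    finally show ?thesis by (simp add: \<psi>_def)
  qed
  ultimately have E: "(\<integral>\<omega>. exp (- u * T 1 \<omega>) \<partial>M) = exp (- \<psi> u)"
    by (metis exp_ln)
  have "(\<integral>\<^sup>+\<omega>. ennreal (exp (- (l * T s \<omega>))) \<partial>M) = (\<integral>\<^sup>+x. ennreal (exp (- (l * x))) \<partial>distr M borel (T s))"
    using assms by (subst nn_integral_distr) auto
  also have "\<dots> = (\<integral>\<^sup>+\<omega>. ennreal (exp (- u * T 1 \<omega>)) \<partial>M)"
    using assms unfolding distr_T[OF assms(2)]
    by (subst nn_integral_distr) (auto intro!: nn_integral_cong simp: u_def ac_simps)
  also have "\<dots> = ennreal (exp (- \<psi> u))"
    unfolding E[symmetric] using int by (intro nn_integral_eq_integral) auto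
  finally show ?thesis by (simp add: u_def)
qed

end

section \<open>Independence of the past\<close>

context ssa
begin

abbreviation F where "F \<equiv> natural_filtration M T"

sublocale F: filtration "space M" F by (rule filtration_natural_filtration)

lemma F_past: "0 < u \<Longrightarrow> F (ennreal u) = past M T (ennreal u)"
  by (simp add: natural_filtration_def)

lemma sets_past: "sets (past M T t) =
    sigma_sets (space M) (\<Union>u\<in>{u. 0 < u \<and> ennreal u \<le> t}. sets (vimage_algebra (space M) (T u) borel))"
  unfolding past_def using sets.sets_into_space by (intro sets_measure_of) fastforce

lemma T_F_measurable:
  assumes "0 < s" "ennreal s \<le> t" shows "T s \<in> borel_measurable (F t)"
proof -
  have "0 < ennreal s" using assms by simp
  then have t: "t \<noteq> 0" using assms(2) by auto
  have "sets (vimage_algebra (space M) (T s) borel) \<subseteq> sets (F t)"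
    using assms t by (auto simp: natural_filtration_def sets_past)
  moreover have "T s \<in> vimage_algebra (space M) (T s) borel \<rightarrow>\<^sub>M borel"
    by (rule measurable_vimage_algebra1) simp
  ultimately show ?thesis
    using measurable_mono[OF order_refl refl, of "vimage_algebra (space M) (T s) borel" "F t" borel]
    by (auto simp: F.space_F)
qed

lemma past_subset_M: "sets (past M T t) \<subseteq> sets M"
  unfolding sets_past
proof (rule sets.sigma_sets_subset, safe)
  fix u X assume "0 < u" "X \<in> sets (vimage_algebra (space M) (T u) borel)"
  then show "X \<in> sets M"
    by (auto simp: sets_vimage_algebra2 intro: measurable_sets)
qed

lemma F_subset_M: "sets (F t) \<subseteq> sets M"
proof (cases "t = 0")
  case True
  have "(\<Inter>u\<in>{0<..}. sets (past M T u)) \<subseteq> sets (past M T 1)"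
    by (rule INF_lower) simp
  then have sub: "(\<Inter>u\<in>{0<..}. sets (past M T u)) \<subseteq> sets M" using past_subset_M by blast
  then have "sigma_sets (space M) (\<Inter>u\<in>{0<..}. sets (past M T u)) \<subseteq> sets M"
    by (rule sets.sigma_sets_subset)
  moreover have "(\<Inter>u\<in>{0<..}. sets (past M T u)) \<subseteq> Pow (space M)"
    using sub sets.space_closed[of M] by blast
  ultimately show ?thesis using True by (simp add: natural_filtration_def)
next
  case False then show ?thesis by (simp add: natural_filtration_def past_subset_M)
qed

text \<open>The finitely many times, completed by \<open>u\<close> and \<open>v\<close> and sorted,
  form a grid to which independence of increments applies. The past event depends on the increments
  with index below \<open>n\<close> through their partial sums, while T v - T u is the increment
  with index \<open>n\<close>.\<close>

lemma indep_increment_rectangle: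
  assumes uv: "0 < u" "u < v" and I: "finite I" "I \<subseteq> {0<..u}" and B: "\<And>r. r \<in> I \<Longrightarrow> B r \<in> sets borel"
    and C: "C \<in> sets borel"
  shows "prob ({\<omega>\<in>space M. \<forall>r\<in>I. T r \<omega> \<in> B r} \<inter> {\<omega>\<in>space M. T v \<omega> - T u \<omega> \<in> C})
    = prob {\<omega>\<in>space M. \<forall>r\<in>I. T r \<omega> \<in> B r} * prob {\<omega>\<in>space M. T v \<omega> - T u \<omega> \<in> C}"
proof -
  \<comment> \<open>Inserting \<open>u\<close> makes it the last grid time before \<open>v\<close>,
    so that the final increment starts at \<open>u\<close>. If \<open>u\<close> is not in
    \<open>I\<close>, the set \<open>B'\<close> imposes no condition there.\<close>
  define xs where "xs = sorted_list_of_set (insert u I)"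
  define n where "n = length xs"
  define B' where "B' r = (if r \<in> I then B r else UNIV)" for r
  have xs: "sorted xs" "distinct xs" "set xs = insert u I" using I by (simp_all add: xs_def del: sorted_list_of_set_insert_remove)
  have n: "0 < n" using xs(3) by (cases xs) (auto simp: n_def)
  define t where "t i = (if i < n then xs ! i else v)" for i
  have t_in: "t i \<in> insert u I" if "i < n" for i using that xs(3) nth_mem[of i xs] by (auto simp: t_def n_def)
  have t_less: "t i < t (Suc i)" if "i < n" for i
  proof (cases "Suc i < n")
    case True
    then have "xs ! i \<le> xs ! Suc i" "xs ! i \<noteq> xs ! Suc i"
      using xs by (auto simp: n_def sorted_nth_mono nth_eq_iff_index_eq)
    then show ?thesis using True by (simp add: t_def)
  next
    case False
    then show ?thesis using t_in[OF that] I uv that by (auto simp: t_def)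
  qed
  have t0: "0 < t 0" using t_in[OF n] I uv by auto
  have last: "t (n - 1) = u"
  proof -
    obtain i where i: "i < n" "xs ! i = u" using xs(3) by (metis in_set_conv_nth insertI1 n_def)
    then have "u \<le> t (n - 1)" using xs(1) n by (auto simp: t_def n_def intro!: sorted_nth_mono)
    moreover have "t (n - 1) \<le> u" using t_in[of "n - 1"] n I by auto
    ultimately show ?thesis by simp
  qed
  define X where "X i = (\<lambda>\<omega>. if i = 0 then T (t 0) \<omega> else T (t i) \<omega> - T (t (i - 1)) \<omega>)" for i
  have ind: "indep_vars (\<lambda>_. borel) X {..n}"
    using SSA t0 t_less unfolding SSA1_def independent_increments_def X_def by blast
  have sum_X: "(\<Sum>k\<le>i. X k \<omega>) = T (t i) \<omega>" for i \<omega>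
    by (induction i) (auto simp: X_def)
  define G where "G = {f \<in> space (\<Pi>\<^sub>M i\<in>{..<n}. (borel :: real measure)). \<forall>i\<in>{..<n}. (\<Sum>k\<le>i. f k) \<in> B' (t i)}"
  have B': "B' r \<in> sets borel" for r using B by (auto simp: B'_def)
  have G: "G \<in> sets (\<Pi>\<^sub>M i\<in>{..<n}. borel)"
  proof -
    have *: "(\<lambda>f. \<Sum>k\<le>i. f k) \<in> borel_measurable (\<Pi>\<^sub>M i\<in>{..<n}. (borel :: real measure))" if "i < n" for i
      using that by (intro borel_measurable_sum measurable_component_singleton) auto
    have "Measurable.pred (\<Pi>\<^sub>M i\<in>{..<n}. (borel :: real measure)) (\<lambda>f. \<forall>i\<in>{..<n}. (\<Sum>k\<le>i. f k) \<in> B' (t i))"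
      using B' * by (intro pred_intros_finite measurable_compose[OF *] pred_sets2[OF _ *]) auto
    then show ?thesis by (simp only: pred_def G_def)
  qed
  have E: "{\<omega>\<in>space M. \<forall>r\<in>I. T r \<omega> \<in> B r} = (\<lambda>\<omega>. \<lambda>i\<in>{..<n}. X i \<omega>) -` G \<inter> space M"
  proof -
    have "(\<forall>r\<in>I. T r \<omega> \<in> B r) \<longleftrightarrow> (\<forall>i\<in>{..<n}. T (t i) \<omega> \<in> B' (t i))" for \<omega>
    proof -
      have "(\<forall>r\<in>I. T r \<omega> \<in> B r) \<longleftrightarrow> (\<forall>r\<in>set xs. T r \<omega> \<in> B' r)"
        unfolding xs(3) by (auto simp: B'_def)
      also have "\<dots> \<longleftrightarrow> (\<forall>i\<in>{..<n}. T (xs ! i) \<omega> \<in> B' (xs ! i))"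
        unfolding n_def by (metis in_set_conv_nth lessThan_iff)
      also have "\<dots> \<longleftrightarrow> (\<forall>i\<in>{..<n}. T (t i) \<omega> \<in> B' (t i))"
        by (intro ball_cong refl) (simp add: t_def)
      finally show ?thesis .
    qed
    moreover have "(\<Sum>k\<le>i. (\<lambda>i\<in>{..<n}. X i \<omega>) k) = T (t i) \<omega>" if "i < n" for i \<omega>
      unfolding sum_X[symmetric] using that by (intro sum.cong) auto
    ultimately show ?thesis by (auto simp: G_def space_PiM PiE_iff simp del: sum.lessThan_Suc sum.atMost_Suc)
  qed
  have Xn: "{\<omega>\<in>space M. T v \<omega> - T u \<omega> \<in> C} = (\<lambda>\<omega>. \<lambda>i\<in>{n}. X i \<omega>) -` {f \<in> space (\<Pi>\<^sub>M i\<in>{n}. borel). f n \<in> C} \<inter> space M"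
    using n last by (auto simp: X_def t_def space_PiM)
  have "indep_var (\<Pi>\<^sub>M i\<in>{..<n}. borel) (\<lambda>\<omega>. \<lambda>i\<in>{..<n}. X i \<omega>) (\<Pi>\<^sub>M i\<in>{n}. borel) (\<lambda>\<omega>. \<lambda>i\<in>{n}. X i \<omega>)"
    using ind by (rule indep_var_restrict) auto
  from indep_varD[OF this G, of "{f \<in> space (\<Pi>\<^sub>M i\<in>{n}. borel). f n \<in> C}"] C
  have "prob ((\<lambda>\<omega>. (\<lambda>i\<in>{..<n}. X i \<omega>, \<lambda>i\<in>{n}. X i \<omega>)) -` (G \<times> {f \<in> space (\<Pi>\<^sub>M i\<in>{n}. borel). f n \<in> C}) \<inter> space M)
     = prob ((\<lambda>\<omega>. \<lambda>i\<in>{..<n}. X i \<omega>) -` G \<inter> space M)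
       * prob ((\<lambda>\<omega>. \<lambda>i\<in>{n}. X i \<omega>) -` {f \<in> space (\<Pi>\<^sub>M i\<in>{n}. borel). f n \<in> C} \<inter> space M)"
    by measurable
  also have "(\<lambda>\<omega>. (\<lambda>i\<in>{..<n}. X i \<omega>, \<lambda>i\<in>{n}. X i \<omega>)) -` (G \<times> {f \<in> space (\<Pi>\<^sub>M i\<in>{n}. borel). f n \<in> C}) \<inter> space M
     = ((\<lambda>\<omega>. \<lambda>i\<in>{..<n}. X i \<omega>) -` G \<inter> space M) \<inter> ((\<lambda>\<omega>. \<lambda>i\<in>{n}. X i \<omega>) -` {f \<in> space (\<Pi>\<^sub>M i\<in>{n}. borel). f n \<in> C} \<inter> space M)"
    by blast
  finally show ?thesis unfolding E Xn .
qed

text \<open>Cylinder events at finitely many times up to \<open>u\<close> are closed under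
  intersection and generate the past, so independence on them extends.\<close>

lemma indep_increment_past:
  assumes uv: "0 < u" "u < v"
  shows "indep_set (sets (past M T (ennreal u))) (sigma_sets (space M) {(\<lambda>\<omega>. T v \<omega> - T u \<omega>) -` C \<inter> space M | C. C \<in> sets borel})"
proof -
  define \<E> where "\<E> = {{\<omega>\<in>space M. \<forall>r\<in>I. T r \<omega> \<in> B r} | I B. finite I \<and> I \<subseteq> {0<..u} \<and> (\<forall>r\<in>I. B r \<in> sets borel)}"
  let ?C = "{(\<lambda>\<omega>. T v \<omega> - T u \<omega>) -` C \<inter> space M | C. C \<in> sets borel}"
  have "indep_set (sigma_sets (space M) \<E>) (sigma_sets (space M) ?C)"
  proof (rule indep_set_sigma_sets)
    show "Int_stable ?C"
      unfolding Int_stable_def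
    proof safe
      fix C C' :: "real set" assume "C \<in> sets borel" "C' \<in> sets borel"
      then show "\<exists>Ca. (\<lambda>\<omega>. T v \<omega> - T u \<omega>) -` C \<inter> space M \<inter> ((\<lambda>\<omega>. T v \<omega> - T u \<omega>) -` C' \<inter> space M) = (\<lambda>\<omega>. T v \<omega> - T u \<omega>) -` Ca \<inter> space M \<and> Ca \<in> sets borel"
        by (intro exI[of _ "C \<inter> C'"]) auto
    qed
    show "Int_stable \<E>"
      unfolding Int_stable_def
    proof (intro ballI)
      fix X Y assume "X \<in> \<E>" "Y \<in> \<E>"
      then obtain I B I' B' where X: "X = {\<omega>\<in>space M. \<forall>r\<in>I. T r \<omega> \<in> B r}" "finite I" "I \<subseteq> {0<..u}" "\<forall>r\<in>I. B r \<in> sets borel"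
        and Y: "Y = {\<omega>\<in>space M. \<forall>r\<in>I'. T r \<omega> \<in> B' r}" "finite I'" "I' \<subseteq> {0<..u}" "\<forall>r\<in>I'. B' r \<in> sets borel"
        unfolding \<E>_def by blast
      define B'' where "B'' r = (if r \<in> I then B r else UNIV) \<inter> (if r \<in> I' then B' r else UNIV)" for r
      have "X \<inter> Y = {\<omega>\<in>space M. \<forall>r\<in>I \<union> I'. T r \<omega> \<in> B'' r}"
        unfolding X(1) Y(1) B''_def by (auto split: if_splits)
      moreover have "\<forall>r\<in>I \<union> I'. B'' r \<in> sets borel" using X(4) Y(4) by (auto simp: B''_def)
      ultimately show "X \<inter> Y \<in> \<E>" unfolding \<E>_def using X(2,3) Y(2,3) by blast
    qed
    show "indep_set \<E> ?C"
    proof (rule indep_setI)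
      show "?C \<subseteq> events" using uv by (auto intro!: measurable_sets[of _ M borel] borel_measurable_diff)
      show "prob (a \<inter> b) = prob a * prob b" if ab: "a \<in> \<E>" "b \<in> ?C" for a b
      proof -
        obtain I B where a: "a = {\<omega>\<in>space M. \<forall>r\<in>I. T r \<omega> \<in> B r}" "finite I" "I \<subseteq> {0<..u}" "\<forall>r\<in>I. B r \<in> sets borel"
          using ab(1) unfolding \<E>_def by blast
        obtain C where "C \<in> sets borel" "b = (\<lambda>\<omega>. T v \<omega> - T u \<omega>) -` C \<inter> space M"
          using ab(2) by blast
        then have b: "C \<in> sets borel" "b = {\<omega>\<in>space M. T v \<omega> - T u \<omega> \<in> C}" by auto
        show ?thesis unfolding a(1) b(2) by (rule indep_increment_rectangle) (use uv a b in auto)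
      qed
      show "\<E> \<subseteq> events"
      proof
      fix X assume "X \<in> \<E>"
      then obtain I B where X: "X = {\<omega>\<in>space M. \<forall>r\<in>I. T r \<omega> \<in> B r}" "finite I" "I \<subseteq> {0<..u}" "\<forall>r\<in>I. B r \<in> sets borel"
        unfolding \<E>_def by blast
      have "{\<omega>\<in>space M. T r \<omega> \<in> B r} \<in> events" if "r \<in> I" for r
      proof -
        have "T r -` B r \<inter> space M \<in> events" using that X by (intro measurable_sets[OF T_measurable]) auto
        also have "T r -` B r \<inter> space M = {\<omega>\<in>space M. T r \<omega> \<in> B r}" by blast
        finally show ?thesis .
      qed
      then show "X \<in> events"
        unfolding X(1) using X(2) by (cases "I = {}") (auto intro!: sets.sets_Collect_finite_All')
      qed
    qed
  qed
  moreover have "sets (past M T (ennreal u)) \<subseteq> sigma_sets (space M) \<E>"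
    unfolding sets_past
  proof (rule sigma_sets_mono, safe)
    fix r X assume r: "0 < r" "ennreal r \<le> ennreal u" and X: "X \<in> sets (vimage_algebra (space M) (T r) borel)"
    then obtain B where B: "B \<in> sets borel" "X = T r -` B \<inter> space M" by (auto simp: sets_vimage_algebra2)
    have "X = {\<omega>\<in>space M. \<forall>r'\<in>{r}. T r' \<omega> \<in> (\<lambda>_. B) r'}" using B by auto
    then have "X \<in> \<E>" unfolding \<E>_def using r uv B(1)
      by (intro CollectI exI[of _ "{r}"] exI[of _ "\<lambda>_. B"]) auto
    then show "X \<in> sigma_sets (space M) \<E>" by (rule sigma_sets.Basic)
  qed
  ultimately show ?thesis
    unfolding indep_set_def by - (erule indep_sets_mono_sets, auto split: bool.split)
qed

lemma nn_integral_increment_past: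
  fixes g :: "real \<Rightarrow> ennreal" and \<xi> :: "'a \<Rightarrow> real"
  assumes uv: "0 < u" "u < v" and \<xi>: "\<xi> \<in> borel_measurable (F (ennreal u))" and g [measurable]: "g \<in> borel_measurable borel"
  shows "(\<integral>\<^sup>+\<omega>. ennreal (\<xi> \<omega>) * g (T v \<omega> - T u \<omega>) \<partial>M) = (\<integral>\<^sup>+\<omega>. ennreal (\<xi> \<omega>) \<partial>M) * (\<integral>\<^sup>+\<omega>. g (T v \<omega> - T u \<omega>) \<partial>M)"
proof -
  let ?\<Delta> = "\<lambda>\<omega>. T v \<omega> - T u \<omega>"
  have \<Delta> [measurable]: "?\<Delta> \<in> borel_measurable M" using uv by simp
  have \<xi>M [measurable]: "\<xi> \<in> borel_measurable M"
    using \<xi> measurable_mono[OF order_refl refl F_subset_M[of "ennreal u"], of borel] F.space_F by auto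
  have "indep_var borel \<xi> borel ?\<Delta>"
  proof -
    have "{\<xi> -` A \<inter> space M | A. A \<in> sets borel} \<subseteq> sets (F (ennreal u))"
      using measurable_sets[OF \<xi>] by (auto simp: F.space_F)
    then have "sigma_sets (space M) {\<xi> -` A \<inter> space M | A. A \<in> sets borel} \<subseteq> sets (past M T (ennreal u))"
      unfolding F_past[OF uv(1), symmetric] F.space_F[of "ennreal u", symmetric] by (rule sets.sigma_sets_subset)
    then have "indep_set (sigma_sets (space M) {\<xi> -` A \<inter> space M | A. A \<in> sets borel})
      (sigma_sets (space M) {?\<Delta> -` A \<inter> space M | A. A \<in> sets borel})"
      using indep_increment_past[OF uv] unfolding indep_set_def
      by - (erule indep_sets_mono_sets, auto split: bool.split)
    then show ?thesis unfolding indep_var_eq using \<xi>M \<Delta> by blast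
  qed
  then have eq: "distr M borel \<xi> \<Otimes>\<^sub>M distr M borel ?\<Delta> = distr M (borel \<Otimes>\<^sub>M borel) (\<lambda>\<omega>. (\<xi> \<omega>, ?\<Delta> \<omega>))"
    unfolding indep_var_distribution_eq by simp
  interpret \<Delta>: prob_space "distr M borel ?\<Delta>" by (rule prob_space_distr) simp
  have "(\<integral>\<^sup>+\<omega>. ennreal (\<xi> \<omega>) * g (?\<Delta> \<omega>) \<partial>M) = (\<integral>\<^sup>+z. ennreal (fst z) * g (snd z) \<partial>distr M (borel \<Otimes>\<^sub>M borel) (\<lambda>\<omega>. (\<xi> \<omega>, ?\<Delta> \<omega>)))"
    by (subst nn_integral_distr) auto
  also have "\<dots> = (\<integral>\<^sup>+x. \<integral>\<^sup>+y. ennreal x * g y \<partial>distr M borel ?\<Delta> \<partial>distr M borel \<xi>)"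
    unfolding eq[symmetric] by (subst \<Delta>.nn_integral_fst[symmetric]) auto
  also have "\<dots> = (\<integral>\<^sup>+x. ennreal x * (\<integral>\<^sup>+y. g y \<partial>distr M borel ?\<Delta>) \<partial>distr M borel \<xi>)"
    by (intro nn_integral_cong nn_integral_cmult) auto
  also have "\<dots> = (\<integral>\<^sup>+x. ennreal x \<partial>distr M borel \<xi>) * (\<integral>\<^sup>+y. g y \<partial>distr M borel ?\<Delta>)"
    by (rule nn_integral_multc) simp
  also have "\<dots> = (\<integral>\<^sup>+\<omega>. ennreal (\<xi> \<omega>) \<partial>M) * (\<integral>\<^sup>+\<omega>. g (?\<Delta> \<omega>) \<partial>M)"
    by (simp add: nn_integral_distr)
  finally show ?thesis .
qed

text \<open>T v is T u plus an independent increment, so the transform of the increment is a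
  quotient; that of T u is positive and finite and can be cancelled.\<close>

lemma laplace_increment:
  assumes "0 \<le> l" "0 < u" "u < v"
  shows "(\<integral>\<^sup>+\<omega>. ennreal (exp (- (l * (T v \<omega> - T u \<omega>)))) \<partial>M) = ennreal (exp (- (\<psi> (l * v) - \<psi> (l * u))))"
    (is "?L = _")
proof -
  have [measurable]: "T u \<in> borel_measurable (F (ennreal u))" using assms by (intro T_F_measurable) auto
  have "ennreal (exp (- \<psi> (l * v))) = (\<integral>\<^sup>+\<omega>. ennreal (exp (- (l * T v \<omega>))) \<partial>M)"
    using assms by (intro laplace_T[symmetric]) auto
  also have "\<dots> = (\<integral>\<^sup>+\<omega>. ennreal (exp (- (l * T u \<omega>))) * ennreal (exp (- (l * (T v \<omega> - T u \<omega>)))) \<partial>M)"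
    by (simp add: ennreal_mult[symmetric] exp_add[symmetric] algebra_simps)
  also have "\<dots> = (\<integral>\<^sup>+\<omega>. ennreal (exp (- (l * T u \<omega>))) \<partial>M) * ?L"
    using assms(2,3) by (rule nn_integral_increment_past) measurable
  also have "(\<integral>\<^sup>+\<omega>. ennreal (exp (- (l * T u \<omega>))) \<partial>M) = ennreal (exp (- \<psi> (l * u)))"
    using assms by (intro laplace_T) auto
  finally have "ennreal (exp (- \<psi> (l * u))) * ?L = ennreal (exp (- \<psi> (l * u))) * ennreal (exp (- (\<psi> (l * v) - \<psi> (l * u))))"
    by (simp add: ennreal_mult[symmetric] exp_add[symmetric])
  then show ?thesis by (subst (asm) ennreal_mult_cancel_left) auto
qed

text \<open>Each induction step splits off the last increment: the event \<open>A\<close> and all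
  earlier increments belong to the past at the time where it starts.\<close>

lemma laplace_increments_past:
  assumes u: "0 < u 0" "\<And>i. i < n \<Longrightarrow> u i < u (Suc i)" and l: "\<And>i. 0 \<le> l i"
    and A: "A \<in> sets (F (ennreal (u 0)))"
  shows "(\<integral>\<^sup>+\<omega>. indicator A \<omega> * ennreal (exp (- (\<Sum>i<n. l i * (T (u (Suc i)) \<omega> - T (u i) \<omega>)))) \<partial>M)
    = emeasure M A * ennreal (exp (- (\<Sum>i<n. \<psi> (l i * u (Suc i)) - \<psi> (l i * u i))))"
  using u(2)
proof (induction n)
  case 0
  have "A \<in> sets M" using A F_subset_M by blast
  then show ?case by simp
next
  case (Suc n)
  have mono: "i \<le> j \<Longrightarrow> j \<le> Suc n \<Longrightarrow> u i \<le> u j" for i j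
  proof (induction j)
    case (Suc j) then show ?case using Suc.prems Suc.IH \<open>\<And>i. i < Suc n \<Longrightarrow> u i < u (Suc i)\<close>[of j]
      by (cases "i = Suc j") auto
  qed simp
  have pos: "0 < u i" if "i \<le> Suc n" for i using u(1) mono[of 0 i] that by simp
  have A' [measurable]: "A \<in> sets (F (ennreal (u n)))"
    using A F.sets_F_mono[of "ennreal (u 0)" "ennreal (u n)"] mono[of 0 n] by (auto simp: ennreal_leI)
  have [measurable]: "T (u i) \<in> borel_measurable (F (ennreal (u n)))" if "i \<le> n" for i
    using that pos mono by (intro T_F_measurable ennreal_leI) auto
  have "(\<integral>\<^sup>+\<omega>. indicator A \<omega> * ennreal (exp (- (\<Sum>i<Suc n. l i * (T (u (Suc i)) \<omega> - T (u i) \<omega>)))) \<partial>M)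
    = (\<integral>\<^sup>+\<omega>. ennreal (indicator A \<omega> * exp (- (\<Sum>i<n. l i * (T (u (Suc i)) \<omega> - T (u i) \<omega>))))
        * ennreal (exp (- (l n * (T (u (Suc n)) \<omega> - T (u n) \<omega>)))) \<partial>M)"
    by (intro nn_integral_cong) (simp add: indicator_def ennreal_mult[symmetric] exp_add[symmetric] add.commute)
  also have "\<dots> = (\<integral>\<^sup>+\<omega>. ennreal (indicator A \<omega> * exp (- (\<Sum>i<n. l i * (T (u (Suc i)) \<omega> - T (u i) \<omega>)))) \<partial>M)
     * (\<integral>\<^sup>+\<omega>. ennreal (exp (- (l n * (T (u (Suc n)) \<omega> - T (u n) \<omega>)))) \<partial>M)"
    using pos Suc.prems by (intro nn_integral_increment_past[where g="\<lambda>x. ennreal (exp (- (l n * x)))"]) auto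
  also have "(\<integral>\<^sup>+\<omega>. ennreal (indicator A \<omega> * exp (- (\<Sum>i<n. l i * (T (u (Suc i)) \<omega> - T (u i) \<omega>)))) \<partial>M)
     = (\<integral>\<^sup>+\<omega>. indicator A \<omega> * ennreal (exp (- (\<Sum>i<n. l i * (T (u (Suc i)) \<omega> - T (u i) \<omega>)))) \<partial>M)"
    by (intro nn_integral_cong) (simp add: indicator_def)
  also have "\<dots> * (\<integral>\<^sup>+\<omega>. ennreal (exp (- (l n * (T (u (Suc n)) \<omega> - T (u n) \<omega>)))) \<partial>M)
     = emeasure M A * ennreal (exp (- (\<Sum>i<n. \<psi> (l i * u (Suc i)) - \<psi> (l i * u i))))
     * ennreal (exp (- (\<psi> (l n * u (Suc n)) - \<psi> (l n * u n))))"
    using Suc.prems pos by (subst Suc.IH) (auto simp: laplace_increment l)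
  also have "\<dots> = emeasure M A * ennreal (exp (- (\<Sum>i<Suc n. \<psi> (l i * u (Suc i)) - \<psi> (l i * u i))))"
    by (simp add: mult.assoc ennreal_mult[symmetric] exp_add[symmetric] add.commute)
  finally show ?case .
qed

end

section \<open>Increments after a stopping time\<close>

context ssa
begin

text \<open>The conditional Laplace functional, given \<open>G\<close>, of the increments of T after
  \<tau>, tested against the events of \<open>G\<close>; the times \<open>v\<close> are relative to
  \<tau>. Fixed and stopping times are treated alike once this property is known.\<close>

definition laplace_after :: "'a measure \<Rightarrow> 'a measure \<Rightarrow> ('a \<Rightarrow> real) \<Rightarrow> bool" where
  "laplace_after P G \<tau> \<longleftrightarrow> (\<forall>A\<in>sets G. \<forall>n v l. v 0 = 0 \<and> (\<forall>i<n. v i < v (Suc i)) \<and> (\<forall>i. 0 \<le> l i) \<longrightarrow>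
     (\<integral>\<^sup>+\<omega>. indicator A \<omega> * ennreal (exp (- (\<Sum>i<n. l i * (level T \<omega> (\<tau> \<omega> + v (Suc i)) - level T \<omega> (\<tau> \<omega> + v i))))) \<partial>P)
   = (\<integral>\<^sup>+\<omega>. indicator A \<omega> * ennreal (exp (- (\<Sum>i<n. \<psi> (l i * (\<tau> \<omega> + v (Suc i))) - \<psi> (l i * (\<tau> \<omega> + v i))))) \<partial>P))"

lemma laplace_after_fixed:
  assumes s: "0 < s" shows "laplace_after M (vimage_algebra (space M) (T s) borel) (\<lambda>_. s)"
  unfolding laplace_after_def
proof (intro ballI allI impI)
  fix A n and v l :: "nat \<Rightarrow> real"
  assume A: "A \<in> sets (vimage_algebra (space M) (T s) borel)"
    and vl: "v 0 = 0 \<and> (\<forall>i<n. v i < v (Suc i)) \<and> (\<forall>i. 0 \<le> l i)"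
  have A': "A \<in> sets (F (ennreal s))"
    using A T_F_measurable[OF s order_refl] by (auto simp: sets_vimage_algebra2 F.space_F[symmetric, of "ennreal s"] intro: measurable_sets)
  then have [measurable]: "A \<in> sets M" using F_subset_M by blast
  show "(\<integral>\<^sup>+\<omega>. indicator A \<omega> * ennreal (exp (- (\<Sum>i<n. l i * (level T \<omega> (s + v (Suc i)) - level T \<omega> (s + v i))))) \<partial>M)
   = (\<integral>\<^sup>+\<omega>. indicator A \<omega> * ennreal (exp (- (\<Sum>i<n. \<psi> (l i * (s + v (Suc i))) - \<psi> (l i * (s + v i))))) \<partial>M)"
  proof -
    have v0: "0 \<le> v i" if "i \<le> n" for i
      using that by (induction i) (use vl in \<open>auto intro: order_trans[OF _ less_imp_le]\<close>)
    have lev: "level T \<omega> (s + v i) = T (s + v i) \<omega>" if "i \<le> n" for i \<omega>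
      using v0[OF that] s by (simp add: level_def)
    have "(\<Sum>i<n. l i * (level T \<omega> (s + v (Suc i)) - level T \<omega> (s + v i))) = (\<Sum>i<n. l i * (T (s + v (Suc i)) \<omega> - T (s + v i) \<omega>))" for \<omega>
      by (intro sum.cong refl) (simp add: lev)
    then show ?thesis
      using laplace_increments_past[of "\<lambda>i. s + v i" n l A] s vl A' by (simp add: nn_integral_multc)
  qed
qed

lemma T_right_continuous:
  assumes "\<omega> \<in> space M" "0 < s" shows "((\<lambda>u. T u \<omega>) \<longlongrightarrow> T s \<omega>) (at_right s)"
  using SSA assms by (auto simp: SSA1_def cadlag_paths_def continuous_within)

lemma T_seq:
  assumes \<omega>: "\<omega> \<in> space M" and s: "0 < s" and c: "c \<longlonglongrightarrow> s" "\<And>n. s \<le> c n"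
  shows "(\<lambda>n. T (c n) \<omega>) \<longlonglongrightarrow> T s \<omega>"
proof -
  \<comment> \<open>The limit from the right excludes the point \<open>s\<close> itself, whereas the
    sequence may hit it; hence the passage to continuity within [s, \<infinity>).\<close>
  have "at s within {s<..} = at s within {s..}"
    by (rule at_within_nhd[of _ UNIV]) auto
  with T_right_continuous[OF \<omega> s] have "continuous (at s within {s..}) (\<lambda>u. T u \<omega>)"
    by (simp add: continuous_within)
  then show ?thesis
    by (rule continuous_within_tendsto_compose) (use c in auto)
qed

lemma level_seq:
  assumes \<omega>: "\<omega> \<in> space M" and s: "0 < s" and c: "c \<longlonglongrightarrow> s" "\<And>n. s \<le> c n"
  shows "(\<lambda>n. level T \<omega> (c n)) \<longlonglongrightarrow> level T \<omega> s"
proof -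
  have "0 < c n" for n using s c(2)[of n] by simp
  then show ?thesis using T_seq[OF assms] s by (simp add: level_def)
qed

text \<open>The floor is increased by one, so for x \<ge> 0 the value lies strictly to the right of
  \<open>x\<close>: whether a random time takes its k-th dyadic value is then known by that value.
  Only countably many values occur.\<close>

definition dyadic :: "nat \<Rightarrow> real \<Rightarrow> real" where
  "dyadic m x = (real (nat \<lfloor>2 ^ m * x\<rfloor>) + 1) / 2 ^ m"

lemma dyadic_bounds:
  assumes "0 \<le> x" shows "x < dyadic m x" "dyadic m x \<le> x + (1 / 2) ^ m"
proof -
  have "real (nat \<lfloor>2 ^ m * x\<rfloor>) = of_int \<lfloor>2 ^ m * x\<rfloor>" using assms by simp
  then have "2 ^ m * x < real (nat \<lfloor>2 ^ m * x\<rfloor>) + 1" "real (nat \<lfloor>2 ^ m * x\<rfloor>) \<le> 2 ^ m * x"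
    by linarith+
  then show "x < dyadic m x" "dyadic m x \<le> x + (1 / 2) ^ m"
    by (simp_all add: dyadic_def field_simps power_divide)
qed

lemma dyadic_tendsto:
  assumes "0 \<le> x" shows "(\<lambda>m. dyadic m x) \<longlonglongrightarrow> x"
proof (rule tendsto_sandwich[OF _ _ tendsto_const])
  show "eventually (\<lambda>m. x \<le> dyadic m x) sequentially"
    using dyadic_bounds(1)[OF assms] by (auto intro!: always_eventually less_imp_le)
  show "eventually (\<lambda>m. dyadic m x \<le> x + (1 / 2) ^ m) sequentially"
    using dyadic_bounds(2)[OF assms] by (auto intro!: always_eventually)
  show "(\<lambda>m. x + (1 / 2) ^ m) \<longlonglongrightarrow> x"
    using tendsto_add[OF tendsto_const[of x] LIMSEQ_power_zero[of "1 / 2 :: real"]] by simp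
qed

text \<open>Right-continuity makes the level at X a limit of levels at times from a countable set.
  These times are capped at \<open>b\<close>, so that only variables T s with s \<le> b enter; b = t
  yields progressive measurability, b = \<infinity> plain measurability.\<close>

lemma level_measurable_bounded:
  assumes G: "space G = space M" "\<And>s. 0 < s \<Longrightarrow> ennreal s \<le> b \<Longrightarrow> T s \<in> borel_measurable G"
    and X [measurable]: "X \<in> borel_measurable G" and Xb: "\<And>\<omega>. \<omega> \<in> space M \<Longrightarrow> ennreal (X \<omega>) \<le> b"
  shows "(\<lambda>\<omega>. level T \<omega> (X \<omega>)) \<in> borel_measurable G"
proof -
  have const: "(\<lambda>\<omega>. level T \<omega> r) \<in> borel_measurable G" if "ennreal r \<le> b" for r
    using G(2)[OF _ that] by (cases "0 < r") (simp_all add: level_def)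
  define c where "c x = (if ennreal x \<le> b then x else enn2real b)" for x
  have c_b: "ennreal (c x) \<le> b" for x
    by (cases b) (auto simp: c_def)
  have c_ge: "x \<le> c y" "c y \<le> y" if "ennreal x \<le> b" "0 \<le> x" "x \<le> y" for x y
    using that by (cases b; auto simp: c_def ennreal_le_iff2 not_le)+
  define g where "g m \<omega> = (if 0 < X \<omega> then level T \<omega> (c (dyadic m (X \<omega>))) else 0)" for m \<omega>
  have g: "g m \<in> borel_measurable G" for m
  proof -
    have "(\<lambda>\<omega>. level T \<omega> (c ((real (nat \<lfloor>2 ^ m * X \<omega>\<rfloor>) + 1) / 2 ^ m))) \<in> borel_measurable G"
      by (rule measurable_compose_countable[where f="\<lambda>k \<omega>. level T \<omega> (c ((real k + 1) / 2 ^ m))"])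
         (auto intro!: const c_b)
    then show ?thesis unfolding g_def dyadic_def by measurable
  qed
  have "(\<lambda>m. g m \<omega>) \<longlonglongrightarrow> level T \<omega> (X \<omega>)" if \<omega>: "\<omega> \<in> space G" for \<omega>
  proof (cases "0 < X \<omega>")
    case True
    have b: "ennreal (X \<omega>) \<le> b" using Xb \<omega> G by auto
    have X_le: "X \<omega> \<le> dyadic m (X \<omega>)" for m using dyadic_bounds(1)[of "X \<omega>" m] True by simp
    have "(\<lambda>m. c (dyadic m (X \<omega>))) \<longlonglongrightarrow> X \<omega>"
      by (rule tendsto_sandwich[OF _ _ tendsto_const dyadic_tendsto])
        (use c_ge[OF b _ X_le] True in auto)
    then show ?thesis
      unfolding g_def using True \<omega> G c_ge[OF b _ X_le] by (auto intro!: level_seq)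
  qed (simp add: g_def level_def)
  then show ?thesis by (rule borel_measurable_LIMSEQ_real[OF _ g])
qed

lemma level_measurable [measurable (raw)]:
  assumes "X \<in> borel_measurable M" shows "(\<lambda>\<omega>. level T \<omega> (X \<omega>)) \<in> borel_measurable M"
  using assms by (intro level_measurable_bounded[where b=\<infinity>]) auto

lemma level_mono: "\<omega> \<in> space M \<Longrightarrow> 0 < s \<Longrightarrow> s \<le> t \<Longrightarrow> level T \<omega> s \<le> level T \<omega> t"
  by (simp add: level_def T_mono)

lemma stopping_time_measurable:
  assumes "stopping_time F \<sigma>" shows "\<sigma> \<in> borel_measurable M"
  using assms by (rule measurable_stopping_time) (auto simp: F_subset_M F.space_F)

lemma pre_sigma_subset_M:
  assumes "stopping_time F \<sigma>" shows "sets (F.pre_sigma \<sigma>) \<subseteq> sets M"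
proof
  fix A assume "A \<in> sets (F.pre_sigma \<sigma>)"
  from F.sets_pre_sigmaD[OF assms this, of \<infinity>] show "A \<in> sets M"
    using F_subset_M by auto
qed

text \<open>On the event \<sigma> \<le> t the time may be replaced by min \<sigma> t, which is known
  at time t; progressive measurability of the level then applies.\<close>

lemma level_stopping_measurable:
  assumes \<sigma>: "stopping_time F \<sigma>"
  shows "(\<lambda>\<omega>. level T \<omega> (enn2real (\<sigma> \<omega>))) \<in> borel_measurable (F.pre_sigma \<sigma>)"
proof (rule borel_measurableI_le)
  fix a :: real
  show "{\<omega> \<in> space (F.pre_sigma \<sigma>). level T \<omega> (enn2real (\<sigma> \<omega>)) \<le> a} \<in> sets (F.pre_sigma \<sigma>)"
  proof (rule F.sets_pre_sigmaI[OF \<sigma>])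
    fix t :: ennreal
    have [measurable]: "(\<lambda>\<omega>. min (\<sigma> \<omega>) t) \<in> borel_measurable (F t)"
    proof (rule borel_measurableI_le)
      fix s
      show "{\<omega> \<in> space (F t). min (\<sigma> \<omega>) t \<le> s} \<in> sets (F t)"
      proof (cases "t \<le> s")
        case False
        then have "{\<omega> \<in> space (F t). min (\<sigma> \<omega>) t \<le> s} = {\<omega> \<in> space (F s). \<sigma> \<omega> \<le> s}"
          by (auto simp: min_le_iff_disj F.space_F)
        also have "\<dots> \<in> sets (F s)" using stopping_timeD[OF \<sigma>] by (simp add: pred_def)
        finally show ?thesis using F.sets_F_mono[of s t] False by (meson linear subsetD)
      qed (auto simp: min_le_iff_disj)
    qed
    have [measurable]: "Measurable.pred (F t) (\<lambda>\<omega>. \<sigma> \<omega> \<le> t)" by (rule stopping_timeD[OF \<sigma>])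
    \<comment> \<open>Outside the event \<sigma> \<le> t the value is immaterial as long as it does
      not exceed t, because that event is intersected with below.\<close>
    define X where "X \<omega> = (if \<sigma> \<omega> \<le> t then enn2real (min (\<sigma> \<omega>) t) else 0)" for \<omega>
    have [measurable]: "X \<in> borel_measurable (F t)" unfolding X_def by measurable
    have [measurable]: "(\<lambda>\<omega>. level T \<omega> (X \<omega>)) \<in> borel_measurable (F t)"
    proof (rule level_measurable_bounded)
      show "ennreal (X \<omega>) \<le> t" for \<omega>
        unfolding X_def by (cases "\<sigma> \<omega>"; cases t) (auto simp: min_def)
    qed (auto simp: F.space_F T_F_measurable)
    have "{\<omega> \<in> space (F t). level T \<omega> (X \<omega>) \<le> a \<and> \<sigma> \<omega> \<le> t} \<in> sets (F t)" by measurable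
    also have "{\<omega> \<in> space (F t). level T \<omega> (X \<omega>) \<le> a \<and> \<sigma> \<omega> \<le> t} =
       {\<omega> \<in> {\<omega> \<in> space (F.pre_sigma \<sigma>). level T \<omega> (enn2real (\<sigma> \<omega>)) \<le> a}. \<sigma> \<omega> \<le> t}"
      by (auto simp: F.space_F F.space_pre_sigma X_def min_def)
    finally show "{\<omega> \<in> {\<omega> \<in> space (F.pre_sigma \<sigma>). level T \<omega> (enn2real (\<sigma> \<omega>)) \<le> a}. \<sigma> \<omega> \<le> t} \<in> sets (F t)" .
  qed
qed

text \<open>Where the dyadic approximation equals s_k, the identity at the fixed time s_k applies,
  and summing over k gives it for the approximation. The limit in m uses right-continuity of the
  paths on one side and continuity of \<psi> on the other, with bounded integrands.\<close>

lemma laplace_after_stopping_M: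
  assumes \<sigma>: "stopping_time F \<sigma>" and A: "A \<in> sets (F.pre_sigma \<sigma>)" and AE: "A \<subseteq> {\<omega>\<in>space M. 0 < \<sigma> \<omega> \<and> \<sigma> \<omega> < \<infinity>}"
    and v: "v 0 = 0" "\<And>i. i < n \<Longrightarrow> v i < v (Suc i)" and l: "\<And>i. 0 \<le> l i"
  shows "(\<integral>\<^sup>+\<omega>. indicator A \<omega> * ennreal (exp (- (\<Sum>i<n. l i * (level T \<omega> (enn2real (\<sigma> \<omega>) + v (Suc i)) - level T \<omega> (enn2real (\<sigma> \<omega>) + v i))))) \<partial>M)
    = (\<integral>\<^sup>+\<omega>. indicator A \<omega> * ennreal (exp (- (\<Sum>i<n. \<psi> (l i * (enn2real (\<sigma> \<omega>) + v (Suc i))) - \<psi> (l i * (enn2real (\<sigma> \<omega>) + v i))))) \<partial>M)"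
proof -
  define \<tau> where "\<tau> \<omega> = enn2real (\<sigma> \<omega>)" for \<omega>
  define \<Phi> where "\<Phi> s \<omega> = exp (- (\<Sum>i<n. l i * (level T \<omega> (s + v (Suc i)) - level T \<omega> (s + v i))))" for s \<omega>
  define \<rho> where "\<rho> s = exp (- (\<Sum>i<n. \<psi> (l i * (s + v (Suc i))) - \<psi> (l i * (s + v i))))" for s
  have v0: "0 \<le> v i" if "i \<le> n" for i
    using that by (induction i) (use v in \<open>auto intro: order_trans[OF _ less_imp_le]\<close>)
  have A_M [measurable]: "A \<in> sets M" using A pre_sigma_subset_M[OF \<sigma>] by blast
  have [measurable]: "\<tau> \<in> borel_measurable M" unfolding \<tau>_def using stopping_time_measurable[OF \<sigma>] by measurable
  have \<tau>: "0 < \<tau> \<omega>" "\<sigma> \<omega> = ennreal (\<tau> \<omega>)" if "\<omega> \<in> A" for \<omega>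
    using AE that unfolding \<tau>_def by (cases "\<sigma> \<omega>"; auto)+
  have \<Phi>_meas: "(\<lambda>\<omega>. \<Phi> (X \<omega>) \<omega>) \<in> borel_measurable M" if "X \<in> borel_measurable M" for X
  proof -
    have [measurable]: "(\<lambda>\<omega>. level T \<omega> (X \<omega> + v i)) \<in> borel_measurable M" for i
      using that by (intro level_measurable borel_measurable_add borel_measurable_const)
    show ?thesis unfolding \<Phi>_def by measurable
  qed
  have \<Phi>_le: "\<Phi> s \<omega> \<le> 1" if "0 < s" "\<omega> \<in> space M" for s \<omega>
    unfolding \<Phi>_def using that v v0
    by (auto intro!: sum_nonneg mult_nonneg_nonneg l level_mono simp: add_pos_nonneg less_imp_le)
  have \<rho>_le: "\<rho> s \<le> 1" if "0 < s" for s
    unfolding \<rho>_def using that v v0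
    by (auto intro!: sum_nonneg \<psi>_diff(2) l simp: add_pos_nonneg less_imp_le)
  define I where "I f = (\<integral>\<^sup>+\<omega>. indicator A \<omega> * ennreal (f \<omega>) \<partial>M)" for f
  have step: "I (\<lambda>\<omega>. \<Phi> (dyadic m (\<tau> \<omega>)) \<omega>) = I (\<lambda>\<omega>. \<rho> (dyadic m (\<tau> \<omega>)))" for m
  proof -
    define A' where "A' k = {\<omega>\<in>A. nat \<lfloor>2 ^ m * \<tau> \<omega>\<rfloor> = k}" for k
    define s where "s k = (real k + 1) / 2 ^ m" for k
    have s: "0 < s k" for k by (simp add: s_def add_pos_nonneg)
    have A'_F: "A' k \<in> sets (F (ennreal (s k)))" for k
    proof -
      \<comment> \<open>That \<open>A\<close> is known at the stopping time yields an event of the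
        filtration at s_k only after cutting \<open>A\<close> with \<sigma> \<le> s_k. The other two
        sets express that the floor equals \<open>k\<close>, that is, k / 2^m \<le> \<sigma> <
        s_k.\<close>
      have eq: "A' k = {\<omega>\<in>A. \<sigma> \<omega> \<le> ennreal (s k)} \<inter> {\<omega>\<in>space (F (ennreal (s k))). \<sigma> \<omega> < ennreal (s k)}
          - {\<omega>\<in>space (F (ennreal (real k / 2 ^ m))). \<sigma> \<omega> < ennreal (real k / 2 ^ m)}" (is "_ = ?R")
      proof (intro set_eqI)
        fix \<omega>
        show "\<omega> \<in> A' k \<longleftrightarrow> \<omega> \<in> ?R"
        proof (cases "\<omega> \<in> A")
          case True
          have sp: "\<omega> \<in> space M" using True AE by auto
          have pos: "0 \<le> \<lfloor>2 ^ m * \<tau> \<omega>\<rfloor>" using \<tau>[OF True] by simp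
          have "nat \<lfloor>2 ^ m * \<tau> \<omega>\<rfloor> = k \<longleftrightarrow> \<lfloor>2 ^ m * \<tau> \<omega>\<rfloor> = int k" using pos by linarith
          also have "\<dots> \<longleftrightarrow> real k \<le> 2 ^ m * \<tau> \<omega> \<and> 2 ^ m * \<tau> \<omega> < real k + 1" by (simp add: floor_eq_iff)
          also have "\<dots> \<longleftrightarrow> real k / 2 ^ m \<le> \<tau> \<omega> \<and> \<tau> \<omega> < s k" by (simp add: s_def field_simps)
          finally have "nat \<lfloor>2 ^ m * \<tau> \<omega>\<rfloor> = k \<longleftrightarrow> real k / 2 ^ m \<le> \<tau> \<omega> \<and> \<tau> \<omega> < s k" .
          then show ?thesis
            using True \<tau>[OF True] sp s[of k] by (auto simp: A'_def F.space_F ennreal_less_iff not_less ennreal_le_iff less_imp_le)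
        qed (auto simp: A'_def)
      qed
      have "{\<omega>\<in>A. \<sigma> \<omega> \<le> ennreal (s k)} \<in> sets (F (ennreal (s k)))"
        by (rule F.sets_pre_sigmaD[OF \<sigma> A])
      moreover have "{\<omega>\<in>space (F t). \<sigma> \<omega> < t} \<in> sets (F t)" for t
        using F.stopping_time_less_const[OF \<sigma>] by (simp add: pred_def)
      moreover have "sets (F (ennreal (real k / 2 ^ m))) \<subseteq> sets (F (ennreal (s k)))"
        by (intro F.sets_F_mono ennreal_leI) (simp add: s_def divide_right_mono)
      ultimately show ?thesis unfolding eq by blast
    qed
    then have A'_M [measurable]: "A' k \<in> sets M" for k using F_subset_M by blast
    have split: "I (\<lambda>\<omega>. f (dyadic m (\<tau> \<omega>)) \<omega>) = (\<Sum>k. \<integral>\<^sup>+\<omega>. indicator (A' k) \<omega> * ennreal (f (s k) \<omega>) \<partial>M)"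
      if [measurable]: "\<And>k. f (s k) \<in> borel_measurable M" for f
    proof -
      have "indicator A \<omega> * ennreal (f (dyadic m (\<tau> \<omega>)) \<omega>) = (\<Sum>k. indicator (A' k) \<omega> * ennreal (f (s k) \<omega>))" for \<omega>
      proof -
        have "(\<Sum>k. indicator (A' k) \<omega> * ennreal (f (s k) \<omega>))
          = (\<Sum>k\<in>{nat \<lfloor>2 ^ m * \<tau> \<omega>\<rfloor>}. indicator (A' k) \<omega> * ennreal (f (s k) \<omega>))"
          by (rule suminf_finite) (auto simp: A'_def)
        then show ?thesis by (simp add: A'_def dyadic_def s_def indicator_def)
      qed
      then have "I (\<lambda>\<omega>. f (dyadic m (\<tau> \<omega>)) \<omega>) = (\<integral>\<^sup>+\<omega>. (\<Sum>k. indicator (A' k) \<omega> * ennreal (f (s k) \<omega>)) \<partial>M)"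
        by (simp add: I_def)
      also have "\<dots> = (\<Sum>k. \<integral>\<^sup>+\<omega>. indicator (A' k) \<omega> * ennreal (f (s k) \<omega>) \<partial>M)"
        by (rule nn_integral_suminf) measurable
      finally show ?thesis .
    qed
    have "(\<integral>\<^sup>+\<omega>. indicator (A' k) \<omega> * ennreal (\<Phi> (s k) \<omega>) \<partial>M) = (\<integral>\<^sup>+\<omega>. indicator (A' k) \<omega> * ennreal (\<rho> (s k)) \<partial>M)" for k
    proof -
      have lev: "level T \<omega> (s k + v i) = T (s k + v i) \<omega>" if "i \<le> n" for i \<omega>
        using v0[OF that] s[of k] by (simp add: level_def)
      have "(\<Sum>i<n. l i * (level T \<omega> (s k + v (Suc i)) - level T \<omega> (s k + v i))) = (\<Sum>i<n. l i * (T (s k + v (Suc i)) \<omega> - T (s k + v i) \<omega>))" for \<omega>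
        by (intro sum.cong refl) (simp add: lev)
      then show ?thesis
        using laplace_increments_past[of "\<lambda>i. s k + v i" n l "A' k"] s[of k] v l A'_F[of k]
        by (simp add: nn_integral_multc \<Phi>_def \<rho>_def)
    qed
    then show ?thesis
      by (subst (1 2) split) (simp_all add: \<Phi>_meas)
  qed
  have bnd: "indicator A \<omega> * ennreal x \<le> 1" if "\<omega> \<in> A \<Longrightarrow> x \<le> 1" for x \<omega>
    using that by (auto simp: indicator_def ennreal_le_1)
  have dy: "0 < dyadic m (\<tau> \<omega>)" if "\<omega> \<in> A" for \<omega> m
    using dyadic_bounds(1)[of "\<tau> \<omega>" m] \<tau>(1)[OF that] by simp
  have [measurable]: "(\<lambda>\<omega>. dyadic m (\<tau> \<omega>)) \<in> borel_measurable M" for m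
    unfolding dyadic_def by measurable
  have fin: "(\<integral>\<^sup>+\<omega>. 1 \<partial>M) < \<infinity>" by (simp add: emeasure_space_1)
  have L1: "(\<lambda>m. I (\<lambda>\<omega>. \<Phi> (dyadic m (\<tau> \<omega>)) \<omega>)) \<longlonglongrightarrow> I (\<lambda>\<omega>. \<Phi> (\<tau> \<omega>) \<omega>)"
    unfolding I_def
  proof (rule nn_integral_dominated_convergence[OF _ _ _ _ fin])
    show "AE \<omega> in M. indicator A \<omega> * ennreal (\<Phi> (dyadic m (\<tau> \<omega>)) \<omega>) \<le> 1" for m
      using dy AE by (intro AE_I2 bnd \<Phi>_le) auto
    show "AE \<omega> in M. (\<lambda>m. indicator A \<omega> * ennreal (\<Phi> (dyadic m (\<tau> \<omega>)) \<omega>)) \<longlonglongrightarrow> indicator A \<omega> * ennreal (\<Phi> (\<tau> \<omega>) \<omega>)"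
    proof (intro AE_I2)
      fix \<omega> assume \<omega>: "\<omega> \<in> space M"
      show "(\<lambda>m. indicator A \<omega> * ennreal (\<Phi> (dyadic m (\<tau> \<omega>)) \<omega>)) \<longlonglongrightarrow> indicator A \<omega> * ennreal (\<Phi> (\<tau> \<omega>) \<omega>)"
      proof (cases "\<omega> \<in> A")
        case True
        have lim: "(\<lambda>m. level T \<omega> (dyadic m (\<tau> \<omega>) + v i)) \<longlonglongrightarrow> level T \<omega> (\<tau> \<omega> + v i)" if "i \<le> n" for i
          using \<tau>(1)[OF True] v0[OF that] dyadic_bounds(1)[of "\<tau> \<omega>"]
          by (intro level_seq \<omega> tendsto_add dyadic_tendsto tendsto_const) (auto intro: less_imp_le)
        have "(\<lambda>m. \<Phi> (dyadic m (\<tau> \<omega>)) \<omega>) \<longlonglongrightarrow> \<Phi> (\<tau> \<omega>) \<omega>"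
          unfolding \<Phi>_def by (intro tendsto_intros lim) auto
        then show ?thesis using True by (simp add: tendsto_ennrealI)
      qed simp
    qed
  qed (auto intro!: borel_measurable_times_ennreal measurable_compose[OF \<Phi>_meas] \<Phi>_meas)
  \<comment> \<open>The dyadic approximation takes countably many values, so composing it with
    \<rho> is measurable whatever \<rho> is; measurability at \<tau> itself then follows in the
    limit.\<close>
  have [measurable]: "(\<lambda>\<omega>. indicator A \<omega> * ennreal (\<rho> (dyadic m (\<tau> \<omega>)))) \<in> borel_measurable M" for m
  proof -
    have "(\<lambda>\<omega>. \<rho> ((real (nat \<lfloor>2 ^ m * \<tau> \<omega>\<rfloor>) + 1) / 2 ^ m)) \<in> borel_measurable M"
      by (rule measurable_compose_countable[where f="\<lambda>k \<omega>. \<rho> ((real k + 1) / 2 ^ m)"]) auto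
    then show ?thesis unfolding dyadic_def by measurable
  qed
  have conv: "(\<lambda>m. indicator A \<omega> * ennreal (\<rho> (dyadic m (\<tau> \<omega>)))) \<longlonglongrightarrow> indicator A \<omega> * ennreal (\<rho> (\<tau> \<omega>))" for \<omega>
  proof (cases "\<omega> \<in> A")
    case True
    have lim: "(\<lambda>m. \<psi> (l j * (dyadic m (\<tau> \<omega>) + v i))) \<longlonglongrightarrow> \<psi> (l j * (\<tau> \<omega> + v i))" if "i \<le> n" for i j
    proof -
      have "isCont (\<lambda>r. \<psi> (l j * r)) (\<tau> \<omega> + v i)"
        using \<tau>(1)[OF True] v0[OF that] by (intro \<Psi>_isCont l) simp
      moreover have "(\<lambda>m. dyadic m (\<tau> \<omega>) + v i) \<longlonglongrightarrow> \<tau> \<omega> + v i"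
        using \<tau>(1)[OF True] by (intro tendsto_add dyadic_tendsto tendsto_const) simp
      ultimately show ?thesis by (rule isCont_tendsto_compose)
    qed
    have "(\<lambda>m. \<rho> (dyadic m (\<tau> \<omega>))) \<longlonglongrightarrow> \<rho> (\<tau> \<omega>)"
      unfolding \<rho>_def by (intro tendsto_intros lim) auto
    then show ?thesis using True by (simp add: tendsto_ennrealI)
  qed simp
  have L2: "(\<lambda>m. I (\<lambda>\<omega>. \<rho> (dyadic m (\<tau> \<omega>)))) \<longlonglongrightarrow> I (\<lambda>\<omega>. \<rho> (\<tau> \<omega>))"
    unfolding I_def
  proof (rule nn_integral_dominated_convergence[OF _ _ _ _ fin])
    show "AE \<omega> in M. indicator A \<omega> * ennreal (\<rho> (dyadic m (\<tau> \<omega>))) \<le> 1" for m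
      using dy by (intro AE_I2 bnd \<rho>_le) auto
    show "AE \<omega> in M. (\<lambda>m. indicator A \<omega> * ennreal (\<rho> (dyadic m (\<tau> \<omega>)))) \<longlonglongrightarrow> indicator A \<omega> * ennreal (\<rho> (\<tau> \<omega>))"
      by (intro AE_I2 conv)
    show "(\<lambda>\<omega>. indicator A \<omega> * ennreal (\<rho> (\<tau> \<omega>))) \<in> borel_measurable M"
      by (rule borel_measurable_LIMSEQ_order[OF conv]) measurable
  qed auto
  have "I (\<lambda>\<omega>. \<Phi> (\<tau> \<omega>) \<omega>) = I (\<lambda>\<omega>. \<rho> (\<tau> \<omega>))"
    using L1 L2 unfolding step by (rule LIMSEQ_unique)
  then show ?thesis by (simp add: I_def \<Phi>_def \<rho>_def \<tau>_def)
qed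

end

section \<open>Coupling with the hold-jump construction\<close>

text \<open>The index is cut off at \<open>n\<close>, so \<open>v\<close> is constant from there on
  and monotone on all indices, as the locale \<open>hold_jump_steps\<close> requires. Zero is
  inserted because increments are counted from the start.\<close>

lemma finite_times_enumeration:
  fixes J :: "real set"
  assumes "finite J" "J \<subseteq> {0..}"
  obtains v n where "v 0 = 0" "\<And>i. i < n \<Longrightarrow> v i < v (Suc i)" "\<And>i j. i \<le> j \<Longrightarrow> v i \<le> v j" "insert 0 J = v ` {..n::nat}"
proof -
  define xs where "xs = sorted_list_of_set (insert 0 J)"
  have xs: "sorted xs" "distinct xs" "set xs = insert 0 J"
    using assms by (simp_all add: xs_def del: sorted_list_of_set_insert_remove)
  define n where "n = length xs - 1"
  have "xs \<noteq> []" using xs(3) by auto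
  then have len: "length xs = Suc n" by (cases xs) (auto simp: n_def)
  define v where "v i = xs ! min i n" for i
  have mono: "v i \<le> v j" if "i \<le> j" for i j
    unfolding v_def using that len by (intro sorted_nth_mono xs) auto
  have img: "insert 0 J = v ` {..n}"
  proof -
    have "insert 0 J = (\<lambda>i. xs ! i) ` {..<length xs}"
      unfolding xs(3)[symmetric] by (auto simp: in_set_conv_nth)
    also have "\<dots> = v ` {..n}" unfolding len v_def by (intro image_cong) auto
    finally show ?thesis .
  qed
  show thesis
  proof (rule that)
    show "v i < v (Suc i)" if "i < n" for i
    proof -
      have "xs ! i \<noteq> xs ! Suc i" using that xs(2) len by (simp add: nth_eq_iff_index_eq)
      then show ?thesis using mono[of i "Suc i"] that by (simp add: v_def)
    qed
    obtain i where i: "i \<le> n" "v i = 0" using img by (metis atMost_iff imageE insertI1)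
    have "v 0 \<in> insert 0 J" using img by auto
    then have "0 \<le> v 0" using assms by auto
    then show "v 0 = 0" using mono[of 0 i] i by simp
  qed (use mono img in auto)
qed

text \<open>Common setting for both halves of the theorem: \<open>P\<close> is \<open>M\<close> for
  a fixed time and \<open>M\<close> conditioned on 0 < \<sigma> < \<infinity> for a stopping time,
  and \<open>G\<close> is the algebra conditioned on. \<open>AE_P\<close> carries almost sure path
  properties from \<open>M\<close> to \<open>P\<close>.\<close>

locale after_time = ssa M T \<theta> N J k + P: prob_space P
  for M :: "'a measure" and T \<theta> and N :: "'b measure" and J k and P :: "'a measure" +
  fixes G :: "'a measure" and \<tau> :: "'a \<Rightarrow> real"
  assumes sets_P [measurable_cong]: "sets P = sets M"
    and AE_P: "\<And>Q. AE \<omega> in M. Q \<omega> \<Longrightarrow> AE \<omega> in P. Q \<omega>"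
    and G: "subalgebra P G"
    and \<tau>_G [measurable]: "\<tau> \<in> borel_measurable G"
    and level_\<tau>_G [measurable]: "(\<lambda>\<omega>. level T \<omega> (\<tau> \<omega>)) \<in> borel_measurable G"
    and \<tau>_pos: "AE \<omega> in P. 0 < \<tau> \<omega>"
    and laplace: "laplace_after P G \<tau>"
begin

lemma space_P: "space P = space M"
  using sets_eq_imp_space_eq[OF sets_P] .

lemma space_G: "space G = space M" using G by (simp add: subalgebra_def space_P)

lemma sets_G: "A \<in> sets G \<Longrightarrow> A \<in> sets M" using G sets_P by (auto simp: subalgebra_def)

lemma G_to_P: "f \<in> G \<rightarrow>\<^sub>M L \<Longrightarrow> f \<in> P \<rightarrow>\<^sub>M L"
  by (rule measurable_from_subalg[OF G])

lemma G_to_M: "f \<in> G \<rightarrow>\<^sub>M L \<Longrightarrow> f \<in> M \<rightarrow>\<^sub>M L"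
  using G_to_P by (simp cong: measurable_cong_sets add: sets_P)

lemma \<tau>_M [measurable]: "\<tau> \<in> borel_measurable M" by (rule G_to_M[OF \<tau>_G])

lemma id_P_G [measurable]: "(\<lambda>\<omega>. \<omega>) \<in> P \<rightarrow>\<^sub>M G"
  by (rule G_to_P) simp

abbreviation "\<Pi>\<^sub>0 \<equiv> \<Pi>\<^sub>M v\<in>{0::real..}. (borel :: real measure)"

text \<open>Paths are compared through their increments since the start, so that both sides begin at
  0; the initial level is \<open>G\<close>-measurable and can be added back afterwards.\<close>

definition dpath :: "'a \<Rightarrow> real \<Rightarrow> real" where
  "dpath \<omega> = (\<lambda>v\<in>{0..}. level T \<omega> (\<tau> \<omega> + v) - level T \<omega> (\<tau> \<omega>))"

definition cpath :: "real \<Rightarrow> (nat \<Rightarrow> real \<times> real) \<Rightarrow> real \<Rightarrow> real" where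
  "cpath s w = (\<lambda>v\<in>{0..}. hold_jump_path w (s, 0) (s + v))"

sublocale PW: pair_prob_space P W ..

lemma level_shift_measurable [measurable]: "(\<lambda>\<omega>. level T \<omega> (\<tau> \<omega> + v)) \<in> borel_measurable M"
  by (intro level_measurable borel_measurable_add borel_measurable_const \<tau>_M)

lemma level_\<tau>_M [measurable]: "(\<lambda>\<omega>. level T \<omega> (\<tau> \<omega>)) \<in> borel_measurable M"
  by (intro level_measurable \<tau>_M)

lemma dpath_measurable [measurable]: "dpath \<in> P \<rightarrow>\<^sub>M \<Pi>\<^sub>0"
  unfolding dpath_def by measurable

lemma hold_jump_path_shift_measurable:
  assumes [measurable]: "w \<in> L \<rightarrow>\<^sub>M W" "s \<in> borel_measurable L"
  shows "(\<lambda>z. hold_jump_path (w z) (s z, 0) (s z + v)) \<in> borel_measurable L"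
  by (rule measurable_hold_jump_path) measurable

lemma cpath_measurable:
  assumes "w \<in> L \<rightarrow>\<^sub>M W" "s \<in> borel_measurable L"
  shows "(\<lambda>z. cpath (s z) (w z)) \<in> L \<rightarrow>\<^sub>M \<Pi>\<^sub>0"
  unfolding cpath_def by (intro measurable_restrict hold_jump_path_shift_measurable assms)

lemma cpath_measurable_G [measurable]: "(\<lambda>(\<omega>, w). cpath (\<tau> \<omega>) w) \<in> G \<Otimes>\<^sub>M W \<rightarrow>\<^sub>M \<Pi>\<^sub>0"
  unfolding case_prod_beta by (rule cpath_measurable) measurable

lemma fst_PW_G [measurable]: "fst \<in> P \<Otimes>\<^sub>M W \<rightarrow>\<^sub>M G"
  using measurable_compose[OF measurable_fst id_P_G] by simp

lemma cpath_measurable_P [measurable]: "(\<lambda>(\<omega>, w). cpath (\<tau> \<omega>) w) \<in> P \<Otimes>\<^sub>M W \<rightarrow>\<^sub>M \<Pi>\<^sub>0"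
  unfolding case_prod_beta
  by (rule cpath_measurable) (auto intro: measurable_compose[OF fst_PW_G \<tau>_G])

lemma AE_PW: "AE z in P \<Otimes>\<^sub>M W. 0 < \<tau> (fst z) \<and> good (snd z)"
proof -
  have "AE z in P \<Otimes>\<^sub>M W. 0 < \<tau> (fst z)"
  proof (rule AE_distrD[of fst _ P])
    show "AE \<omega> in distr (P \<Otimes>\<^sub>M W) P fst. 0 < \<tau> \<omega>"
      by (subst W.P.distr_pair_fst) (rule \<tau>_pos)
  qed simp
  moreover have "AE z in P \<Otimes>\<^sub>M W. good (snd z)"
  proof (rule AE_distrD[of snd _ W])
    have "distr (P \<Otimes>\<^sub>M W) W snd = W"
    proof (rule measure_eqI)
      fix A assume "A \<in> sets (distr (P \<Otimes>\<^sub>M W) W snd)"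
      then have A: "A \<in> sets W" by simp
      have "emeasure (distr (P \<Otimes>\<^sub>M W) W snd) A = emeasure (P \<Otimes>\<^sub>M W) (space P \<times> A)"
        using A sets.sets_into_space[OF A]
        by (subst emeasure_distr) (auto simp: space_pair_measure intro!: arg_cong[where f="emeasure _"])
      then show "emeasure (distr (P \<Otimes>\<^sub>M W) W snd) A = emeasure W A"
        using A by (simp add: W.P.emeasure_pair_measure_Times P.emeasure_space_1)
    qed simp
    then show "AE w in distr (P \<Otimes>\<^sub>M W) W snd. good w" by (simp only: AE_good)
  qed simp
  ultimately show ?thesis by eventually_elim simp
qed

lemma hold_jump_path_start: "good w \<Longrightarrow> 0 < s \<Longrightarrow> hold_jump_path w (s, 0) s = 0"
  using hold_jump_path_eq[of w s s 0] S_strict[of w s 0] by simp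

lemma hold_jump_path_mono:
  assumes "good w" "0 < s" "a \<le> b" shows "hold_jump_path w (s, 0) a \<le> hold_jump_path w (s, 0) b"
proof -
  obtain m where m: "b < S w s m"
    using eventually_happens[OF S_unbounded[OF assms(1,2), of b]] by auto
  then have m: "b < S w s (Suc m)" using S_strict[OF assms(1,2), of m] by linarith
  have "0 < snd (w i)" for i using assms(1) by (auto simp: good_def)
  then have pos: "0 \<le> S w s (Suc i) * snd (w i)" for i
    using S_pos[OF assms(1,2), of "Suc i"] by (simp add: less_imp_le)
  have "(\<Sum>k<m. if S w s (Suc k) \<le> a then S w s (Suc k) * snd (w k) else 0) \<le> (\<Sum>k<m. if S w s (Suc k) \<le> b then S w s (Suc k) * snd (w k) else 0)"
    using assms(3) by (intro sum_mono) (simp add: pos)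
  then show ?thesis
    using m assms by (subst (1 2) hold_jump_path_eq[where m=m]) auto
qed

text \<open>For each fixed \<omega> the chain is run from \<tau>(\<omega>) over the grid
  \<tau>(\<omega>) + v_i. No grid point precedes the start, so the clipping in \<open>V\<close> is
  void and V at \<tau>(\<omega>) is the right-hand integrand of
  \<open>laplace_after\<close>.\<close>

lemma laplace_couple:
  assumes A: "A \<in> sets G" and v: "v 0 = 0" "\<And>i. i < n \<Longrightarrow> v i < v (Suc i)" "\<And>i j. i \<le> j \<Longrightarrow> v i \<le> v j"
    and l: "\<And>i. 0 \<le> l i"
  shows "(\<integral>\<^sup>+\<omega>. indicator A \<omega> * ennreal (exp (- (\<Sum>i<n. l i * (level T \<omega> (\<tau> \<omega> + v (Suc i)) - level T \<omega> (\<tau> \<omega> + v i))))) \<partial>P)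
    = (\<integral>\<^sup>+z. indicator A (fst z) * ennreal (exp (- (\<Sum>i<n. l i * (hold_jump_path (snd z) (\<tau> (fst z), 0) (\<tau> (fst z) + v (Suc i))
          - hold_jump_path (snd z) (\<tau> (fst z), 0) (\<tau> (fst z) + v i))))) \<partial>(P \<Otimes>\<^sub>M W))"
proof -
  let ?h = "\<lambda>\<omega> w. ennreal (exp (- (\<Sum>i<n. l i * (hold_jump_path w (\<tau> \<omega>, 0) (\<tau> \<omega> + v (Suc i))
          - hold_jump_path w (\<tau> \<omega>, 0) (\<tau> \<omega> + v i)))))"
  let ?\<psi> = "\<lambda>\<omega>. \<Sum>i<n. \<psi> (l i * (\<tau> \<omega> + v (Suc i))) - \<psi> (l i * (\<tau> \<omega> + v i))"
  have [measurable]: "A \<in> sets P" using sets_G[OF A] sets_P by simp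
  have [measurable]: "(\<lambda>z. hold_jump_path (snd z) (\<tau> (fst z), 0) (\<tau> (fst z) + v i)) \<in> borel_measurable (P \<Otimes>\<^sub>M W)" for i
    by (rule hold_jump_path_shift_measurable) (auto intro: measurable_compose[OF fst_PW_G \<tau>_G])
  have "(\<integral>\<^sup>+\<omega>. indicator A \<omega> * ennreal (exp (- (\<Sum>i<n. l i * (level T \<omega> (\<tau> \<omega> + v (Suc i)) - level T \<omega> (\<tau> \<omega> + v i))))) \<partial>P)
    = (\<integral>\<^sup>+\<omega>. indicator A \<omega> * ennreal (exp (- ?\<psi> \<omega>)) \<partial>P)"
    using laplace A v(1,2) l unfolding laplace_after_def by blast
  also have "\<dots> = (\<integral>\<^sup>+\<omega>. \<integral>\<^sup>+w. indicator A \<omega> * ?h \<omega> w \<partial>W \<partial>P)"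
  proof (rule nn_integral_cong_AE)
    show "AE \<omega> in P. indicator A \<omega> * ennreal (exp (- ?\<psi> \<omega>))
      = (\<integral>\<^sup>+w. indicator A \<omega> * ?h \<omega> w \<partial>W)"
      using \<tau>_pos
    proof eventually_elim
      fix \<omega> assume \<tau>: "0 < \<tau> \<omega>"
      interpret hold_jump_steps D \<theta> "\<lambda>l r. \<psi> (l * r)" n "\<lambda>i. \<tau> \<omega> + v i" l
        by unfold_locales (use v l \<tau> in auto)
      have "max (\<tau> \<omega>) (\<tau> \<omega> + v i) = \<tau> \<omega> + v i" for i using v(3)[of 0 i] v(1) by simp
      then have "V (\<tau> \<omega>) = exp (- ?\<psi> \<omega>)"
        by (simp add: V_def)
      moreover have "(\<lambda>w. hold_jump_path w (\<tau> \<omega>, 0) (\<tau> \<omega> + v i)) \<in> borel_measurable W" for i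
        by (rule hold_jump_path_shift_measurable) auto
      ultimately show "indicator A \<omega> * ennreal (exp (- ?\<psi> \<omega>))
      = (\<integral>\<^sup>+w. indicator A \<omega> * ?h \<omega> w \<partial>W)"
        using hold_jump_path_laplace[OF \<tau>] by (subst nn_integral_cmult) auto
    qed
  qed
  also have "\<dots> = (\<integral>\<^sup>+z. indicator A (fst z) * ?h (fst z) (snd z) \<partial>(P \<Otimes>\<^sub>M W))"
    by (subst W.P.nn_integral_fst[symmetric]) auto
  finally show ?thesis .
qed

text \<open>The variables for the uniqueness theorem are the increments since the start, the
  coordinates of the path, whereas the known functional concerns successive intervals. Summation by
  parts converts weights \<open>m\<close> of the former into weights \<open>l\<close> of the latter,
  which are tail sums of \<open>m\<close>.\<close>

lemma rectangle_couple:
  assumes A: "A \<in> sets G" and I: "finite I" "I \<subseteq> {0..}" and B: "\<And>x. x \<in> I \<Longrightarrow> B x \<in> sets borel"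
  shows "(\<integral>\<^sup>+\<omega>. indicator A \<omega> * indicator {f\<in>space \<Pi>\<^sub>0. \<forall>x\<in>I. f x \<in> B x} (dpath \<omega>) \<partial>P)
    = (\<integral>\<^sup>+z. indicator A (fst z) * indicator {f\<in>space \<Pi>\<^sub>0. \<forall>x\<in>I. f x \<in> B x} (cpath (\<tau> (fst z)) (snd z)) \<partial>(P \<Otimes>\<^sub>M W))"
proof -
  let ?R = "{f\<in>space \<Pi>\<^sub>0. \<forall>x\<in>I. f x \<in> B x}"
  let ?p = "\<lambda>z. hold_jump_path (snd z) (\<tau> (fst z), 0)"
  obtain v n where v: "v 0 = 0" "\<And>i. i < n \<Longrightarrow> v i < v (Suc i)" "\<And>i j. i \<le> j \<Longrightarrow> v i \<le> v j" "insert 0 I = v ` {..n}"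
    using finite_times_enumeration[OF I] by metis
  have v0: "0 \<le> v i" for i using v(3)[of 0 i] v(1) by simp
  define X where "X i \<omega> = level T \<omega> (\<tau> \<omega> + v (Suc i)) - level T \<omega> (\<tau> \<omega>)" for i \<omega>
  define Y where "Y i z = ?p z (\<tau> (fst z) + v (Suc i)) - ?p z (\<tau> (fst z) + 0)" for i and z :: "'a \<times> (nat \<Rightarrow> real \<times> real)"
  define B' where "B' x = (if x \<in> I then B x else UNIV)" for x
  have B': "B' x \<in> sets borel" for x using B by (simp add: B'_def)
  have A_P [measurable]: "A \<in> sets P" using sets_G[OF A] sets_P by simp
  have Y_meas: "(\<lambda>z. ?p z (\<tau> (fst z) + x)) \<in> borel_measurable (P \<Otimes>\<^sub>M W)" for x
    by (rule hold_jump_path_shift_measurable) (auto intro: measurable_compose[OF fst_PW_G \<tau>_G])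
  \<comment> \<open>At time 0 both paths are almost surely 0, so a condition there is a constant
    factor.\<close>
  define c where "c = (if 0 \<in> B' 0 then 1 else 0 :: ennreal)"
  have telescope: "(\<Sum>i<n. m i * (h (Suc i) - h 0)) = (\<Sum>i<n. (\<Sum>j\<in>{i..<n}. m j) * (h (Suc i) - h i))" for m h :: "nat \<Rightarrow> real"
  proof -
    have "(\<Sum>i<n. m i * (h (Suc i) - h 0)) = (\<Sum>i<n. \<Sum>k\<in>{..<Suc i}. m i * (h (Suc k) - h k))"
      by (simp only: sum_lessThan_telescope sum_distrib_left[symmetric])
    also have "\<dots> = (\<Sum>i<n. \<Sum>k<n. if k \<le> i then m i * (h (Suc k) - h k) else 0)"
      by (intro sum.cong refl sum.mono_neutral_cong_left) auto
    also have "\<dots> = (\<Sum>k<n. \<Sum>i<n. if k \<le> i then m i * (h (Suc k) - h k) else 0)"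
      by (rule sum.swap)
    also have "\<dots> = (\<Sum>k<n. \<Sum>i\<in>{k..<n}. m i * (h (Suc k) - h k))"
      by (intro sum.cong refl sum.mono_neutral_cong_right) auto
    finally show ?thesis by (simp only: sum_distrib_right)
  qed
  let ?X = "\<lambda>\<omega>. \<Prod>i<n. indicator (B' (v (Suc i))) (X i \<omega>)" and ?Y = "\<lambda>z. \<Prod>i<n. indicator (B' (v (Suc i))) (Y i z)"
  have "(\<integral>\<^sup>+\<omega>. indicator A \<omega> * ?X \<omega> \<partial>P)
    = (\<integral>\<^sup>+z. indicator A (fst z) * ?Y z \<partial>(P \<Otimes>\<^sub>M W))"
  proof (rule laplace_unique_multi)
    show "X i \<in> borel_measurable P" for i unfolding X_def by measurable
    show "(\<lambda>\<omega>. indicator A \<omega>) \<in> borel_measurable P" by measurable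
    show "Y i \<in> borel_measurable (P \<Otimes>\<^sub>M W)" for i
      unfolding Y_def by (intro borel_measurable_diff Y_meas)
    show "(\<lambda>z. indicator A (fst z)) \<in> borel_measurable (P \<Otimes>\<^sub>M W)" by measurable
    show "AE \<omega> in P. 0 \<le> X i \<omega>" for i
      using \<tau>_pos AE_space
      by eventually_elim (use v0 in \<open>simp add: X_def level_mono space_P\<close>)
    show "AE z in P \<Otimes>\<^sub>M W. 0 \<le> Y i z" for i
      using AE_PW by eventually_elim (use v0 in \<open>auto simp: Y_def intro: hold_jump_path_mono\<close>)
    show "(\<integral>\<^sup>+\<omega>. indicator A \<omega> \<partial>P) < \<infinity>" by (simp add: P.emeasure_eq_measure)
    show "B' (v (Suc i)) \<in> sets borel" for i by (rule B')
    fix m :: "nat \<Rightarrow> nat"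
    define l where "l i = (\<Sum>j\<in>{i..<n}. real (m j))" for i
    have l: "0 \<le> l i" for i by (simp add: l_def sum_nonneg)
    have "(\<Sum>i<n. real (m i) * X i \<omega>) = (\<Sum>i<n. l i * (level T \<omega> (\<tau> \<omega> + v (Suc i)) - level T \<omega> (\<tau> \<omega> + v i)))" for \<omega>
      using telescope[of m "\<lambda>i. level T \<omega> (\<tau> \<omega> + v i)"] by (simp add: X_def l_def v(1))
    moreover have "(\<Sum>i<n. real (m i) * Y i z) = (\<Sum>i<n. l i * (?p z (\<tau> (fst z) + v (Suc i))
          - ?p z (\<tau> (fst z) + v i)))" for z
      using telescope[of m "\<lambda>i. ?p z (\<tau> (fst z) + v i)"] by (simp add: Y_def l_def v(1))
    ultimately show "(\<integral>\<^sup>+\<omega>. indicator A \<omega> * ennreal (exp (- (\<Sum>i<n. real (m i) * X i \<omega>))) \<partial>P)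
      = (\<integral>\<^sup>+z. indicator A (fst z) * ennreal (exp (- (\<Sum>i<n. real (m i) * Y i z))) \<partial>(P \<Otimes>\<^sub>M W))"
      using laplace_couple[OF A v(1-3) l] by simp
  qed
  then have main: "(\<integral>\<^sup>+\<omega>. c * (indicator A \<omega> * ?X \<omega>) \<partial>P)
    = (\<integral>\<^sup>+z. c * (indicator A (fst z) * ?Y z) \<partial>(P \<Otimes>\<^sub>M W))"
    by (auto simp: c_def)
  have rect: "indicator ?R f = c * (\<Prod>i<n. indicator (B' (v (Suc i))) (f (v (Suc i))) :: ennreal)"
    if "f \<in> space \<Pi>\<^sub>0" "f 0 = 0" for f
  proof -
    have "(\<forall>x\<in>I. f x \<in> B x) \<longleftrightarrow> (\<forall>x\<in>insert 0 I. f x \<in> B' x)" by (auto simp: B'_def)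
    also have "\<dots> \<longleftrightarrow> (\<forall>i\<in>{..n}. f (v i) \<in> B' (v i))" unfolding v(4) by simp
    also have "\<dots> \<longleftrightarrow> 0 \<in> B' 0 \<and> (\<forall>i<n. f (v (Suc i)) \<in> B' (v (Suc i)))"
    proof -
      have "{..n} = insert 0 (Suc ` {..<n})" by (simp add: lessThan_Suc_atMost[symmetric] lessThan_Suc_eq_insert_0)
      then show ?thesis using v(1) that(2) by auto
    qed
    finally show ?thesis
      using that(1) by (auto simp: c_def indicator_def intro!: prod.neutral prod_zero[symmetric] intro: sym)
  qed
  have dp: "dpath \<omega> \<in> space \<Pi>\<^sub>0" "dpath \<omega> 0 = 0" "dpath \<omega> (v (Suc i)) = X i \<omega>" for \<omega> i
    using v0 by (auto simp: dpath_def X_def space_PiM)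
  have cp: "cpath s w \<in> space \<Pi>\<^sub>0" for s w by (auto simp: cpath_def space_PiM)
  have "(\<integral>\<^sup>+\<omega>. indicator A \<omega> * indicator ?R (dpath \<omega>) \<partial>P)
    = (\<integral>\<^sup>+\<omega>. c * (indicator A \<omega> * ?X \<omega>) \<partial>P)"
    by (intro nn_integral_cong) (simp only: rect[OF dp(1,2)] dp(3), rule mult.left_commute)
  also note main
  also have "(\<integral>\<^sup>+z. c * (indicator A (fst z) * ?Y z) \<partial>(P \<Otimes>\<^sub>M W))
    = (\<integral>\<^sup>+z. indicator A (fst z) * indicator ?R (cpath (\<tau> (fst z)) (snd z)) \<partial>(P \<Otimes>\<^sub>M W))"
  proof (rule nn_integral_cong_AE)
    show "AE z in P \<Otimes>\<^sub>M W. c * (indicator A (fst z) * ?Y z)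
      = indicator A (fst z) * indicator ?R (cpath (\<tau> (fst z)) (snd z))"
      using AE_PW
    proof eventually_elim
      fix z :: "'a \<times> (nat \<Rightarrow> real \<times> real)" assume z: "0 < \<tau> (fst z) \<and> good (snd z)"
      then have 0: "?p z (\<tau> (fst z)) = 0" by (simp add: hold_jump_path_start)
      then have "cpath (\<tau> (fst z)) (snd z) 0 = 0" "cpath (\<tau> (fst z)) (snd z) (v (Suc i)) = Y i z" for i
        using v0 by (simp_all add: cpath_def Y_def)
      then show "c * (indicator A (fst z) * ?Y z)
      = indicator A (fst z) * indicator ?R (cpath (\<tau> (fst z)) (snd z))"
        by (simp only: rect[OF cp]) (rule mult.left_commute)
    qed
  qed
  finally show ?thesis .
qed

text \<open>For fixed \<open>A\<close> the two sides are finite measures on path space, determined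
  by their finite-dimensional cylinders; products of such \<open>A\<close> with path events then
  generate the \<sigma>-algebra. Keeping \<omega> as first component, measured by \<open>G\<close>,
  retains the conditional law given \<open>G\<close>.\<close>

lemma coupling:
  "distr P (G \<Otimes>\<^sub>M \<Pi>\<^sub>0) (\<lambda>\<omega>. (\<omega>, dpath \<omega>)) = distr (P \<Otimes>\<^sub>M W) (G \<Otimes>\<^sub>M \<Pi>\<^sub>0) (\<lambda>(\<omega>, w). (\<omega>, cpath (\<tau> \<omega>) w))"
    (is "?L = ?R")
proof -
  have m1 [measurable]: "(\<lambda>\<omega>. (\<omega>, dpath \<omega>)) \<in> P \<rightarrow>\<^sub>M G \<Otimes>\<^sub>M \<Pi>\<^sub>0" by measurable
  have m2 [measurable]: "(\<lambda>z. (fst z, cpath (\<tau> (fst z)) (snd z))) \<in> P \<Otimes>\<^sub>M W \<rightarrow>\<^sub>M G \<Otimes>\<^sub>M \<Pi>\<^sub>0"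
    using cpath_measurable_P by (intro measurable_Pair) (auto simp: case_prod_beta)
  have R: "?R = distr (P \<Otimes>\<^sub>M W) (G \<Otimes>\<^sub>M \<Pi>\<^sub>0) (\<lambda>z. (fst z, cpath (\<tau> (fst z)) (snd z)))"
    by (intro distr_cong refl) auto
  interpret L: prob_space ?L by (rule P.prob_space_distr) simp
  have step: "(\<integral>\<^sup>+\<omega>. indicator A \<omega> * indicator C (dpath \<omega>) \<partial>P)
    = (\<integral>\<^sup>+z. indicator A (fst z) * indicator C (cpath (\<tau> (fst z)) (snd z)) \<partial>(P \<Otimes>\<^sub>M W))"
    if A: "A \<in> sets G" and C: "C \<in> sets \<Pi>\<^sub>0" for A C
  proof -
    have [measurable]: "A \<in> sets P" using sets_G[OF A] sets_P by simp
    have [measurable]: "(\<lambda>z. cpath (\<tau> (fst z)) (snd z)) \<in> P \<Otimes>\<^sub>M W \<rightarrow>\<^sub>M \<Pi>\<^sub>0"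
      using cpath_measurable_P by (simp add: case_prod_beta)
    let ?\<mu> = "distr (density P (indicator A)) \<Pi>\<^sub>0 dpath"
    let ?\<nu> = "distr (density (P \<Otimes>\<^sub>M W) (\<lambda>z. indicator A (fst z))) \<Pi>\<^sub>0 (\<lambda>z. cpath (\<tau> (fst z)) (snd z))"
    have \<mu>: "emeasure ?\<mu> C = (\<integral>\<^sup>+\<omega>. indicator A \<omega> * indicator C (dpath \<omega>) \<partial>P)" if [measurable]: "C \<in> sets \<Pi>\<^sub>0" for C
      by (subst nn_integral_indicator[symmetric], simp, subst nn_integral_distr, simp, simp, subst nn_integral_density) auto
    have \<nu>: "emeasure ?\<nu> C = (\<integral>\<^sup>+z. indicator A (fst z) * indicator C (cpath (\<tau> (fst z)) (snd z)) \<partial>(P \<Otimes>\<^sub>M W))" if [measurable]: "C \<in> sets \<Pi>\<^sub>0" for C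
      by (subst nn_integral_indicator[symmetric], simp, subst nn_integral_distr, simp, simp, subst nn_integral_density) auto
    have "?\<mu> = ?\<nu>"
    proof (rule measure_eqI_PiM_infinite)
      show "finite_measure ?\<mu>"
      proof
        have "emeasure ?\<mu> (space ?\<mu>) = (\<integral>\<^sup>+\<omega>. indicator A \<omega> * indicator (space \<Pi>\<^sub>0) (dpath \<omega>) \<partial>P)"
          unfolding space_distr by (rule \<mu>[OF sets.top])
        also have "\<dots> \<le> (\<integral>\<^sup>+\<omega>. 1 \<partial>P)"
          by (rule nn_integral_mono) (auto simp: indicator_def)
        finally have "emeasure ?\<mu> (space ?\<mu>) \<le> (\<integral>\<^sup>+\<omega>. 1 \<partial>P)" .
        then show "emeasure ?\<mu> (space ?\<mu>) \<noteq> \<infinity>" by (auto simp: P.emeasure_space_1 top_unique)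
      qed
      fix B :: "real \<Rightarrow> real set" and I assume I: "finite I" "I \<subseteq> {0..}" "\<And>i. i \<in> I \<Longrightarrow> B i \<in> sets borel"
      have "prod_emb {0..} (\<lambda>_. borel) I (Pi\<^sub>E I B) = {f\<in>space \<Pi>\<^sub>0. \<forall>x\<in>I. f x \<in> B x}"
        by (auto simp: prod_emb_def space_PiM PiE_iff extensional_def)
      moreover have "prod_emb {0..} (\<lambda>_. borel) I (Pi\<^sub>E I B) \<in> sets \<Pi>\<^sub>0"
        using I by (intro sets_PiM_I) auto
      ultimately show "emeasure ?\<mu> (prod_emb {0..} (\<lambda>_. borel) I (Pi\<^sub>E I B)) = emeasure ?\<nu> (prod_emb {0..} (\<lambda>_. borel) I (Pi\<^sub>E I B))"
        using rectangle_couple[OF A I] by (simp only: \<mu> \<nu>)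
    qed auto
    then show ?thesis using \<mu>[OF C] \<nu>[OF C] by simp
  qed
  have "?L = distr (P \<Otimes>\<^sub>M W) (G \<Otimes>\<^sub>M \<Pi>\<^sub>0) (\<lambda>z. (fst z, cpath (\<tau> (fst z)) (snd z)))" (is "_ = ?R'")
  proof (rule measure_eqI_generator_eq[where E="{a \<times> b | a b. a \<in> sets G \<and> b \<in> sets \<Pi>\<^sub>0}" and A="\<lambda>_. space G \<times> space \<Pi>\<^sub>0" and \<Omega>="space G \<times> space \<Pi>\<^sub>0"])
    show "Int_stable {a \<times> b | a b. a \<in> sets G \<and> b \<in> sets \<Pi>\<^sub>0}" by (rule Int_stable_pair_measure_generator)
    show "{a \<times> b | a b. a \<in> sets G \<and> b \<in> sets \<Pi>\<^sub>0} \<subseteq> Pow (space G \<times> space \<Pi>\<^sub>0)" by (rule pair_measure_closed)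
    show "emeasure ?L X = emeasure ?R' X" if X: "X \<in> {a \<times> b | a b. a \<in> sets G \<and> b \<in> sets \<Pi>\<^sub>0}" for X
    proof -
      obtain A C where AC [measurable]: "A \<in> sets G" "C \<in> sets \<Pi>\<^sub>0" and X: "X = A \<times> C" using X by blast
      have [measurable]: "X \<in> sets (G \<Otimes>\<^sub>M \<Pi>\<^sub>0)" unfolding X by simp
      have "emeasure ?L X = (\<integral>\<^sup>+\<omega>. indicator A \<omega> * indicator C (dpath \<omega>) \<partial>P)"
        by (subst nn_integral_indicator[symmetric], simp, subst nn_integral_distr) (auto simp: X indicator_times)
      also have "\<dots> = emeasure ?R' X"
        unfolding step[OF AC]
        by (subst nn_integral_indicator[symmetric], simp, subst nn_integral_distr) (auto simp: X indicator_times)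
      finally show ?thesis .
    qed
  qed (auto simp: sets_pair_measure L.emeasure_finite)
  then show ?thesis unfolding R .
qed

end

section \<open>Recovering the chain from the path\<close>

abbreviation nonneg_rats :: "real set" where "nonneg_rats \<equiv> {q\<in>\<rat>. 0 \<le> q}"

text \<open>For a right-continuous increasing step path \<open>d\<close> these rational infima are the first time at which
  \<open>d\<close> exceeds \<open>y\<close>, and the level it then takes; they depend on countably many coordinates only.\<close>
definition next_step :: "(real \<Rightarrow> real) \<Rightarrow> real \<Rightarrow> real \<times> real" where
  "next_step d y = (real_of_ereal (INF q\<in>nonneg_rats. if y < d q then ereal q else \<infinity>),
     real_of_ereal (INF q\<in>nonneg_rats. if y < d q then ereal (d q) else \<infinity>))"

primrec step_chain :: "(real \<Rightarrow> real) \<Rightarrow> nat \<Rightarrow> real \<times> real" where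
  "step_chain d 0 = (0, 0)"
| "step_chain d (Suc n) = next_step d (snd (step_chain d n))"

lemma countable_nonneg_rats: "countable nonneg_rats"
  using countable_rat by (rule countable_subset[rotated]) auto

lemma measurable_step_chain [measurable (raw)]:
  assumes d: "d \<in> L \<rightarrow>\<^sub>M (\<Pi>\<^sub>M v\<in>{0::real..}. (borel :: real measure))"
  shows "(\<lambda>z. step_chain (d z) n) \<in> L \<rightarrow>\<^sub>M borel \<Otimes>\<^sub>M borel"
proof (induction n)
  case 0 show ?case by simp
next
  case (Suc n)
  have d_q: "(\<lambda>z. d z q) \<in> borel_measurable L" if "q \<in> nonneg_rats" for q
    using measurable_compose[OF d measurable_component_singleton[of q]] that by simp
  have y: "(\<lambda>z. snd (step_chain (d z) n)) \<in> borel_measurable L"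
    using measurable_compose[OF Suc measurable_snd] by simp
  have "(\<lambda>z. INF q\<in>nonneg_rats. if snd (step_chain (d z) n) < d z q then ereal (f q z) else \<infinity>) \<in> borel_measurable L"
    if f: "\<And>q. q \<in> nonneg_rats \<Longrightarrow> f q \<in> borel_measurable L" for f
  proof (rule borel_measurable_INF[OF countable_nonneg_rats])
    fix q assume q: "q \<in> nonneg_rats"
    note [measurable] = d_q[OF q] y f[OF q]
    show "(\<lambda>z. if snd (step_chain (d z) n) < d z q then ereal (f q z) else \<infinity>) \<in> borel_measurable L" by measurable
  qed
  from this[of "\<lambda>q z. q"] this[of "\<lambda>q z. d z q"] d_q
  show ?case by (auto simp: next_step_def intro!: measurable_Pair borel_measurable_real_of_ereal)
qed

text \<open>As the levels increase strictly, d q exceeds y_n exactly when q has reached s_(n+1).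
  Rationals just to the right of s_(n+1) approach the infimum of the times, and any of them before
  s_(n+2) attains the level y_(n+1).\<close>

lemma step_chain_eq:
  assumes s0: "s 0 = 0" "y 0 = 0" and s: "\<And>n. s n < s (Suc n)" "\<And>x. \<exists>n. x < s n" and y: "\<And>n. y n < y (Suc n)"
    and d: "\<And>n v. s n \<le> v \<Longrightarrow> v < s (Suc n) \<Longrightarrow> d v = y n"
  shows "step_chain d n = (s n, y n)"
proof (induction n)
  case 0 show ?case by (simp add: s0)
next
  case (Suc n)
  have s_mono: "strict_mono s" and y_mono: "strict_mono y" using s(1) y by (auto simp: strict_mono_Suc_iff)
  have d_iff: "y n < d q \<longleftrightarrow> s (Suc n) \<le> q" and d_ge: "s (Suc n) \<le> q \<Longrightarrow> y (Suc n) \<le> d q" if "0 \<le> q" for q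
  proof -
    \<comment> \<open>The index of the step that contains \<open>q\<close>.\<close>
    define m where "m = (LEAST m. q < s (Suc m))"
    obtain k where k: "q < s k" using s(2) by blast
    then have "q < s (Suc k)" using s(1)[of k] by linarith
    then have m: "q < s (Suc m)" unfolding m_def by (rule LeastI)
    have "s m \<le> q"
    proof (cases m)
      case (Suc m')
      then have "\<not> q < s (Suc m')" using not_less_Least[of m' "\<lambda>m. q < s (Suc m)"] by (simp add: m_def)
      then show ?thesis using Suc by simp
    qed (use that s0 in simp)
    with m have dq: "d q = y m" by (intro d)
    have "s (Suc n) \<le> q \<longleftrightarrow> n < m"
    proof
      assume "s (Suc n) \<le> q"
      with m have "s (Suc n) < s (Suc m)" by simp
      then show "n < m" using strict_mono_less[OF s_mono] by simp
    next
      assume "n < m"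
      then have "s (Suc n) \<le> s m" using strict_mono_less_eq[OF s_mono] by simp
      with \<open>s m \<le> q\<close> show "s (Suc n) \<le> q" by simp
    qed
    then show "y n < d q \<longleftrightarrow> s (Suc n) \<le> q" "s (Suc n) \<le> q \<Longrightarrow> y (Suc n) \<le> d q"
      using strict_mono_less[OF y_mono] strict_mono_less_eq[OF y_mono] by (auto simp: dq)
  qed
  have s_nonneg: "0 \<le> s k" for k using strict_mono_less_eq[OF s_mono, of 0 k] s0 by simp
  have between: "\<exists>q\<in>nonneg_rats. s (Suc n) < q \<and> q < b" if "s (Suc n) < b" for b
    using Rats_dense_in_real[OF that] s_nonneg[of "Suc n"] by (auto intro: order_trans less_imp_le)
  have "(INF q\<in>nonneg_rats. if y n < d q then ereal q else \<infinity>) = ereal (s (Suc n))"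
  proof (rule INF_eqI)
    show "ereal (s (Suc n)) \<le> (if y n < d q then ereal q else \<infinity>)" if "q \<in> nonneg_rats" for q
      using that d_iff[of q] by auto
    fix x assume x: "\<And>q. q \<in> nonneg_rats \<Longrightarrow> x \<le> (if y n < d q then ereal q else \<infinity>)"
    show "x \<le> ereal (s (Suc n))"
    proof (rule dense_ge)
      fix z assume z: "ereal (s (Suc n)) < z"
      obtain b where b: "s (Suc n) < b" "ereal b \<le> z"
        using z by (cases z) (auto intro: that[of "s (Suc n) + 1"])
      obtain q where "q \<in> nonneg_rats" "s (Suc n) < q" "q < b" using between[OF b(1)] by blast
      then have "x \<le> ereal q" using x[of q] d_iff[of q] by auto
      also have "\<dots> \<le> z" using \<open>q < b\<close> b(2) by (meson ereal_less_eq(3) less_imp_le order_trans)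
      finally show "x \<le> z" .
    qed
  qed
  moreover have "(INF q\<in>nonneg_rats. if y n < d q then ereal (d q) else \<infinity>) = ereal (y (Suc n))"
  proof (rule INF_eqI)
    show "ereal (y (Suc n)) \<le> (if y n < d q then ereal (d q) else \<infinity>)" if "q \<in> nonneg_rats" for q
      using that d_iff[of q] d_ge[of q] by auto
    fix x assume x: "\<And>q. q \<in> nonneg_rats \<Longrightarrow> x \<le> (if y n < d q then ereal (d q) else \<infinity>)"
    obtain q where q: "q \<in> nonneg_rats" "s (Suc n) < q" "q < s (Suc (Suc n))"
      using between[OF s(1)[of "Suc n"]] by blast
    then have "d q = y (Suc n)" by (intro d) auto
    then show "x \<le> ereal (y (Suc n))" using x[OF q(1)] y[of n] by simp
  qed
  ultimately show ?case by (simp add: next_step_def Suc)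
qed

context hold_jump
begin

lemma hold_jump_path_between:
  assumes "good w" "0 < s" "S w s n \<le> v" "v < S w s (Suc n)"
  shows "hold_jump_path w (s, 0) v = snd (hold_jump_chain w (s, 0) n)"
proof -
  have "(LEAST n. v < S w s (Suc n)) = n"
  proof (rule Least_equality)
    show "v < S w s (Suc n)" by fact
    fix k assume "v < S w s (Suc k)"
    then have "S w s n < S w s (Suc k)" using assms(3) by simp
    then have "\<not> Suc k \<le> n" using S_mono[OF assms(1,2), of "Suc k" n] by linarith
    then show "n \<le> k" by simp
  qed
  then show ?thesis by (simp add: hold_jump_path_def)
qed

lemma step_chain_hold_jump:
  assumes w: "good w" "0 < s" and d: "\<And>v. 0 \<le> v \<Longrightarrow> d v = hold_jump_path w (s, 0) (s + v)"
  shows "step_chain d n = (S w s n - s, snd (hold_jump_chain w (s, 0) n))"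
proof (rule step_chain_eq)
  show "S w s n - s < S w s (Suc n) - s" for n using S_strict[OF w] by simp
  show "\<exists>n. x < S w s n - s" for x
    using eventually_happens[OF S_unbounded[OF w, of "x + s"]] by (auto simp: less_diff_eq)
  show "snd (hold_jump_chain w (s, 0) n) < snd (hold_jump_chain w (s, 0) (Suc n))" for n
    using S_pos[OF w, of "Suc n"] w(1) by (simp add: snd_hold_jump_chain good_def)
  show "d v = snd (hold_jump_chain w (s, 0) n)" if "S w s n - s \<le> v" "v < S w s (Suc n) - s" for n v
    using that S_mono[OF w, of 0 n] by (subst d) (auto intro!: hold_jump_path_between[OF w])
qed simp_all

end

section \<open>Regularity of the paths\<close>

context ssa
begin

abbreviation "intensity \<equiv> density (restrict_space lborel {0<..}) (\<lambda>s. ennreal (\<theta> / s))"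

lemma sets_intensity: "A \<in> sets borel \<Longrightarrow> A \<subseteq> {0<..} \<Longrightarrow> A \<in> sets intensity"
  by (auto simp: sets_restrict_space)

lemma emeasure_intensity:
  assumes "A \<in> sets borel" "A \<subseteq> {0<..}"
  shows "emeasure intensity A = (\<integral>\<^sup>+s\<in>A. ennreal (\<theta> / s) \<partial>lborel)"
proof -
  have "emeasure intensity A = (\<integral>\<^sup>+s\<in>A. ennreal (\<theta> / s) \<partial>restrict_space lborel {0<..})"
    using sets_intensity[OF assms] by (intro emeasure_density) (auto intro!: measurable_restrict_space1)
  also have "\<dots> = (\<integral>\<^sup>+s. ennreal (\<theta> / s) * indicator A s * indicator {0<..} s \<partial>lborel)"
    by (subst nn_integral_restrict_space) auto
  also have "\<dots> = (\<integral>\<^sup>+s\<in>A. ennreal (\<theta> / s) \<partial>lborel)"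
    using assms(2) by (intro nn_integral_cong) (auto simp: indicator_def)
  finally show ?thesis .
qed

lemma emeasure_intensity_Icc:
  assumes "0 < a" "a \<le> b"
  shows "emeasure intensity {a..b} = ennreal (\<theta> * ln (b / a))"
proof -
  have "(\<integral>\<^sup>+s\<in>{a..b}. ennreal (\<theta> / s) \<partial>lborel) = ennreal (\<theta> * ln b - \<theta> * ln a)"
  proof (rule nn_integral_FTC_Icc)
    show "DERIV (\<lambda>s. \<theta> * ln s) s :> \<theta> / s" if "s \<in> {a..b}" for s
      using that assms by (auto intro!: derivative_eq_intros)
  qed (use assms rate_pos in auto)
  then show ?thesis
    using assms by (subst emeasure_intensity) (auto simp: ln_div algebra_simps)
qed

lemma count_measurable:
  assumes "A \<in> sets borel" "A \<subseteq> {0<..}"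
  shows "(\<lambda>\<omega>. emeasure (count_space UNIV) (jump_times T \<omega> \<inter> A)) \<in> borel_measurable M"
  using rate sets_intensity[OF assms] unfolding finite_rate_def poisson_point_process_def Let_def by blast

text \<open>The Poisson weights sum to 1, so the count is almost surely a natural number.\<close>

lemma AE_finite_jumps:
  assumes ab: "0 < a" shows "AE \<omega> in M. finite (jump_times T \<omega> \<inter> {a..b})"
proof (cases "a \<le> b")
  case True
  let ?N = "\<lambda>\<omega>. emeasure (count_space UNIV) (jump_times T \<omega> \<inter> {a..b})"
  have N [measurable]: "?N \<in> borel_measurable M"
    using ab by (intro count_measurable) auto
  define m where "m = measure intensity {a..b}"
  have "{a..b} \<in> sets intensity" using ab by (intro sets_intensity) auto
  moreover have "emeasure intensity {a..b} < \<infinity>" using ab True by (simp add: emeasure_intensity_Icc)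
  ultimately have P: "prob {\<omega>\<in>space M. ?N \<omega> = of_nat n} = m ^ n / fact n * exp (- m)" for n
    using rate unfolding finite_rate_def poisson_point_process_def Let_def m_def by blast
  have "(\<lambda>n. prob {\<omega>\<in>space M. ?N \<omega> = of_nat n}) sums prob (\<Union>n. {\<omega>\<in>space M. ?N \<omega> = of_nat n})"
    by (rule finite_measure_UNION) (auto simp: disjoint_family_on_def)
  moreover have "(\<lambda>n. m ^ n / fact n * exp (- m)) sums (exp m * exp (- m))"
    using exp_converges[of m] by (intro sums_mult2) (simp add: scaleR_conv_of_real divide_inverse mult.commute)
  ultimately have "prob (\<Union>n. {\<omega>\<in>space M. ?N \<omega> = of_nat n}) = exp m * exp (- m)"
    unfolding P by (rule sums_unique2)
  then have "prob (\<Union>n. {\<omega>\<in>space M. ?N \<omega> = of_nat n}) = 1"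
    by (simp add: exp_add[symmetric])
  then have "AE \<omega> in M. \<omega> \<in> (\<Union>n. {\<omega>\<in>space M. ?N \<omega> = of_nat n})" by (rule AE_prob_1)
  then show ?thesis
  proof eventually_elim
    fix \<omega> assume "\<omega> \<in> (\<Union>n. {\<omega>\<in>space M. ?N \<omega> = of_nat n})"
    then have "?N \<omega> \<noteq> \<infinity>" by auto
    then show "finite (jump_times T \<omega> \<inter> {a..b})"
      by (rule contrapos_np) (simp add: emeasure_count_space_infinite)
  qed
qed simp

text \<open>The intensity of [a, b] is \<theta> ln (b / a), so a set containing intervals with
  arbitrarily large ratio has infinite intensity and receives infinitely many points.\<close>

lemma AE_infinite_count:
  assumes A: "A \<in> sets borel" "A \<subseteq> {0<..}" and large: "\<And>r. 0 \<le> r \<Longrightarrow> \<exists>a b. 0 < a \<and> a \<le> b \<and> ln (b / a) = r \<and> {a..b} \<subseteq> A"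
  shows "AE \<omega> in M. infinite (jump_times T \<omega> \<inter> A)"
proof -
  have "emeasure intensity A = \<infinity>"
  proof (rule ccontr)
    assume "emeasure intensity A \<noteq> \<infinity>"
    then obtain r where r: "emeasure intensity A = ennreal r" "0 \<le> r" by (cases "emeasure intensity A") auto
    \<comment> \<open>An interval with logarithmic ratio (r + 1) / \<theta> has mass r + 1, more
      than \<open>A\<close> is supposed to have.\<close>
    then have "0 \<le> (r + 1) / \<theta>" using rate_pos by simp
    then obtain a b where ab: "0 < a" "a \<le> b" "ln (b / a) = (r + 1) / \<theta>" "{a..b} \<subseteq> A" using large by blast
    have "ennreal (r + 1) = emeasure intensity {a..b}"
      using emeasure_intensity_Icc[OF ab(1,2)] ab(3) rate_pos by simp
    also have "\<dots> \<le> emeasure intensity A"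
      using sets_intensity[OF A] ab(4) by (intro emeasure_mono)
    finally show False using r by simp
  qed
  then have "AE \<omega> in M. emeasure (count_space UNIV) (jump_times T \<omega> \<inter> A) = \<infinity>"
    using rate sets_intensity[OF A] unfolding finite_rate_def poisson_point_process_def Let_def by blast
  then show ?thesis
  proof eventually_elim
    fix \<omega> assume "emeasure (count_space UNIV) (jump_times T \<omega> \<inter> A) = \<infinity>"
    then show "infinite (jump_times T \<omega> \<inter> A)"
      using emeasure_count_space_finite[of "jump_times T \<omega> \<inter> A" UNIV] by auto
  qed
qed

lemma AE_infinite_jumps:
  assumes "0 < a" shows "AE \<omega> in M. infinite (jump_times T \<omega> \<inter> {a..})"
proof (rule AE_infinite_count)
  show "\<exists>c d. 0 < c \<and> c \<le> d \<and> ln (d / c) = r \<and> {c..d} \<subseteq> {a..}" if "0 \<le> r" for r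
    using that assms by (intro exI[of _ a] exI[of _ "a * exp r"]) auto
qed (use assms in auto)

lemma AE_infinite_small_jumps:
  assumes "0 < b" shows "AE \<omega> in M. infinite (jump_times T \<omega> \<inter> {0<..b})"
proof (rule AE_infinite_count)
  show "\<exists>c d. 0 < c \<and> c \<le> d \<and> ln (d / c) = r \<and> {c..d} \<subseteq> {0<..b}" if "0 \<le> r" for r
  proof (intro exI conjI)
    show pos: "0 < b * exp (- r)" using assms by simp
    show "{b * exp (- r)..b} \<subseteq> {0<..b}" using pos by (auto intro: less_le_trans)
    show "b * exp (- r) \<le> b" using that assms by (simp add: mult_left_le)
    have "b / (b * exp (- r)) = exp r" using assms by (simp add: exp_minus field_simps)
    then show "ln (b / (b * exp (- r))) = r" by simp
  qed
qed auto

text \<open>The almost sure properties under which the rest is argued path by path. Jumps may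
  accumulate at time 0 only; positivity is there because the chain lives in (0,
  \<infinity>)^2.\<close>

definition regular :: "'a \<Rightarrow> bool" where
  "regular \<omega> \<longleftrightarrow> \<omega> \<in> space M \<and> (\<forall>a>0. \<forall>b. finite (jump_times T \<omega> \<inter> {a..b})) \<and> (\<forall>a>0. infinite (jump_times T \<omega> \<inter> {a..})) \<and>
     (\<forall>s>0. (jump_size T \<omega> has_sum T s \<omega>) {0<..s}) \<and> (\<forall>s>0. 0 < T s \<omega>)"

lemma jump_size_left_limit:
  assumes "\<omega> \<in> space M" "0 < s"
  shows "((\<lambda>u. T u \<omega>) \<longlongrightarrow> T s \<omega> - jump_size T \<omega> s) (at_left s)"
proof -
  obtain l where l: "((\<lambda>u. T u \<omega>) \<longlongrightarrow> l) (at_left s)"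
    using SSA assms unfolding SSA1_def cadlag_paths_def by blast
  then have "Lim (at_left s) (\<lambda>u. T u \<omega>) = l" by (intro tendsto_Lim) auto
  then show ?thesis using l assms by (simp add: jump_size_def)
qed

lemma jump_size_nonneg:
  assumes "\<omega> \<in> space M" shows "0 \<le> jump_size T \<omega> s"
proof (cases "0 < s")
  case True
  have "eventually (\<lambda>u. T u \<omega> \<le> T s \<omega>) (at_left s)"
    unfolding eventually_at_left_field using True assms by (intro exI[of _ 0]) (auto intro!: T_mono)
  then have "T s \<omega> - jump_size T \<omega> s \<le> T s \<omega>"
    by (intro tendsto_upperbound[OF jump_size_left_limit[OF assms True]]) auto
  then show ?thesis by simp
qed (simp add: jump_size_def)

lemma jump_size_eq_0: "\<omega> \<in> space M \<Longrightarrow> 0 < s \<Longrightarrow> s \<notin> jump_times T \<omega> \<Longrightarrow> jump_size T \<omega> s = 0"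
  using jump_size_nonneg[of \<omega> s] by (auto simp: jump_times_def)

text \<open>Finiteness and infinitude are monotone in the interval, so rational endpoints leave
  countably many null sets. Positivity of T a follows from a jump before time \<open>a\<close>,
  which exists because jumps accumulate at 0, and from T \<ge> 0 just before that jump.\<close>

lemma AE_regular: "AE \<omega> in M. regular \<omega>"
proof -
  let ?Q = "{q\<in>\<rat>. (0::real) < q}"
  have Q: "countable ?Q" using countable_rat by (rule countable_subset[rotated]) auto
  have "AE \<omega> in M. \<forall>a\<in>?Q. \<forall>b\<in>\<rat>. finite (jump_times T \<omega> \<inter> {a..b})"
    by (intro AE_ball_countable[OF Q, THEN iffD2] AE_ball_countable[OF countable_rat, THEN iffD2] ballI AE_finite_jumps) simp
  moreover have "AE \<omega> in M. \<forall>a\<in>?Q. infinite (jump_times T \<omega> \<inter> {a..})"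
    by (intro AE_ball_countable[OF Q, THEN iffD2] ballI AE_infinite_jumps) simp
  moreover have "AE \<omega> in M. \<forall>s>0. (jump_size T \<omega> has_sum T s \<omega>) {0<..s}"
    using no_drift by (simp add: no_drift_def)
  moreover note AE_T_nonneg
  moreover have "AE \<omega> in M. \<forall>n::nat. infinite (jump_times T \<omega> \<inter> {0<..1 / real (Suc n)})"
    by (subst AE_all_countable, intro allI AE_infinite_small_jumps) simp
  moreover note AE_space
  ultimately show ?thesis
  proof eventually_elim
    fix \<omega>
    assume fin: "\<forall>a\<in>?Q. \<forall>b\<in>\<rat>. finite (jump_times T \<omega> \<inter> {a..b})"
      and inf: "\<forall>a\<in>?Q. infinite (jump_times T \<omega> \<inter> {a..})"
      and sum: "\<forall>s>0. (jump_size T \<omega> has_sum T s \<omega>) {0<..s}" and nonneg: "\<forall>s>0. 0 \<le> T s \<omega>"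
      and small: "\<forall>n::nat. infinite (jump_times T \<omega> \<inter> {0<..1 / real (Suc n)})" and \<omega>: "\<omega> \<in> space M"
    show "regular \<omega>"
      unfolding regular_def
    proof (intro conjI allI impI \<omega> sum[rule_format])
      fix a :: real assume a: "0 < a"
      show "finite (jump_times T \<omega> \<inter> {a..b})" for b
      proof -
        obtain p where p: "p \<in> \<rat>" "0 < p" "p < a" using Rats_dense_in_real[OF a] by blast
        obtain q where q: "q \<in> \<rat>" "b < q" using Rats_dense_in_real[of b "b + 1"] by auto
        have "finite (jump_times T \<omega> \<inter> {p..q})" using fin p q by blast
        then show ?thesis by (rule finite_subset[rotated]) (use p q in auto)
      qed
      show "infinite (jump_times T \<omega> \<inter> {a..})"
      proof -
        obtain p where p: "p \<in> \<rat>" "a < p" using Rats_dense_in_real[of a "a + 1"] by auto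
        then have "infinite (jump_times T \<omega> \<inter> {p..})" using inf a by auto
        then show ?thesis by (rule infinite_super[rotated]) (use p in auto)
      qed
      obtain n where n: "1 / real (Suc n) < a" using reals_Archimedean[OF a] by (auto simp: inverse_eq_divide)
      obtain r where r: "r \<in> jump_times T \<omega>" "r \<le> 1 / real (Suc n)"
        using small[rule_format, of n] by (metis IntE infinite_imp_nonempty all_not_in_conv greaterThanAtMost_iff)
      have r0: "0 < r" "0 < jump_size T \<omega> r" using r by (auto simp: jump_times_def)
      have "eventually (\<lambda>u. 0 \<le> T u \<omega>) (at_left r)"
        unfolding eventually_at_left_field using r0 nonneg by (intro exI[of _ 0]) auto
      then have "0 \<le> T r \<omega> - jump_size T \<omega> r"
        by (intro tendsto_lowerbound[OF jump_size_left_limit[OF \<omega> r0(1)]]) auto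
      then show "0 < T a \<omega>" using r0 T_mono[OF \<omega> r0(1), of a] r n by linarith
    qed
  qed
qed

text \<open>Up to any later jump \<open>b\<close> only finitely many jumps lie in (s, b], so the
  infimum is a minimum and hence itself a jump time.\<close>

lemma first_jump_regular:
  assumes \<omega>: "regular \<omega>" and s: "0 < s"
  shows first_jump_gt: "s < first_jump T \<omega> s" and first_jump_in: "first_jump T \<omega> s \<in> jump_times T \<omega>"
    and first_jump_le: "\<And>r. r \<in> jump_times T \<omega> \<Longrightarrow> s < r \<Longrightarrow> first_jump T \<omega> s \<le> r"
proof -
  have "infinite (jump_times T \<omega> \<inter> {s..})" using \<omega> s by (auto simp: regular_def)
  then have "infinite (jump_times T \<omega> \<inter> {s..} - {s})" by simp
  moreover have "jump_times T \<omega> \<inter> {s..} - {s} = jump_times T \<omega> \<inter> {s<..}" by auto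
  ultimately have ne: "jump_times T \<omega> \<inter> {s<..} \<noteq> {}" by (metis finite.emptyI)
  then obtain b where b: "b \<in> jump_times T \<omega>" "s < b" by auto
  let ?F = "jump_times T \<omega> \<inter> {s<..b}"
  have "finite (jump_times T \<omega> \<inter> {s..b})" using \<omega> s by (auto simp: regular_def)
  then have F: "finite ?F" "?F \<noteq> {}" using b by (auto elim: finite_subset[rotated])
  have "Inf (jump_times T \<omega> \<inter> {s<..}) = Min ?F"
  proof (rule cInf_eq_minimum)
    show "Min ?F \<in> jump_times T \<omega> \<inter> {s<..}" using Min_in[OF F] by auto
    fix r assume r: "r \<in> jump_times T \<omega> \<inter> {s<..}"
    show "Min ?F \<le> r"
    proof (cases "r \<le> b")
      case True then show ?thesis using r F by (intro Min_le) auto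
    next
      case False then show ?thesis using Min_in[OF F] by auto
    qed
  qed
  then have eq: "first_jump T \<omega> s = Min ?F" using ne by (simp add: first_jump_def)
  show "s < first_jump T \<omega> s" "first_jump T \<omega> s \<in> jump_times T \<omega>" using Min_in[OF F] by (auto simp: eq)
  show "first_jump T \<omega> s \<le> r" if "r \<in> jump_times T \<omega>" "s < r" for r
    using that Min_in[OF F] F by (cases "r \<le> b") (auto simp: eq)
qed

text \<open>This is where the absence of drift enters: T is the sum of its jumps, and there are none
  in (s, u].\<close>

lemma constant_until_jump:
  assumes \<omega>: "regular \<omega>" and s: "0 < s" "s \<le> u" "u < first_jump T \<omega> s"
  shows "T u \<omega> = T s \<omega>"
proof -
  have sp: "\<omega> \<in> space M" using \<omega> by (simp add: regular_def)
  have "(jump_size T \<omega> has_sum T u \<omega>) {0<..u}" using \<omega> s by (auto simp: regular_def)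
  moreover have "(jump_size T \<omega> has_sum x) {0<..u} \<longleftrightarrow> (jump_size T \<omega> has_sum x) {0<..s}" for x
  proof (rule has_sum_cong_neutral)
    fix r assume "r \<in> {0<..u} - {0<..s}"
    then have "r \<notin> jump_times T \<omega>" "0 < r" using first_jump_le[OF \<omega> s(1), of r] s by auto
    then show "jump_size T \<omega> r = 0" by (intro jump_size_eq_0 sp)
  qed (use s in auto)
  moreover have "(jump_size T \<omega> has_sum T s \<omega>) {0<..s}" using \<omega> s by (auto simp: regular_def)
  ultimately show ?thesis using has_sum_unique by blast
qed

text \<open>T keeps its value at \<open>s\<close> until the jump, so that value is the left
  limit.\<close>

lemma jump_size_first_jump:
  assumes \<omega>: "regular \<omega>" and s: "0 < s"
  shows "jump_size T \<omega> (first_jump T \<omega> s) = T (first_jump T \<omega> s) \<omega> - T s \<omega>"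
proof -
  let ?H = "first_jump T \<omega> s"
  have sp: "\<omega> \<in> space M" using \<omega> by (simp add: regular_def)
  have H: "s < ?H" by (rule first_jump_gt[OF \<omega> s])
  have "eventually (\<lambda>u. T u \<omega> = T s \<omega>) (at_left ?H)"
    unfolding eventually_at_left_field
    by (intro exI[of _ s] conjI allI impI H constant_until_jump[OF \<omega> s]) simp_all
  then have "((\<lambda>u. T u \<omega>) \<longlongrightarrow> T s \<omega>) (at_left ?H)" by (rule tendsto_eventually)
  moreover have "((\<lambda>u. T u \<omega>) \<longlongrightarrow> T ?H \<omega> - jump_size T \<omega> ?H) (at_left ?H)"
    using H s by (intro jump_size_left_limit[OF sp]) simp
  ultimately have "T s \<omega> = T ?H \<omega> - jump_size T \<omega> ?H"
    using tendsto_unique[of "at_left ?H"] by auto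
  then show ?thesis by simp
qed

abbreviation jtime :: "'a \<Rightarrow> real \<Rightarrow> nat \<Rightarrow> real" where
  "jtime \<omega> s n \<equiv> (first_jump T \<omega> ^^ n) s"

lemma jtime_pos: "regular \<omega> \<Longrightarrow> 0 < s \<Longrightarrow> 0 < jtime \<omega> s n"
  by (induction n) (auto dest: first_jump_gt intro: less_trans)

lemma jtime_strict: "regular \<omega> \<Longrightarrow> 0 < s \<Longrightarrow> jtime \<omega> s n < jtime \<omega> s (Suc n)"
  using first_jump_gt[OF _ jtime_pos] by simp

text \<open>Otherwise the successive jump times would be infinitely many jumps in the bounded
  interval [s, x], which stays away from 0.\<close>

lemma jtime_unbounded:
  assumes \<omega>: "regular \<omega>" and s: "0 < s" shows "\<exists>n. x < jtime \<omega> s n"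
proof (rule ccontr)
  assume "\<not> (\<exists>n. x < jtime \<omega> s n)"
  then have le: "jtime \<omega> s n \<le> x" for n by (simp add: not_less)
  have mono: "strict_mono (jtime \<omega> s)" using jtime_strict[OF assms] by (auto simp: strict_mono_Suc_iff)
  have "range (\<lambda>n. jtime \<omega> s (Suc n)) \<subseteq> jump_times T \<omega> \<inter> {s..x}"
  proof safe
    fix n
    show "jtime \<omega> s (Suc n) \<in> jump_times T \<omega>"
      using first_jump_in[OF \<omega> jtime_pos[OF assms]] by simp
    show "jtime \<omega> s (Suc n) \<in> {s..x}"
      using le[of "Suc n"] strict_mono_less_eq[OF mono, of 0 "Suc n"] by simp
  qed
  moreover have "finite (jump_times T \<omega> \<inter> {s..x})" using \<omega> s by (auto simp: regular_def)
  ultimately have "finite (range (\<lambda>n. jtime \<omega> s (Suc n)))" by (rule finite_subset)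
  moreover have "inj (\<lambda>n. jtime \<omega> s (Suc n))"
    using strict_mono_eq[OF mono] by (auto simp: inj_def simp del: funpow.simps)
  ultimately show False using range_inj_infinite by blast
qed

lemma step_chain_T:
  assumes \<omega>: "regular \<omega>" and s: "0 < s" and d: "\<And>v. 0 \<le> v \<Longrightarrow> d v = T (s + v) \<omega> - T s \<omega>"
  shows "step_chain d n = (jtime \<omega> s n - s, T (jtime \<omega> s n) \<omega> - T s \<omega>)"
proof (rule step_chain_eq)
  have mono: "strict_mono (jtime \<omega> s)" using jtime_strict[OF \<omega> s] by (auto simp: strict_mono_Suc_iff)
  show "jtime \<omega> s n - s < jtime \<omega> s (Suc n) - s" for n using jtime_strict[OF \<omega> s, of n] by simp
  show "\<exists>n. x < jtime \<omega> s n - s" for x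
    using jtime_unbounded[OF \<omega> s, of "x + s"] by (auto simp: less_diff_eq)
  show "T (jtime \<omega> s n) \<omega> - T s \<omega> < T (jtime \<omega> s (Suc n)) \<omega> - T s \<omega>" for n
    using jump_size_first_jump[OF \<omega> jtime_pos[OF \<omega> s]] first_jump_in[OF \<omega> jtime_pos[OF \<omega> s, of n]]
    by (simp add: jump_times_def)
  show "d v = T (jtime \<omega> s n) \<omega> - T s \<omega>" if "jtime \<omega> s n - s \<le> v" "v < jtime \<omega> s (Suc n) - s" for n v
  proof -
    have "s \<le> jtime \<omega> s n" using strict_mono_less_eq[OF mono, of 0 n] by simp
    then have "0 \<le> v" using that by simp
    moreover have "T (s + v) \<omega> = T (jtime \<omega> s n) \<omega>"
      using that by (intro constant_until_jump[OF \<omega> jtime_pos[OF \<omega> s]]) auto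
    ultimately show ?thesis by (simp add: d)
  qed
qed simp_all

end

section \<open>Measurability and the transition kernel\<close>

context ssa
begin

text \<open>Measurable counts are part of the definition of a Poisson point process, and a jump in
  \<open>A\<close> means a nonzero count.\<close>

lemma jump_in_measurable:
  assumes [measurable]: "A \<in> sets borel" and A: "A \<subseteq> {0<..}"
  shows "Measurable.pred M (\<lambda>\<omega>. jump_times T \<omega> \<inter> A \<noteq> {})"
proof -
  have "(jump_times T \<omega> \<inter> A \<noteq> {}) = (emeasure (count_space UNIV) (jump_times T \<omega> \<inter> A) \<noteq> 0)" for \<omega>
    by (subst emeasure_count_space_eq_0) auto
  moreover have "Measurable.pred M (\<lambda>\<omega>. emeasure (count_space UNIV) (jump_times T \<omega> \<inter> A) \<noteq> 0)"
    using count_measurable[OF assms] by measurable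
  ultimately show ?thesis by simp
qed

text \<open>Counts are measurable for fixed sets, but the set after X is random. A jump after X is a
  jump at or after some positive rational q > X, which leaves countably many fixed sets.\<close>

lemma first_jump_measurable [measurable (raw)]:
  assumes [measurable]: "X \<in> borel_measurable M"
  shows "(\<lambda>\<omega>. first_jump T \<omega> (X \<omega>)) \<in> borel_measurable M"
proof (rule borel_measurableI_less)
  fix b :: real
  let ?Q = "{q\<in>\<rat>. (0::real) < q}"
  have Q: "countable ?Q" using countable_rat by (rule countable_subset[rotated]) auto
  have jump_after: "(jump_times T \<omega> \<inter> {X \<omega><..} \<inter> B \<noteq> {}) \<longleftrightarrow> (\<exists>q\<in>?Q. X \<omega> < q \<and> jump_times T \<omega> \<inter> ({q..} \<inter> B) \<noteq> {})" for \<omega> B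
  proof
    assume "jump_times T \<omega> \<inter> {X \<omega><..} \<inter> B \<noteq> {}"
    then obtain r where r: "r \<in> jump_times T \<omega>" "X \<omega> < r" "r \<in> B" by auto
    then have "max (X \<omega>) 0 < r" by (auto simp: jump_times_def)
    then obtain q where "q \<in> \<rat>" "max (X \<omega>) 0 < q" "q < r" using Rats_dense_in_real by blast
    then show "\<exists>q\<in>?Q. X \<omega> < q \<and> jump_times T \<omega> \<inter> ({q..} \<inter> B) \<noteq> {}"
      using r by (intro bexI[of _ q]) auto
  qed auto
  have meas: "Measurable.pred M (\<lambda>\<omega>. jump_times T \<omega> \<inter> {X \<omega><..} \<inter> B \<noteq> {})" if [measurable]: "B \<in> sets borel" for B
    unfolding jump_after
  proof (rule measurable_pred_countable(2)[OF Q])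
    fix q assume "q \<in> ?Q"
    then have [measurable]: "Measurable.pred M (\<lambda>\<omega>. jump_times T \<omega> \<inter> ({q..} \<inter> B) \<noteq> {})"
      by (intro jump_in_measurable) auto
    show "Measurable.pred M (\<lambda>\<omega>. X \<omega> < q \<and> jump_times T \<omega> \<inter> ({q..} \<inter> B) \<noteq> {})" by measurable
  qed
  have [measurable]: "Measurable.pred M (\<lambda>\<omega>. jump_times T \<omega> \<inter> {X \<omega><..} \<noteq> {})"
    using meas[of UNIV] by simp
  have [measurable]: "Measurable.pred M (\<lambda>\<omega>. jump_times T \<omega> \<inter> {X \<omega><..} \<inter> {..<b} \<noteq> {})"
    by (rule meas) simp
  have "first_jump T \<omega> (X \<omega>) < b \<longleftrightarrow>
      (if jump_times T \<omega> \<inter> {X \<omega><..} \<noteq> {} then jump_times T \<omega> \<inter> {X \<omega><..} \<inter> {..<b} \<noteq> {} else X \<omega> < b)" for \<omega>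
  proof (cases "jump_times T \<omega> \<inter> {X \<omega><..} = {}")
    case False
    have "bdd_below (jump_times T \<omega> \<inter> {X \<omega><..})" by (rule bdd_belowI[of _ "X \<omega>"]) auto
    from cInf_less_iff[OF False this, of b] show ?thesis using False by (auto simp: first_jump_def)
  qed (simp add: first_jump_def)
  moreover have "{\<omega>\<in>space M. if jump_times T \<omega> \<inter> {X \<omega><..} \<noteq> {} then jump_times T \<omega> \<inter> {X \<omega><..} \<inter> {..<b} \<noteq> {} else X \<omega> < b} \<in> sets M"
    by measurable
  ultimately show "{\<omega>\<in>space M. first_jump T \<omega> (X \<omega>) < b} \<in> sets M" by simp
qed

lemma jump_size_measurable [measurable (raw)]:
  assumes [measurable]: "X \<in> borel_measurable M"
  shows "(\<lambda>\<omega>. jump_size T \<omega> (X \<omega>)) \<in> borel_measurable M"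
proof -
  \<comment> \<open>The left limit is taken along X - X / (n + 2); the offset 2 keeps these points
    strictly between 0 and X already for n = 0.\<close>
  define g where "g n \<omega> = (if 0 < X \<omega> then level T \<omega> (X \<omega>) - level T \<omega> (X \<omega> - X \<omega> / (real n + 2)) else 0)" for n \<omega>
  have "g n \<in> borel_measurable M" for n
  proof -
    have [measurable]: "(\<lambda>\<omega>. level T \<omega> (X \<omega>)) \<in> borel_measurable M"
      "(\<lambda>\<omega>. level T \<omega> (X \<omega> - X \<omega> / (real n + 2))) \<in> borel_measurable M"
      by (rule level_measurable; measurable)+
    show ?thesis unfolding g_def by measurable
  qed
  moreover have "(\<lambda>n. g n \<omega>) \<longlonglongrightarrow> jump_size T \<omega> (X \<omega>)" if \<omega>: "\<omega> \<in> space M" for \<omega>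
  proof (cases "0 < X \<omega>")
    case True
    let ?c = "\<lambda>n. X \<omega> - X \<omega> / (real n + 2)"
    have c: "0 < ?c n" "?c n < X \<omega>" for n
      using True by (simp_all add: field_simps add_pos_nonneg)
    have "(\<lambda>n. X \<omega> / (real n + 2)) \<longlonglongrightarrow> 0" by real_asymp
    then have "?c \<longlonglongrightarrow> X \<omega> - 0" by (intro tendsto_intros)
    then have "filterlim ?c (at_left (X \<omega>)) sequentially"
      using c by (intro tendsto_imp_filterlim_at_left always_eventually) simp_all
    from filterlim_compose[OF jump_size_left_limit[OF \<omega> True] this]
    have "(\<lambda>n. T (X \<omega>) \<omega> - T (?c n) \<omega>) \<longlonglongrightarrow> T (X \<omega>) \<omega> - (T (X \<omega>) \<omega> - jump_size T \<omega> (X \<omega>))"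
      by (intro tendsto_intros)
    then show ?thesis using True c by (simp add: g_def level_def)
  qed (simp add: g_def jump_size_def)
  ultimately show ?thesis by (rule borel_measurable_LIMSEQ_real[rotated])
qed

lemma jtime_measurable:
  assumes "X \<in> borel_measurable M" shows "(\<lambda>\<omega>. jtime \<omega> (X \<omega>) n) \<in> borel_measurable M"
  by (induction n) (use assms in \<open>auto intro: first_jump_measurable\<close>)

lemma jump_chain_measurable:
  assumes "X \<in> borel_measurable M" shows "jump_chain T X n \<in> M \<rightarrow>\<^sub>M borel \<Otimes>\<^sub>M borel"
  unfolding jump_chain_def Let_def
  by (intro measurable_Pair level_measurable jtime_measurable assms)

end

section \<open>One round as a map, and the transition kernel\<close>

context hold_jump
begin

definition kernel_step :: "real \<times> real \<Rightarrow> real \<times> real \<Rightarrow> real \<times> real" where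
  "kernel_step p x = (fst x / fst p, snd x + fst x / fst p * snd p)"

lemma kernel_step_measurable [measurable (raw)]:
  assumes [measurable]: "f \<in> L \<rightarrow>\<^sub>M borel \<Otimes>\<^sub>M borel" "g \<in> L \<rightarrow>\<^sub>M borel \<Otimes>\<^sub>M borel"
  shows "(\<lambda>z. kernel_step (f z) (g z)) \<in> L \<rightarrow>\<^sub>M borel \<Otimes>\<^sub>M borel"
  unfolding kernel_step_def by measurable

lemma sets_BD: "sets step_law = sets (borel \<Otimes>\<^sub>M borel)"
  by (rule sets_pair_measure_cong) auto

lemma kernel_step_measurable1 [measurable]: "(\<lambda>p. kernel_step p x) \<in> step_law \<rightarrow>\<^sub>M borel \<Otimes>\<^sub>M borel"
  by (rule kernel_step_measurable) (simp_all cong: measurable_cong_sets add: sets_BD space_pair_measure)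

lemma hold_jump_chain_step:
  "hold_jump_chain w x (Suc n) = kernel_step (w n) (hold_jump_chain w x n)"
  by (auto simp: hold_jump_chain.simps(2) kernel_step_def Let_def split: prod.splits)

lemma hold_jump_chain_shift:
  "hold_jump_chain w x (Suc n) = hold_jump_chain (\<lambda>i. w (Suc i)) (kernel_step (w 0) x) n"
  using hold_jump_chain_Suc[of w "fst x" "snd x" n] by (simp add: kernel_step_def)

text \<open>The hold time is s / \<beta>, and replacing \<beta> by it before or after forming the
  product with \<open>D\<close> gives the same law. The kernel thus becomes the image of the law of
  one round of the chain.\<close>

lemma hold_jump_kernel_eq: "hold_jump_kernel \<theta> D x = distr step_law borel (\<lambda>p. kernel_step p x)"
proof (cases x)
  case (Pair s t)
  have H: "prob_space (hold_law \<theta> s)" unfolding hold_law_def by (rule B.prob_space_distr) simp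
  interpret H: prob_space "hold_law \<theta> s" by (rule H)
  have [measurable_cong]: "sets (hold_law \<theta> s) = sets borel" by (simp add: hold_law_def)
  have m: "(\<lambda>(h, j). (h, t + h * j)) \<in> hold_law \<theta> s \<Otimes>\<^sub>M D \<rightarrow>\<^sub>M borel"
    unfolding borel_prod[symmetric] by measurable
  have m': "(\<lambda>p. kernel_step p x) \<in> step_law \<rightarrow>\<^sub>M borel"
    unfolding borel_prod[symmetric] by measurable
  show ?thesis
  proof (rule measure_eqI)
    fix A assume "A \<in> sets (hold_jump_kernel \<theta> D x)"
    then have A [measurable]: "A \<in> sets borel" by (simp add: hold_jump_kernel_def Pair)
    then have A' [measurable]: "A \<in> sets (borel \<Otimes>\<^sub>M borel)" unfolding borel_prod[symmetric] .
    have "emeasure (hold_jump_kernel \<theta> D x) A = (\<integral>\<^sup>+z. indicator A z \<partial>distr (hold_law \<theta> s \<Otimes>\<^sub>M D) borel (\<lambda>(h, j). (h, t + h * j)))"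
      by (simp add: hold_jump_kernel_def Pair)
    also have "\<dots> = (\<integral>\<^sup>+z. indicator A (case z of (h, j) \<Rightarrow> (h, t + h * j)) \<partial>(hold_law \<theta> s \<Otimes>\<^sub>M D))"
      using m by (subst nn_integral_distr) auto
    also have "\<dots> = (\<integral>\<^sup>+h. \<integral>\<^sup>+j. indicator A (h, t + h * j) \<partial>D \<partial>hold_law \<theta> s)"
      by (subst D.nn_integral_fst[symmetric]) (auto simp: case_prod_beta)
    also have "\<dots> = (\<integral>\<^sup>+b. \<integral>\<^sup>+j. indicator A (s / b, t + s / b * j) \<partial>D \<partial>beta1_law \<theta>)"
      unfolding hold_law_def by (subst nn_integral_distr) auto
    also have "\<dots> = (\<integral>\<^sup>+p. indicator A (kernel_step p x) \<partial>step_law)"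
      by (subst D.nn_integral_fst[symmetric]) (auto simp: kernel_step_def Pair)
    also have "\<dots> = emeasure (distr step_law borel (\<lambda>p. kernel_step p x)) A"
      using m' by (subst nn_integral_indicator[symmetric], simp, subst nn_integral_distr) auto
    finally show "emeasure (hold_jump_kernel \<theta> D x) A = emeasure (distr step_law borel (\<lambda>p. kernel_step p x)) A" .
  qed (simp add: hold_jump_kernel_def Pair)
qed

lemma hold_jump_kernel_measurable:
  "hold_jump_kernel \<theta> D \<in> restrict_space borel E \<rightarrow>\<^sub>M prob_algebra borel"
proof (rule measurable_restrict_space1)
  have "(\<lambda>x. distr step_law borel (\<lambda>p. kernel_step p x)) \<in> borel \<Otimes>\<^sub>M borel \<rightarrow>\<^sub>M prob_algebra borel"
  proof (rule measurable_distr_prob_space2[where M="step_law"])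
    show "(\<lambda>x. step_law) \<in> borel \<Otimes>\<^sub>M borel \<rightarrow>\<^sub>M prob_algebra step_law"
      by (rule measurable_const) (simp add: space_prob_algebra BD.prob_space_axioms)
    show "(\<lambda>(x, p). kernel_step p x) \<in> (borel \<Otimes>\<^sub>M borel) \<Otimes>\<^sub>M step_law \<rightarrow>\<^sub>M borel"
      unfolding borel_prod[symmetric] kernel_step_def by measurable
  qed
  then show "hold_jump_kernel \<theta> D \<in> borel \<rightarrow>\<^sub>M prob_algebra borel"
    by (simp add: hold_jump_kernel_eq[abs_def] borel_prod)
qed

lemma AE_BD: "AE p in step_law. 0 < fst p \<and> 0 < snd p"
proof (rule BD.AE_pair_measure)
  show "AE b in beta1_law \<theta>. AE j in D. 0 < fst (b, j) \<and> 0 < snd (b, j)"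
    using AE_beta1 by eventually_elim (use D_pos in auto)
qed measurable

lemma hold_jump_kernel_state_space:
  assumes "x \<in> {0<..} \<times> {0<..}" shows "measure (hold_jump_kernel \<theta> D x) ({0<..} \<times> {0<..}) = 1"
proof -
  have m: "(\<lambda>p. kernel_step p x) \<in> step_law \<rightarrow>\<^sub>M borel"
    unfolding borel_prod[symmetric] by measurable
  then interpret K: prob_space "hold_jump_kernel \<theta> D x"
    unfolding hold_jump_kernel_eq by (rule BD.prob_space_distr)
  have "AE z in hold_jump_kernel \<theta> D x. z \<in> {0<..} \<times> {0<..}"
    unfolding hold_jump_kernel_eq
  proof (subst AE_distr_iff[OF m])
    show "AE p in step_law. kernel_step p x \<in> {0<..} \<times> {0<..}"
      using AE_BD by eventually_elim (use assms in \<open>auto simp: kernel_step_def intro!: add_pos_pos\<close>)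
  qed (auto simp: borel_prod[symmetric])
  then show ?thesis
    by (subst K.prob_eq_1) (auto simp: hold_jump_kernel_eq borel_prod[symmetric])
qed

lemma nn_integral_W_component:
  assumes [measurable]: "f \<in> borel_measurable (borel \<Otimes>\<^sub>M borel)"
  shows "(\<integral>\<^sup>+w. f (w 0) \<partial>W) = (\<integral>\<^sup>+p. f p \<partial>step_law)"
proof -
  have [measurable]: "f \<in> borel_measurable step_law"
    by (simp cong: measurable_cong_sets add: sets_BD)
  show ?thesis by (subst nn_integral_W) (simp_all add: W.P.emeasure_space_1)
qed

text \<open>The history up to \<open>n\<close> is encoded as the sequence stopped at
  \<open>n\<close>, via \<open>min i n\<close>, so all functionals live on one sequence space. The
  induction peels off the first round, which changes both the starting state and the functional;
  hence both are generalised.\<close>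

lemma markov_W:
  assumes "f \<in> borel_measurable (\<Pi>\<^sub>M i\<in>(UNIV::nat set). borel \<Otimes>\<^sub>M borel)" and g [measurable]: "g \<in> borel_measurable (borel \<Otimes>\<^sub>M borel)"
  shows "(\<integral>\<^sup>+w. f (\<lambda>i. hold_jump_chain w x (min i n)) * g (hold_jump_chain w x (Suc n)) \<partial>W)
    = (\<integral>\<^sup>+w. f (\<lambda>i. hold_jump_chain w x (min i n)) * (\<integral>\<^sup>+p. g (kernel_step p (hold_jump_chain w x n)) \<partial>step_law) \<partial>W)"
  using assms(1)
proof (induction n arbitrary: x f)
  case 0
  have [measurable]: "(\<lambda>p. g (kernel_step p x)) \<in> borel_measurable (borel \<Otimes>\<^sub>M borel)" by measurable
  have "(\<integral>\<^sup>+w. f (\<lambda>i. x) * g (kernel_step (w 0) x) \<partial>W) = f (\<lambda>i. x) * (\<integral>\<^sup>+p. g (kernel_step p x) \<partial>step_law)"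
    using nn_integral_W_component[of "\<lambda>p. f (\<lambda>i. x) * g (kernel_step p x)"]
    by (simp add: nn_integral_cmult)
  then show ?case by (simp add: hold_jump_chain_step W.P.emeasure_space_1)
next
  case (Suc n)
  note f [measurable] = Suc.prems
  have g' [measurable]: "(\<lambda>z. \<integral>\<^sup>+p. g (kernel_step p z) \<partial>step_law) \<in> borel_measurable (borel \<Otimes>\<^sub>M borel)"
    unfolding kernel_step_def by measurable
  have chain: "(\<lambda>z. hold_jump_chain z x i) \<in> W \<rightarrow>\<^sub>M borel \<Otimes>\<^sub>M borel" for i x
    by (rule measurable_hold_jump_chain) (auto simp: space_pair_measure)
  have seq [measurable]: "(\<lambda>w. f (\<lambda>i. hold_jump_chain w x (min i m))) \<in> borel_measurable W" for m
  proof (rule measurable_compose[OF _ f])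
    show "(\<lambda>w i. hold_jump_chain w x (min i m)) \<in> W \<rightarrow>\<^sub>M (\<Pi>\<^sub>M i\<in>(UNIV::nat set). borel \<Otimes>\<^sub>M borel)"
      by (rule measurable_PiM_single') (auto simp: chain space_pair_measure)
  qed
  \<comment> \<open>After the first round the history is \<open>x\<close> followed by the history of
    the chain that the remaining rounds produce from \<open>kernel_step p x\<close>.\<close>
  have shift: "(\<lambda>i. hold_jump_chain (case_nat p w) x (min i (Suc n)))
      = case_nat x (\<lambda>i. hold_jump_chain w (kernel_step p x) (min i n))" for p w
    by (rule ext) (auto simp: hold_jump_chain_shift split: nat.split)
  have f': "(\<lambda>c. f (case_nat x c)) \<in> borel_measurable (\<Pi>\<^sub>M i\<in>(UNIV::nat set). borel \<Otimes>\<^sub>M borel)"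
    by (rule measurable_compose[OF _ f]) (auto intro!: measurable_PiM_single' split: nat.split simp: space_pair_measure)
  have "(\<integral>\<^sup>+w. f (\<lambda>i. hold_jump_chain w x (min i (Suc n))) * h (hold_jump_chain w x (Suc m)) \<partial>W)
    = (\<integral>\<^sup>+p. \<integral>\<^sup>+w. f (case_nat x (\<lambda>i. hold_jump_chain w (kernel_step p x) (min i n))) * h (hold_jump_chain w (kernel_step p x) m) \<partial>W \<partial>step_law)"
    if [measurable]: "h \<in> borel_measurable (borel \<Otimes>\<^sub>M borel)" for h m
  proof (subst nn_integral_W)
    show "(\<lambda>w. f (\<lambda>i. hold_jump_chain w x (min i (Suc n))) * h (hold_jump_chain w x (Suc m))) \<in> borel_measurable W"
      using measurable_compose[OF chain[of x "Suc m"] that] by measurable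
  qed (simp only: shift hold_jump_chain_shift nat.case)
  from this[of g "Suc n"] this[OF g', of n] show ?case
    by (simp only: g Suc.IH[OF f'])
qed

end

section \<open>Conditional laws\<close>

context after_time
begin

abbreviation start :: "'a \<Rightarrow> real \<times> real" where "start \<omega> \<equiv> (\<tau> \<omega>, level T \<omega> (\<tau> \<omega>))"

abbreviation "seq_space \<equiv> \<Pi>\<^sub>M i\<in>(UNIV::nat set). (borel \<Otimes>\<^sub>M borel :: (real \<times> real) measure)"

lemma coupling_nn_integral:
  assumes [measurable]: "h \<in> borel_measurable (G \<Otimes>\<^sub>M \<Pi>\<^sub>0)"
  shows "(\<integral>\<^sup>+\<omega>. h (\<omega>, dpath \<omega>) \<partial>P) = (\<integral>\<^sup>+z. h (fst z, cpath (\<tau> (fst z)) (snd z)) \<partial>(P \<Otimes>\<^sub>M W))"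
proof -
  have m1: "(\<lambda>\<omega>. (\<omega>, dpath \<omega>)) \<in> P \<rightarrow>\<^sub>M G \<Otimes>\<^sub>M \<Pi>\<^sub>0" by measurable
  have m2: "(\<lambda>(\<omega>, w). (\<omega>, cpath (\<tau> \<omega>) w)) \<in> P \<Otimes>\<^sub>M W \<rightarrow>\<^sub>M G \<Otimes>\<^sub>M \<Pi>\<^sub>0"
    using cpath_measurable_P unfolding case_prod_beta by (intro measurable_Pair) auto
  have "(\<integral>\<^sup>+\<omega>. h (\<omega>, dpath \<omega>) \<partial>P) = (\<integral>\<^sup>+y. h y \<partial>distr P (G \<Otimes>\<^sub>M \<Pi>\<^sub>0) (\<lambda>\<omega>. (\<omega>, dpath \<omega>)))"
    using m1 by (subst nn_integral_distr) auto
  also have "\<dots> = (\<integral>\<^sup>+z. h (case z of (\<omega>, w) \<Rightarrow> (\<omega>, cpath (\<tau> \<omega>) w)) \<partial>(P \<Otimes>\<^sub>M W))"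
    unfolding coupling using m2 by (subst nn_integral_distr) auto
  finally show ?thesis by (simp add: case_prod_beta)
qed

lemma AE_regular_P: "AE \<omega> in P. regular \<omega> \<and> 0 < \<tau> \<omega>"
  using AE_P[OF AE_regular] \<tau>_pos by eventually_elim simp

lemma jump_chain_eq: "jump_chain T \<tau> n \<omega> = (jtime \<omega> (\<tau> \<omega>) n, level T \<omega> (jtime \<omega> (\<tau> \<omega>) n))"
  by (simp add: jump_chain_def Let_def)

lemma jump_chain_step_chain:
  assumes "regular \<omega>" "0 < \<tau> \<omega>"
  shows "jump_chain T \<tau> n \<omega> = (\<tau> \<omega> + fst (step_chain (dpath \<omega>) n), level T \<omega> (\<tau> \<omega>) + snd (step_chain (dpath \<omega>) n))"
proof -
  have "step_chain (dpath \<omega>) n = (jtime \<omega> (\<tau> \<omega>) n - \<tau> \<omega>, T (jtime \<omega> (\<tau> \<omega>) n) \<omega> - T (\<tau> \<omega>) \<omega>)"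
    using assms by (intro step_chain_T) (auto simp: dpath_def level_def)
  then show ?thesis using assms jtime_pos[OF assms, of n] by (simp add: jump_chain_eq level_def)
qed

lemma hold_jump_chain_step_chain:
  assumes "good w" "0 < s"
  shows "hold_jump_chain w (s, t) n = (s + fst (step_chain (cpath s w) n), t + snd (step_chain (cpath s w) n))"
proof -
  have "step_chain (cpath s w) n = (S w s n - s, snd (hold_jump_chain w (s, 0) n))"
    using assms by (intro step_chain_hold_jump) (auto simp: cpath_def)
  then show ?thesis
    by (simp add: prod_eq_iff fst_hold_jump_chain_0[of w s t] snd_hold_jump_chain_0[of w s t])
qed

lemma start_G [measurable]: "start \<in> G \<rightarrow>\<^sub>M borel \<Otimes>\<^sub>M borel" by measurable

lemma measurable_sequence:
  "(\<And>i. (\<lambda>z. f z i) \<in> L \<rightarrow>\<^sub>M borel \<Otimes>\<^sub>M borel) \<Longrightarrow> f \<in> L \<rightarrow>\<^sub>M seq_space"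
  by (rule measurable_PiM_single') (auto simp: space_pair_measure)

text \<open>\<open>\<Phi>\<close> adds the \<open>G\<close>-measurable start to
  \<open>step_chain\<close> and almost surely recovers either chain from its own increment path. As
  \<open>h\<close> may depend on \<omega> through \<open>G\<close>, the identity determines the
  conditional law of the chain given \<open>G\<close>.\<close>

lemma chain_coupling:
  assumes h [measurable]: "h \<in> borel_measurable (G \<Otimes>\<^sub>M seq_space)"
  shows "(\<integral>\<^sup>+\<omega>. h (\<omega>, \<lambda>i. jump_chain T \<tau> i \<omega>) \<partial>P)
    = (\<integral>\<^sup>+\<omega>. \<integral>\<^sup>+w. h (\<omega>, \<lambda>i. hold_jump_chain w (start \<omega>) i) \<partial>W \<partial>P)"
proof -
  define \<Phi> where "\<Phi> z = (\<lambda>i. (\<tau> (fst z) + fst (step_chain (snd z) i), level T (fst z) (\<tau> (fst z)) + snd (step_chain (snd z) i)))"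
    for z :: "'a \<times> (real \<Rightarrow> real)"
  have \<Phi> [measurable]: "\<Phi> \<in> G \<Otimes>\<^sub>M \<Pi>\<^sub>0 \<rightarrow>\<^sub>M seq_space"
  proof (rule measurable_sequence)
    fix i
    have [measurable]: "(\<lambda>z. step_chain (snd z) i) \<in> G \<Otimes>\<^sub>M \<Pi>\<^sub>0 \<rightarrow>\<^sub>M borel \<Otimes>\<^sub>M borel"
      by (rule measurable_step_chain) simp
    have [measurable]: "(\<lambda>z. level T (fst z) (\<tau> (fst z))) \<in> borel_measurable (G \<Otimes>\<^sub>M \<Pi>\<^sub>0)"
      by (rule measurable_compose[OF measurable_fst level_\<tau>_G])
    show "(\<lambda>z. \<Phi> z i) \<in> G \<Otimes>\<^sub>M \<Pi>\<^sub>0 \<rightarrow>\<^sub>M borel \<Otimes>\<^sub>M borel" unfolding \<Phi>_def by measurable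
  qed
  have "(\<integral>\<^sup>+\<omega>. h (\<omega>, \<lambda>i. jump_chain T \<tau> i \<omega>) \<partial>P) = (\<integral>\<^sup>+\<omega>. (\<lambda>z. h (fst z, \<Phi> z)) (\<omega>, dpath \<omega>) \<partial>P)"
  proof (rule nn_integral_cong_AE)
    show "AE \<omega> in P. h (\<omega>, \<lambda>i. jump_chain T \<tau> i \<omega>) = (\<lambda>z. h (fst z, \<Phi> z)) (\<omega>, dpath \<omega>)"
      using AE_regular_P by eventually_elim (simp add: \<Phi>_def jump_chain_step_chain)
  qed
  also have "\<dots> = (\<integral>\<^sup>+z. (\<lambda>z. h (fst z, \<Phi> z)) (fst z, cpath (\<tau> (fst z)) (snd z)) \<partial>(P \<Otimes>\<^sub>M W))"
    by (rule coupling_nn_integral) measurable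
  also have "\<dots> = (\<integral>\<^sup>+z. h (fst z, \<lambda>i. hold_jump_chain (snd z) (start (fst z)) i) \<partial>(P \<Otimes>\<^sub>M W))"
  proof (rule nn_integral_cong_AE)
    show "AE z in P \<Otimes>\<^sub>M W. (\<lambda>z. h (fst z, \<Phi> z)) (fst z, cpath (\<tau> (fst z)) (snd z)) = h (fst z, \<lambda>i. hold_jump_chain (snd z) (start (fst z)) i)"
      using AE_PW by eventually_elim (simp add: \<Phi>_def hold_jump_chain_step_chain)
  qed
  also have "\<dots> = (\<integral>\<^sup>+\<omega>. \<integral>\<^sup>+w. h (\<omega>, \<lambda>i. hold_jump_chain w (start \<omega>) i) \<partial>W \<partial>P)"
  proof (subst W.P.nn_integral_fst[symmetric])
    have "(\<lambda>z i. hold_jump_chain (snd z) (start (fst z)) i) \<in> P \<Otimes>\<^sub>M W \<rightarrow>\<^sub>M seq_space"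
      by (intro measurable_sequence measurable_hold_jump_chain measurable_compose[OF fst_PW_G start_G] measurable_snd)
    then show "(\<lambda>z. h (fst z, \<lambda>i. hold_jump_chain (snd z) (start (fst z)) i)) \<in> borel_measurable (P \<Otimes>\<^sub>M W)"
      by (intro measurable_compose[OF measurable_Pair[OF fst_PW_G] h])
  qed simp
  finally show ?thesis .
qed

lemma AE_cond_exp_eq:
  assumes G': "subalgebra P G'" and B: "B \<in> sets P" and q: "q \<in> borel_measurable G'" "\<And>\<omega>. 0 \<le> q \<omega>" "\<And>\<omega>. q \<omega> \<le> 1"
    and eq: "\<And>A. A \<in> sets G' \<Longrightarrow> (\<integral>\<^sup>+\<omega>. indicator A \<omega> * indicator B \<omega> \<partial>P) = (\<integral>\<^sup>+\<omega>. indicator A \<omega> * ennreal (q \<omega>) \<partial>P)"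
  shows "AE \<omega> in P. real_cond_exp P G' (indicator B) \<omega> = q \<omega>"
proof -
  interpret S: finite_measure_subalgebra P G' by unfold_locales (rule G')
  interpret S: sigma_finite_subalgebra P G' by (rule finite_measure_subalgebra_is_sigma_finite) unfold_locales
  have qP [measurable]: "q \<in> borel_measurable P" by (rule measurable_from_subalg[OF G' q(1)])
  note B [measurable]
  show ?thesis
  proof (rule S.real_cond_exp_charact)
    show "integrable P (indicator B :: 'a \<Rightarrow> real)" by (simp add: P.emeasure_eq_measure)
    show "integrable P q" using q(2,3) by (intro P.integrable_const_bound[where B=1]) auto
    show "q \<in> borel_measurable G'" by fact
    fix A assume A: "A \<in> sets G'"
    then have [measurable]: "A \<in> sets P" using G' by (auto simp: subalgebra_def)
    have i1: "(\<integral>\<omega>\<in>A. indicator B \<omega> \<partial>P) = enn2real (\<integral>\<^sup>+\<omega>. indicator A \<omega> * indicator B \<omega> \<partial>P)"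
      unfolding set_lebesgue_integral_def
      by (subst integral_eq_nn_integral) (auto intro!: arg_cong[where f=enn2real] nn_integral_cong simp: indicator_def)
    have i2: "(\<integral>\<omega>\<in>A. q \<omega> \<partial>P) = enn2real (\<integral>\<^sup>+\<omega>. indicator A \<omega> * ennreal (q \<omega>) \<partial>P)"
      unfolding set_lebesgue_integral_def
      by (subst integral_eq_nn_integral) (auto intro!: arg_cong[where f=enn2real] nn_integral_cong simp: indicator_def q(2))
    show "(\<integral>\<omega>\<in>A. indicator B \<omega> \<partial>P) = (\<integral>\<omega>\<in>A. q \<omega> \<partial>P)" unfolding i1 i2 eq[OF A] ..
  qed
qed

lemma has_cond_law_I:
  assumes G': "subalgebra P G'" and X: "X \<in> P \<rightarrow>\<^sub>M L" and Q: "\<And>\<omega>. prob_space (Q \<omega>)"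
    and q: "\<And>B. B \<in> sets L \<Longrightarrow> (\<lambda>\<omega>. emeasure (Q \<omega>) B) \<in> borel_measurable G'"
    and eq: "\<And>A B. A \<in> sets G' \<Longrightarrow> B \<in> sets L \<Longrightarrow> (\<integral>\<^sup>+\<omega>. indicator A \<omega> * indicator B (X \<omega>) \<partial>P) = (\<integral>\<^sup>+\<omega>. indicator A \<omega> * emeasure (Q \<omega>) B \<partial>P)"
  shows "has_cond_law P G' L X Q"
  unfolding has_cond_law_def
proof (intro conjI ballI X AE_cond_exp_eq[OF G'])
  fix B assume B: "B \<in> sets L"
  show "X -` B \<inter> space P \<in> sets P" using X B by (rule measurable_sets)
  show "(\<lambda>\<omega>. measure (Q \<omega>) B) \<in> borel_measurable G'"
    unfolding measure_def using q[OF B] by measurable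
  show "0 \<le> measure (Q \<omega>) B" "measure (Q \<omega>) B \<le> 1" for \<omega>
    using prob_space.prob_le_1[OF Q[of \<omega>]] by auto
  fix A assume A: "A \<in> sets G'"
  have "(\<integral>\<^sup>+\<omega>. indicator A \<omega> * indicator (X -` B \<inter> space P) \<omega> \<partial>P) = (\<integral>\<^sup>+\<omega>. indicator A \<omega> * indicator B (X \<omega>) \<partial>P)"
    by (intro nn_integral_cong) (auto simp: indicator_def)
  also have "\<dots> = (\<integral>\<^sup>+\<omega>. indicator A \<omega> * ennreal (measure (Q \<omega>) B) \<partial>P)"
    unfolding eq[OF A B] using finite_measure.emeasure_eq_measure[OF prob_space.finite_measure[OF Q]] by simp
  finally show "(\<integral>\<^sup>+\<omega>. indicator A \<omega> * indicator (X -` B \<inter> space P) \<omega> \<partial>P) = (\<integral>\<^sup>+\<omega>. indicator A \<omega> * ennreal (measure (Q \<omega>) B) \<partial>P)" .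
qed

abbreviation "hold \<equiv> \<lambda>\<omega>. first_jump T \<omega> (\<tau> \<omega>)"

lemma hold_measurable [measurable]: "hold \<in> borel_measurable M"
  by (rule first_jump_measurable) simp

lemma fst_jump_chain_1: "fst (jump_chain T \<tau> (Suc 0) \<omega>) = hold \<omega>"
  by (simp add: jump_chain_def Let_def)

lemma first_step_measurable [measurable]:
  "(\<lambda>c. c i) \<in> seq_space \<rightarrow>\<^sub>M borel \<Otimes>\<^sub>M borel"
  by (rule measurable_component_singleton) simp

lemma indicator_G [measurable]: "A \<in> sets G \<Longrightarrow> (\<lambda>z. indicator A (fst z) :: ennreal) \<in> borel_measurable (G \<Otimes>\<^sub>M L)"
  by (rule measurable_compose[OF measurable_fst borel_measurable_indicator])

lemma hold_law_prob: "prob_space (hold_law \<theta> s)"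
  unfolding hold_law_def by (rule B.prob_space_distr) simp

lemma emeasure_hold_law_eq: "B \<in> sets borel \<Longrightarrow> emeasure (hold_law \<theta> s) B = (\<integral>\<^sup>+b. indicator B (s / b) \<partial>beta1_law \<theta>)"
  unfolding hold_law_def
  by (subst nn_integral_indicator[symmetric], simp, subst nn_integral_distr) auto

lemma nn_integral_W_beta:
  assumes [measurable]: "f \<in> borel_measurable borel"
  shows "(\<integral>\<^sup>+w. f (fst (w 0)) \<partial>W) = (\<integral>\<^sup>+b. f b \<partial>beta1_law \<theta>)"
proof -
  have "(\<integral>\<^sup>+w. f (fst (w 0)) \<partial>W) = (\<integral>\<^sup>+p. f (fst p) \<partial>step_law)"
    by (rule nn_integral_W_component[where f="\<lambda>p. f (fst p)"]) measurable
  also have "\<dots> = (\<integral>\<^sup>+b. f b \<partial>beta1_law \<theta>)"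
  proof (subst D.nn_integral_fst[symmetric])
    show "(\<lambda>p. f (fst p)) \<in> borel_measurable step_law"
      by (simp cong: measurable_cong_sets add: sets_BD)
  qed (simp add: D.emeasure_space_1[simplified])
  finally show ?thesis .
qed

lemma hold_cond_law: "has_cond_law P G borel hold (\<lambda>\<omega>. hold_law \<theta> (\<tau> \<omega>))"
proof (rule has_cond_law_I[OF G])
  show "hold \<in> borel_measurable P" by (simp cong: measurable_cong_sets add: sets_P)
  show "prob_space (hold_law \<theta> (\<tau> \<omega>))" for \<omega> by (rule hold_law_prob)
  fix B :: "real set" assume B [measurable]: "B \<in> sets borel"
  show "(\<lambda>\<omega>. emeasure (hold_law \<theta> (\<tau> \<omega>)) B) \<in> borel_measurable G"
    unfolding emeasure_hold_law_eq[OF B] by measurable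
  fix A assume A [measurable]: "A \<in> sets G"
  have "(\<integral>\<^sup>+\<omega>. indicator A \<omega> * indicator B (hold \<omega>) \<partial>P)
    = (\<integral>\<^sup>+\<omega>. (\<lambda>z. indicator A (fst z) * indicator B (fst (snd z (Suc 0)))) (\<omega>, \<lambda>i. jump_chain T \<tau> i \<omega>) \<partial>P)"
    by (simp add: fst_jump_chain_1)
  also have "\<dots> = (\<integral>\<^sup>+\<omega>. \<integral>\<^sup>+w. (\<lambda>z. indicator A (fst z) * indicator B (fst (snd z (Suc 0)))) (\<omega>, \<lambda>i. hold_jump_chain w (start \<omega>) i) \<partial>W \<partial>P)"
    by (rule chain_coupling) measurable
  also have "\<dots> = (\<integral>\<^sup>+\<omega>. indicator A \<omega> * emeasure (hold_law \<theta> (\<tau> \<omega>)) B \<partial>P)"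
  proof (rule nn_integral_cong)
    fix \<omega>
    have "(\<integral>\<^sup>+w. indicator A \<omega> * indicator B (\<tau> \<omega> / fst (w 0)) \<partial>W) = (\<integral>\<^sup>+b. indicator A \<omega> * indicator B (\<tau> \<omega> / b) \<partial>beta1_law \<theta>)"
      by (rule nn_integral_W_beta[where f="\<lambda>b. indicator A \<omega> * indicator B (\<tau> \<omega> / b)"]) measurable
    then show "(\<integral>\<^sup>+w. (\<lambda>z. indicator A (fst z) * indicator B (fst (snd z (Suc 0)))) (\<omega>, \<lambda>i. hold_jump_chain w (start \<omega>) i) \<partial>W)
      = indicator A \<omega> * emeasure (hold_law \<theta> (\<tau> \<omega>)) B"
      by (simp add: hold_jump_chain_step kernel_step_def emeasure_hold_law_eq nn_integral_cmult)
  qed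
  finally show "(\<integral>\<^sup>+\<omega>. indicator A \<omega> * indicator B (hold \<omega>) \<partial>P) = (\<integral>\<^sup>+\<omega>. indicator A \<omega> * emeasure (hold_law \<theta> (\<tau> \<omega>)) B \<partial>P)" .
qed

lemma hold_jump_law_path:
  "(\<lambda>v\<in>{0..}. hold_jump_path w (s, t) (fst (s, t) + v)) = (\<lambda>v\<in>{0..}. t + cpath s w v)"
  by (auto simp: cpath_def hold_jump_path_0[of w s t])

lemma future_cond_law:
  "has_cond_law P G \<Pi>\<^sub>0 (\<lambda>\<omega>. \<lambda>v\<in>{0..}. level T \<omega> (\<tau> \<omega> + v)) (\<lambda>\<omega>. hold_jump_law \<theta> D (start \<omega>))"
proof (rule has_cond_law_I[OF G])
  have path_m: "(\<lambda>w. \<lambda>v\<in>{0..}. t + cpath s w v) \<in> W \<rightarrow>\<^sub>M \<Pi>\<^sub>0" for s t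
  proof (rule measurable_restrict)
    fix v :: real assume "v \<in> {0..}"
    then have "(\<lambda>w. cpath s w v) \<in> borel_measurable W"
      by (intro measurable_compose[OF cpath_measurable measurable_component_singleton]) auto
    then show "(\<lambda>w. t + cpath s w v) \<in> borel_measurable W" by measurable
  qed
  show "(\<lambda>\<omega>. \<lambda>v\<in>{0..}. level T \<omega> (\<tau> \<omega> + v)) \<in> P \<rightarrow>\<^sub>M \<Pi>\<^sub>0" by measurable
  show "prob_space (hold_jump_law \<theta> D (start \<omega>))" for \<omega>
    unfolding hold_jump_law_def hold_jump_law_path using path_m by (rule W.P.prob_space_distr)
  \<comment> \<open>\<open>\<Psi>\<close> turns an increment path back into a path of levels; the
    level added is \<open>G\<close>-measurable.\<close>
  define \<Psi> where "\<Psi> z = (\<lambda>v\<in>{0..}. level T (fst z) (\<tau> (fst z)) + snd z v)" for z :: "'a \<times> (real \<Rightarrow> real)"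
  have \<Psi> [measurable]: "\<Psi> \<in> G \<Otimes>\<^sub>M \<Pi>\<^sub>0 \<rightarrow>\<^sub>M \<Pi>\<^sub>0"
    unfolding \<Psi>_def
  proof (rule measurable_restrict)
    fix v :: real assume "v \<in> {0..}"
    then have "(\<lambda>z. snd z v) \<in> borel_measurable (G \<Otimes>\<^sub>M \<Pi>\<^sub>0)"
      by (intro measurable_compose[OF measurable_snd measurable_component_singleton]) auto
    moreover have "(\<lambda>z. level T (fst z) (\<tau> (fst z))) \<in> borel_measurable (G \<Otimes>\<^sub>M \<Pi>\<^sub>0)"
      by (rule measurable_compose[OF measurable_fst level_\<tau>_G])
    ultimately show "(\<lambda>z. level T (fst z) (\<tau> (fst z)) + snd z v) \<in> borel_measurable (G \<Otimes>\<^sub>M \<Pi>\<^sub>0)" by measurable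
  qed
  fix B assume B [measurable]: "B \<in> sets \<Pi>\<^sub>0"
  have law: "emeasure (hold_jump_law \<theta> D (start \<omega>)) B = (\<integral>\<^sup>+w. indicator B (\<Psi> (\<omega>, cpath (\<tau> \<omega>) w)) \<partial>W)" for \<omega>
  proof -
    have "emeasure (hold_jump_law \<theta> D (start \<omega>)) B = (\<integral>\<^sup>+y. indicator B y \<partial>distr W \<Pi>\<^sub>0 (\<lambda>w. \<lambda>v\<in>{0..}. level T \<omega> (\<tau> \<omega>) + cpath (\<tau> \<omega>) w v))"
      unfolding hold_jump_law_def hold_jump_law_path by simp
    then show ?thesis
      using path_m by (subst (asm) nn_integral_distr) (auto simp: \<Psi>_def)
  qed
  \<comment> \<open>Joint measurability on the product of \<open>G\<close> and \<open>W\<close>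
    makes the law of the constructed path \<open>G\<close>-measurable once the rounds are integrated
    out.\<close>
  have comp: "(\<lambda>z. indicator B (\<Psi> (fst z, cpath (\<tau> (fst z)) (snd z))) :: ennreal) \<in> borel_measurable (G \<Otimes>\<^sub>M W)"
  proof (rule measurable_compose[OF _ borel_measurable_indicator[OF B]])
    have "(\<lambda>z. (fst z, cpath (\<tau> (fst z)) (snd z))) \<in> G \<Otimes>\<^sub>M W \<rightarrow>\<^sub>M G \<Otimes>\<^sub>M \<Pi>\<^sub>0"
      using cpath_measurable_G unfolding case_prod_beta by (intro measurable_Pair) auto
    then show "(\<lambda>z. \<Psi> (fst z, cpath (\<tau> (fst z)) (snd z))) \<in> G \<Otimes>\<^sub>M W \<rightarrow>\<^sub>M \<Pi>\<^sub>0" by (rule measurable_compose[OF _ \<Psi>])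
  qed
  show "(\<lambda>\<omega>. emeasure (hold_jump_law \<theta> D (start \<omega>)) B) \<in> borel_measurable G"
    unfolding law using W.P.borel_measurable_nn_integral_fst[OF comp] by simp
  fix A assume A [measurable]: "A \<in> sets G"
  have A_P [measurable]: "A \<in> sets P" using sets_G[OF A] sets_P by simp
  have "(\<integral>\<^sup>+\<omega>. indicator A \<omega> * indicator B (\<lambda>v\<in>{0..}. level T \<omega> (\<tau> \<omega> + v)) \<partial>P)
    = (\<integral>\<^sup>+\<omega>. (\<lambda>z. indicator A (fst z) * indicator B (\<Psi> z)) (\<omega>, dpath \<omega>) \<partial>P)"
  proof (intro nn_integral_cong)
    fix \<omega>
    have "\<Psi> (\<omega>, dpath \<omega>) = (\<lambda>v\<in>{0..}. level T \<omega> (\<tau> \<omega> + v))" by (auto simp: \<Psi>_def dpath_def)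
    then show "indicator A \<omega> * indicator B (\<lambda>v\<in>{0..}. level T \<omega> (\<tau> \<omega> + v)) = (\<lambda>z. indicator A (fst z) * (indicator B (\<Psi> z) :: ennreal)) (\<omega>, dpath \<omega>)"
      by simp
  qed
  also have "\<dots> = (\<integral>\<^sup>+z. (\<lambda>z. indicator A (fst z) * indicator B (\<Psi> z)) (fst z, cpath (\<tau> (fst z)) (snd z)) \<partial>(P \<Otimes>\<^sub>M W))"
    by (rule coupling_nn_integral) measurable
  also have "\<dots> = (\<integral>\<^sup>+\<omega>. \<integral>\<^sup>+w. indicator A \<omega> * indicator B (\<Psi> (\<omega>, cpath (\<tau> \<omega>) w)) \<partial>W \<partial>P)"
  proof (subst W.P.nn_integral_fst[symmetric])
    have id: "(\<lambda>z. z) \<in> P \<Otimes>\<^sub>M W \<rightarrow>\<^sub>M G \<Otimes>\<^sub>M W"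
      using measurable_Pair[OF fst_PW_G measurable_snd] by simp
    have [measurable]: "(\<lambda>z. indicator B (\<Psi> (fst z, cpath (\<tau> (fst z)) (snd z))) :: ennreal) \<in> borel_measurable (P \<Otimes>\<^sub>M W)"
      using measurable_compose[OF id comp] by simp
    show "(\<lambda>z. (\<lambda>z. indicator A (fst z) * (indicator B (\<Psi> z) :: ennreal)) (fst z, cpath (\<tau> (fst z)) (snd z))) \<in> borel_measurable (P \<Otimes>\<^sub>M W)"
      by simp
  qed simp
  also have "\<dots> = (\<integral>\<^sup>+\<omega>. indicator A \<omega> * emeasure (hold_jump_law \<theta> D (start \<omega>)) B \<partial>P)"
  proof (rule nn_integral_cong)
    fix \<omega> assume "\<omega> \<in> space P"
    then have "(\<lambda>w. (\<omega>, w)) \<in> W \<rightarrow>\<^sub>M G \<Otimes>\<^sub>M W" by (intro measurable_Pair1') (simp add: space_G space_P)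
    from measurable_compose[OF this comp]
    have "(\<lambda>w. indicator B (\<Psi> (\<omega>, cpath (\<tau> \<omega>) w)) :: ennreal) \<in> borel_measurable W" by simp
    then show "(\<integral>\<^sup>+w. indicator A \<omega> * indicator B (\<Psi> (\<omega>, cpath (\<tau> \<omega>) w)) \<partial>W) = indicator A \<omega> * emeasure (hold_jump_law \<theta> D (start \<omega>)) B"
      by (subst law) (rule nn_integral_cmult)
  qed
  finally show "(\<integral>\<^sup>+\<omega>. indicator A \<omega> * indicator B (\<lambda>v\<in>{0..}. level T \<omega> (\<tau> \<omega> + v)) \<partial>P)
    = (\<integral>\<^sup>+\<omega>. indicator A \<omega> * emeasure (hold_jump_law \<theta> D (start \<omega>)) B \<partial>P)" .
qed

end

section \<open>The jump given the past and the hold time, and the Markov property\<close>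

context hold_jump
begin

text \<open>The probability of h J > y, written as an integral of a jointly measurable function of
  (h, j), so that Fubini yields measurability in \<open>h\<close>.\<close>

definition jump_tail :: "real \<Rightarrow> real \<Rightarrow> ennreal" where
  "jump_tail y h = (\<integral>\<^sup>+j. (if y < h * j then 1 else 0) \<partial>D)"

lemma jump_tail_measurable [measurable]: "jump_tail y \<in> borel_measurable borel"
  unfolding jump_tail_def by measurable

end

context after_time
begin

lemma jump_tail_eq: "ennreal (measure N {\<eta>\<in>space N. y < h * J \<eta>}) = jump_tail y h"
proof -
  interpret N: prob_space N by (rule N)
  have "(\<integral>\<^sup>+j. (if y < h * j then 1 else 0) \<partial>D) = (\<integral>\<^sup>+\<eta>. (if y < h * J \<eta> then 1 else 0 :: ennreal) \<partial>N)"
    unfolding D_def by (rule nn_integral_distr) measurable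
  then have "jump_tail y h = (\<integral>\<^sup>+\<eta>. (if y < h * J \<eta> then 1 else 0) \<partial>N)"
    by (simp add: jump_tail_def)
  also have "\<dots> = (\<integral>\<^sup>+\<eta>. indicator {\<eta>\<in>space N. y < h * J \<eta>} \<eta> \<partial>N)"
    by (intro nn_integral_cong) (simp add: indicator_def)
  also have "\<dots> = emeasure N {\<eta>\<in>space N. y < h * J \<eta>}" by (rule nn_integral_indicator) measurable
  finally show ?thesis by (simp add: N.emeasure_eq_measure)
qed

abbreviation "GH \<equiv> sigma (space P) (sets G \<union> sets (vimage_algebra (space P) hold borel))"

lemma sets_GH: "sets GH = sigma_sets (space P) (sets G \<union> sets (vimage_algebra (space P) hold borel))"
  and space_GH: "space GH = space P"
proof -
  have "sets G \<union> sets (vimage_algebra (space P) hold borel) \<subseteq> Pow (space P)"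
    using sets.space_closed[of G] sets.space_closed[of "vimage_algebra (space P) hold borel"]
    by (simp add: space_G space_P)
  then show "sets GH = sigma_sets (space P) (sets G \<union> sets (vimage_algebra (space P) hold borel))"
    "space GH = space P" by (rule sets_measure_of, rule space_measure_of)
qed

lemma subalgebra_GH: "subalgebra P GH"
proof -
  have "sets (vimage_algebra (space P) hold borel) \<subseteq> sets P"
    by (auto simp: sets_vimage_algebra2 sets_P space_P intro: measurable_sets[OF hold_measurable])
  then show ?thesis
    using G unfolding subalgebra_def space_GH sets_GH by (intro conjI refl sets.sigma_sets_subset) auto
qed

lemma hold_GH [measurable]: "hold \<in> borel_measurable GH"
proof (rule measurableI)
  fix B :: "real set" assume "B \<in> sets borel"
  then have "hold -` B \<inter> space P \<in> sets (vimage_algebra (space P) hold borel)"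
    by (rule in_vimage_algebra)
  then show "hold -` B \<inter> space GH \<in> sets GH" unfolding space_GH sets_GH by blast
qed simp

text \<open>Pulling back along \<omega> \<mapsto> (\<omega>, hold \<omega>) catches both generators
  of the \<sigma>-algebra, so its events are conditions \<open>R\<close> on this pair. In this form
  \<open>chain_coupling\<close> applies, the hold time being the first time of the chain after the
  start.\<close>

lemma GH_preimage:
  assumes "C \<in> sets GH"
  obtains R where "R \<in> sets (G \<Otimes>\<^sub>M borel)" "\<And>\<omega>. \<omega> \<in> space P \<Longrightarrow> \<omega> \<in> C \<longleftrightarrow> (\<omega>, hold \<omega>) \<in> R"
proof -
  let ?f = "\<lambda>\<omega>. (\<omega>, hold \<omega>)"
  let ?V = "vimage_algebra (space P) ?f (G \<Otimes>\<^sub>M borel)"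
  have V: "sets ?V = {?f -` A \<inter> space P | A. A \<in> sets (G \<Otimes>\<^sub>M borel)}"
    by (rule sets_vimage_algebra2) (auto simp: space_pair_measure space_G space_P)
  have "sets G \<subseteq> sets ?V"
  proof
    fix A assume A: "A \<in> sets G"
    then have "A = ?f -` (A \<times> UNIV) \<inter> space P" using sets.sets_into_space[OF A] by (auto simp: space_G space_P)
    moreover have "A \<times> UNIV \<in> sets (G \<Otimes>\<^sub>M (borel :: real measure))" using A by simp
    ultimately show "A \<in> sets ?V" unfolding V by blast
  qed
  moreover have "sets (vimage_algebra (space P) hold borel) \<subseteq> sets ?V"
  proof
    fix A assume "A \<in> sets (vimage_algebra (space P) hold borel)"
    then obtain B where B: "B \<in> sets borel" "A = hold -` B \<inter> space P" by (auto simp: sets_vimage_algebra2)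
    then have "A = ?f -` (space G \<times> B) \<inter> space P" by (auto simp: space_G space_P)
    moreover have "space G \<times> B \<in> sets (G \<Otimes>\<^sub>M borel)" using B by simp
    ultimately show "A \<in> sets ?V" unfolding V by blast
  qed
  ultimately have "sigma_sets (space ?V) (sets G \<union> sets (vimage_algebra (space P) hold borel)) \<subseteq> sets ?V"
    by (intro sets.sigma_sets_subset) auto
  then have "C \<in> sets ?V" using assms unfolding sets_GH by auto
  then obtain R where "R \<in> sets (G \<Otimes>\<^sub>M borel)" "C = ?f -` R \<inter> space P" unfolding V by blast
  then show thesis by (intro that[of R]) auto
qed

lemma jump_event_measurable: "{\<omega>\<in>space P. y < jump_size T \<omega> (hold \<omega>)} \<in> sets P"
proof -
  have [measurable]: "(\<lambda>\<omega>. jump_size T \<omega> (hold \<omega>)) \<in> borel_measurable M"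
    by (rule jump_size_measurable) measurable
  show ?thesis by (simp add: sets_P space_P)
qed

text \<open>The claim is carried over to the chain, where the jump is h J with \<open>J\<close>
  independent of the hold time h. Integrating over \<open>J\<close> there gives
  \<open>jump_tail\<close>, and the result is carried back to T.\<close>

lemma jump_law:
  "AE \<omega> in P. real_cond_exp P GH (indicator {\<omega>\<in>space P. y < jump_size T \<omega> (hold \<omega>)}) \<omega>
     = measure N {\<eta>\<in>space N. y < hold \<omega> * J \<eta>}"
proof (rule AE_cond_exp_eq[OF subalgebra_GH jump_event_measurable])
  interpret N: prob_space N by (rule N)
  show "measure N {\<eta>\<in>space N. y < hold \<omega> * J \<eta>} \<le> 1" for \<omega> by simp
  have "measure N {\<eta>\<in>space N. y < h * J \<eta>} = enn2real (jump_tail y h)" for h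
    by (simp add: jump_tail_eq[symmetric])
  then show "(\<lambda>\<omega>. measure N {\<eta>\<in>space N. y < hold \<omega> * J \<eta>}) \<in> borel_measurable GH"
    using measurable_compose[OF hold_GH jump_tail_measurable] by simp
  fix C assume "C \<in> sets GH"
  then obtain R where R [measurable]: "R \<in> sets (G \<Otimes>\<^sub>M borel)" and CR: "\<And>\<omega>. \<omega> \<in> space P \<Longrightarrow> \<omega> \<in> C \<longleftrightarrow> (\<omega>, hold \<omega>) \<in> R"
    using GH_preimage by metis
  have fst_c: "(\<lambda>z. fst (snd z (Suc 0))) \<in> borel_measurable (G \<Otimes>\<^sub>M seq_space)" by measurable
  have R1: "(\<lambda>z. indicator R (fst z, fst (snd z (Suc 0))) :: ennreal) \<in> borel_measurable (G \<Otimes>\<^sub>M seq_space)"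
    by (rule measurable_compose[OF measurable_Pair[OF measurable_fst fst_c] borel_measurable_indicator[OF R]])
  let ?i = "\<lambda>x. if y < x then 1 else 0 :: ennreal"
  \<comment> \<open>In \<open>?g\<close> the jump appears as the difference of the levels with
    indices 1 and 0; \<open>?h\<close> has in its place the probability of a large jump given the
    hold time.\<close>
  let ?g = "\<lambda>z. indicator R (fst z, fst (snd z (Suc 0))) * ?i (snd (snd z (Suc 0)) - snd (snd z 0))"
  let ?h = "\<lambda>z. indicator R (fst z, fst (snd z (Suc 0))) * jump_tail y (fst (snd z (Suc 0)))"
  let ?X = "\<lambda>\<omega>. (\<omega>, \<lambda>i. jump_chain T \<tau> i \<omega>)" and ?c = "\<lambda>\<omega> w. (\<omega>, \<lambda>i. hold_jump_chain w (start \<omega>) i)"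
  let ?E = "{\<omega>\<in>space P. y < jump_size T \<omega> (hold \<omega>)}"
  have "(\<integral>\<^sup>+\<omega>. indicator C \<omega> * indicator ?E \<omega> \<partial>P)
    = (\<integral>\<^sup>+\<omega>. ?g (?X \<omega>) \<partial>P)"
  proof (rule nn_integral_cong_AE)
    show "AE \<omega> in P. indicator C \<omega> * indicator ?E \<omega>
      = ?g (?X \<omega>)"
      using AE_regular_P AE_space
    proof eventually_elim
      fix \<omega> assume \<omega>: "regular \<omega> \<and> 0 < \<tau> \<omega>" "\<omega> \<in> space P"
      then have "jump_size T \<omega> (hold \<omega>) = level T \<omega> (hold \<omega>) - level T \<omega> (\<tau> \<omega>)"
        using jump_size_first_jump[of \<omega> "\<tau> \<omega>"] first_jump_gt[of \<omega> "\<tau> \<omega>"] by (simp add: level_def)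
      then show "indicator C \<omega> * indicator ?E \<omega>
      = ?g (?X \<omega>)"
        using \<omega> CR[OF \<omega>(2)] by (simp add: jump_chain_eq indicator_def)
    qed
  qed
  also have "\<dots> = (\<integral>\<^sup>+\<omega>. \<integral>\<^sup>+w. ?g
      (?c \<omega> w) \<partial>W \<partial>P)"
  proof (rule chain_coupling)
    note [measurable] = R1
    show "?g \<in> borel_measurable (G \<Otimes>\<^sub>M seq_space)"
      by measurable
  qed
  also have "\<dots> = (\<integral>\<^sup>+\<omega>. \<integral>\<^sup>+w. ?h
      (?c \<omega> w) \<partial>W \<partial>P)"
  proof (rule nn_integral_cong)
    fix \<omega> assume "\<omega> \<in> space P"
    then have "(\<lambda>h. (\<omega>, h)) \<in> borel \<rightarrow>\<^sub>M G \<Otimes>\<^sub>M (borel :: real measure)" by (intro measurable_Pair1') (simp add: space_G space_P)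
    then have R\<omega> [measurable]: "(\<lambda>h. indicator R (\<omega>, h) :: ennreal) \<in> borel_measurable borel"
      by (rule measurable_compose[OF _ borel_measurable_indicator[OF R]])
    let ?s = "\<tau> \<omega>"
    have f_meas: "(\<lambda>p. indicator R (\<omega>, ?s / fst p) * ?i (?s / fst p * snd p)) \<in> borel_measurable (borel \<Otimes>\<^sub>M borel)"
      by measurable
    have "(\<integral>\<^sup>+w. indicator R (\<omega>, ?s / fst (w 0)) * ?i (?s / fst (w 0) * snd (w 0)) \<partial>W)
      = (\<integral>\<^sup>+p. indicator R (\<omega>, ?s / fst p) * ?i (?s / fst p * snd p) \<partial>step_law)"
      by (rule nn_integral_W_component[OF f_meas])
    also have "\<dots> = (\<integral>\<^sup>+b. \<integral>\<^sup>+j. indicator R (\<omega>, ?s / b) * ?i (?s / b * j) \<partial>D \<partial>beta1_law \<theta>)"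
      using f_meas by (subst D.nn_integral_fst[symmetric]) (simp_all cong: measurable_cong_sets add: sets_BD)
    also have "\<dots> = (\<integral>\<^sup>+b. indicator R (\<omega>, ?s / b) * jump_tail y (?s / b) \<partial>beta1_law \<theta>)"
      unfolding jump_tail_def by (intro nn_integral_cong nn_integral_cmult) auto
    also have "\<dots> = (\<integral>\<^sup>+w. indicator R (\<omega>, ?s / fst (w 0)) * jump_tail y (?s / fst (w 0)) \<partial>W)"
      by (rule nn_integral_W_beta[symmetric, where f="\<lambda>b. indicator R (\<omega>, ?s / b) * jump_tail y (?s / b)"]) measurable
    finally show "(\<integral>\<^sup>+w. ?g
      (?c \<omega> w) \<partial>W)
      = (\<integral>\<^sup>+w. ?h
      (?c \<omega> w) \<partial>W)"
      by (simp add: hold_jump_chain_step kernel_step_def)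
  qed
  also have "\<dots> = (\<integral>\<^sup>+\<omega>. ?h (?X \<omega>) \<partial>P)"
  proof (rule chain_coupling[symmetric])
    note [measurable] = R1 measurable_compose[OF fst_c jump_tail_measurable]
    show "?h \<in> borel_measurable (G \<Otimes>\<^sub>M seq_space)"
      by measurable
  qed
  also have "\<dots> = (\<integral>\<^sup>+\<omega>. indicator C \<omega> * ennreal (measure N {\<eta>\<in>space N. y < hold \<omega> * J \<eta>}) \<partial>P)"
    by (intro nn_integral_cong) (simp add: fst_jump_chain_1 jump_tail_eq CR indicator_def)
  finally show "(\<integral>\<^sup>+\<omega>. indicator C \<omega> * indicator ?E \<omega> \<partial>P)
    = (\<integral>\<^sup>+\<omega>. indicator C \<omega> * ennreal (measure N {\<eta>\<in>space N. y < hold \<omega> * J \<eta>}) \<partial>P)" .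
qed simp

theorem hold_jump_description: "hold_jump_description P T \<theta> N J G \<tau>"
  unfolding hold_jump_description_def Let_def D_def[symmetric]
proof (intro conjI allI impI hold_cond_law future_cond_law jump_event_measurable)
  show "AE \<omega> in P. 0 < \<tau> \<omega> \<and> \<tau> \<omega> < hold \<omega> \<and> hold \<omega> \<in> jump_times T \<omega> \<and>
    (\<forall>u. \<tau> \<omega> \<le> u \<and> u < hold \<omega> \<longrightarrow> T u \<omega> = T (\<tau> \<omega>) \<omega>)"
    using AE_regular_P by eventually_elim (auto simp: first_jump_gt first_jump_in constant_until_jump)
  fix y :: real
  show "AE \<omega> in P. real_cond_exp P GH (indicator {\<omega>\<in>space P. y < jump_size T \<omega> (hold \<omega>)}) \<omega> = measure N {\<eta>\<in>space N. y < hold \<omega> * J \<eta>} \<and>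
      measure N {\<eta>\<in>space N. y < hold \<omega> * J \<eta>} = measure N {\<eta>\<in>space N. y / hold \<omega> < J \<eta>}"
    using jump_law[of y] AE_regular_P
  proof eventually_elim
    fix \<omega> assume c: "real_cond_exp P GH (indicator {\<omega>\<in>space P. y < jump_size T \<omega> (hold \<omega>)}) \<omega> = measure N {\<eta>\<in>space N. y < hold \<omega> * J \<eta>}"
      and \<omega>: "regular \<omega> \<and> 0 < \<tau> \<omega>"
    then have "0 < hold \<omega>" using first_jump_gt[of \<omega> "\<tau> \<omega>"] by simp
    then have "{\<eta>\<in>space N. y < hold \<omega> * J \<eta>} = {\<eta>\<in>space N. y / hold \<omega> < J \<eta>}"
      by (auto simp: divide_less_eq mult.commute)
    with c show "real_cond_exp P GH (indicator {\<omega>\<in>space P. y < jump_size T \<omega> (hold \<omega>)}) \<omega> = measure N {\<eta>\<in>space N. y < hold \<omega> * J \<eta>} \<and>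
      measure N {\<eta>\<in>space N. y < hold \<omega> * J \<eta>} = measure N {\<eta>\<in>space N. y / hold \<omega> < J \<eta>}" by simp
  qed
qed

lemma hold_jump_kernel_prob: "prob_space (hold_jump_kernel \<theta> D x)"
  unfolding hold_jump_kernel_eq
  by (rule BD.prob_space_distr) (simp add: borel_prod[symmetric])

lemma jump_chain_P: "jump_chain T \<tau> n \<in> P \<rightarrow>\<^sub>M borel \<Otimes>\<^sub>M borel"
  using jump_chain_measurable[OF \<tau>_M, of n] by (simp cong: measurable_cong_sets add: sets_P)

text \<open>An event of the history is transferred to the hold-jump chain, \<open>markov_W\<close>
  is applied for each fixed start, and the result is transferred back.\<close>

lemma jump_chain_cond_law:
  "has_cond_law P (vimage_algebra (space P) (\<lambda>\<omega>. \<lambda>i\<in>{..n}. jump_chain T \<tau> i \<omega>) (\<Pi>\<^sub>M i\<in>{..n}. borel \<Otimes>\<^sub>M borel))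
    (borel \<Otimes>\<^sub>M borel) (jump_chain T \<tau> (Suc n)) (\<lambda>\<omega>. hold_jump_kernel \<theta> D (jump_chain T \<tau> n \<omega>))"
proof -
  let ?X = "jump_chain T \<tau>"
  let ?f = "\<lambda>\<omega>. \<lambda>i\<in>{..n}. ?X i \<omega>"
  let ?PI = "\<Pi>\<^sub>M i\<in>{..n}. (borel \<Otimes>\<^sub>M borel :: (real \<times> real) measure)"
  let ?V = "vimage_algebra (space P) ?f ?PI"
  have f_P: "?f \<in> P \<rightarrow>\<^sub>M ?PI" by (intro measurable_restrict jump_chain_P)
  have f_sp: "?f \<in> space P \<rightarrow> space ?PI" using measurable_space[OF f_P] by auto
  show ?thesis
  proof (rule has_cond_law_I)
    show "subalgebra P ?V"
      unfolding subalgebra_def by (auto simp: sets_vimage_algebra2[OF f_sp] intro: measurable_sets[OF f_P])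
    show "?X (Suc n) \<in> P \<rightarrow>\<^sub>M borel \<Otimes>\<^sub>M borel" by (rule jump_chain_P)
    show "prob_space (hold_jump_kernel \<theta> D (?X n \<omega>))" for \<omega> by (rule hold_jump_kernel_prob)
    fix B :: "(real \<times> real) set" assume B [measurable]: "B \<in> sets (borel \<Otimes>\<^sub>M borel)"
    define \<kappa> where "\<kappa> x = (\<integral>\<^sup>+p. indicator B (kernel_step p x) \<partial>step_law)" for x
    have \<kappa> [measurable]: "\<kappa> \<in> borel_measurable (borel \<Otimes>\<^sub>M borel)"
      unfolding \<kappa>_def kernel_step_def by measurable
    have K: "emeasure (hold_jump_kernel \<theta> D x) B = \<kappa> x" for x
    proof -
      have "emeasure (hold_jump_kernel \<theta> D x) B = (\<integral>\<^sup>+z. indicator B z \<partial>distr step_law (borel \<Otimes>\<^sub>M borel) (\<lambda>p. kernel_step p x))"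
        unfolding hold_jump_kernel_eq borel_prod[symmetric] by (rule nn_integral_indicator[symmetric]) simp
      then show ?thesis by (subst (asm) nn_integral_distr) (auto simp: \<kappa>_def)
    qed
    have Xn: "?X n \<in> ?V \<rightarrow>\<^sub>M borel \<Otimes>\<^sub>M borel"
      using measurable_compose[OF measurable_vimage_algebra1[OF f_sp] measurable_component_singleton[of n]] by simp
    show "(\<lambda>\<omega>. emeasure (hold_jump_kernel \<theta> D (?X n \<omega>)) B) \<in> borel_measurable ?V"
      unfolding K by (rule measurable_compose[OF Xn \<kappa>])
    fix A assume "A \<in> sets ?V"
    then obtain R where R: "R \<in> sets ?PI" "A = ?f -` R \<inter> space P" unfolding sets_vimage_algebra2[OF f_sp] by blast
    \<comment> \<open>\<open>f\<close> extends the event from the states up to \<open>n\<close> to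
      whole sequences. Stopping a sequence at \<open>n\<close> leaves these states unchanged, which
      is the form of \<open>markov_W\<close>.\<close>
    define f where "f c = (indicator R (restrict c {..n}) :: ennreal)" for c :: "nat \<Rightarrow> real \<times> real"
    have f [measurable]: "f \<in> borel_measurable seq_space"
      unfolding f_def by (rule measurable_compose[OF _ borel_measurable_indicator[OF R(1)]]) (intro measurable_restrict first_step_measurable)
    have f_min: "(\<lambda>z. f (\<lambda>i. snd z (min i n))) \<in> borel_measurable (G \<Otimes>\<^sub>M seq_space)"
      by (intro measurable_compose[OF _ f] measurable_sequence measurable_compose[OF measurable_snd first_step_measurable])
    have A_f: "indicator A \<omega> = f (\<lambda>i. ?X (min i n) \<omega>)" if "\<omega> \<in> space P" for \<omega>
    proof -
      have "restrict (\<lambda>i. ?X (min i n) \<omega>) {..n} = ?f \<omega>" by (auto simp: restrict_def min_def)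
      then show ?thesis using that by (simp add: f_def R(2) indicator_def)
    qed
    note [measurable] = f_min
    have "(\<integral>\<^sup>+\<omega>. indicator A \<omega> * indicator B (?X (Suc n) \<omega>) \<partial>P)
      = (\<integral>\<^sup>+\<omega>. (\<lambda>z. f (\<lambda>i. snd z (min i n)) * indicator B (snd z (Suc n))) (\<omega>, \<lambda>i. ?X i \<omega>) \<partial>P)"
      by (intro nn_integral_cong) (simp add: A_f)
    also have "\<dots> = (\<integral>\<^sup>+\<omega>. \<integral>\<^sup>+w. (\<lambda>z. f (\<lambda>i. snd z (min i n)) * indicator B (snd z (Suc n))) (\<omega>, \<lambda>i. hold_jump_chain w (start \<omega>) i) \<partial>W \<partial>P)"
      by (rule chain_coupling) measurable
    also have "\<dots> = (\<integral>\<^sup>+\<omega>. \<integral>\<^sup>+w. (\<lambda>z. f (\<lambda>i. snd z (min i n)) * \<kappa> (snd z n)) (\<omega>, \<lambda>i. hold_jump_chain w (start \<omega>) i) \<partial>W \<partial>P)"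
      using markov_W[OF f, of "indicator B"] by (simp add: \<kappa>_def)
    also have "\<dots> = (\<integral>\<^sup>+\<omega>. (\<lambda>z. f (\<lambda>i. snd z (min i n)) * \<kappa> (snd z n)) (\<omega>, \<lambda>i. ?X i \<omega>) \<partial>P)"
      by (rule chain_coupling[symmetric]) measurable
    also have "\<dots> = (\<integral>\<^sup>+\<omega>. indicator A \<omega> * emeasure (hold_jump_kernel \<theta> D (?X n \<omega>)) B \<partial>P)"
      by (intro nn_integral_cong) (simp add: A_f K)
    finally show "(\<integral>\<^sup>+\<omega>. indicator A \<omega> * indicator B (?X (Suc n) \<omega>) \<partial>P) = (\<integral>\<^sup>+\<omega>. indicator A \<omega> * emeasure (hold_jump_kernel \<theta> D (?X n \<omega>)) B \<partial>P)" .
  qed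
qed

theorem homogeneous_markov_chain:
  "homogeneous_markov_chain P borel ({0<..} \<times> {0<..}) (hold_jump_kernel \<theta> D) (jump_chain T \<tau>)"
  unfolding homogeneous_markov_chain_def
proof (intro conjI ballI allI hold_jump_kernel_measurable hold_jump_kernel_state_space)
  fix n
  show "jump_chain T \<tau> n \<in> P \<rightarrow>\<^sub>M borel" using jump_chain_P[of n] by (simp add: borel_prod)
  show "AE \<omega> in P. jump_chain T \<tau> n \<omega> \<in> {0<..} \<times> {0<..}"
    using AE_regular_P
  proof eventually_elim
    fix \<omega> assume \<omega>: "regular \<omega> \<and> 0 < \<tau> \<omega>"
    then have "0 < jtime \<omega> (\<tau> \<omega>) n" by (simp add: jtime_pos)
    moreover from this \<omega> have "0 < T (jtime \<omega> (\<tau> \<omega>) n) \<omega>" by (simp add: regular_def)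
    ultimately show "jump_chain T \<tau> n \<omega> \<in> {0<..} \<times> {0<..}" by (simp add: jump_chain_eq level_def)
  qed
  show "has_cond_law P (vimage_algebra (space P) (\<lambda>\<omega>. \<lambda>i\<in>{..n}. jump_chain T \<tau> i \<omega>) (\<Pi>\<^sub>M i\<in>{..n}. borel))
    borel (jump_chain T \<tau> (Suc n)) (\<lambda>\<omega>. hold_jump_kernel \<theta> D (jump_chain T \<tau> n \<omega>))"
    using jump_chain_cond_law[of n] by (simp add: borel_prod)
qed

end

section \<open>Fixed times and stopping times\<close>

context ssa
begin

lemma after_fixed_time:
  assumes s: "0 < s" shows "after_time M T \<theta> N J k M (vimage_algebra (space M) (T s) borel) (\<lambda>_. s)"
proof (intro after_time.intro after_time_axioms.intro)
  show "ssa M T \<theta> N J k" by (rule ssa_axioms)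
  show "prob_space M" by (rule prob_space_axioms)
  show "subalgebra M (vimage_algebra (space M) (T s) borel)"
    unfolding subalgebra_def by (auto simp: sets_vimage_algebra2 intro: measurable_sets[OF T_measurable[OF s]])
  have "T s \<in> borel_measurable (vimage_algebra (space M) (T s) borel)" by (rule measurable_vimage_algebra1) simp
  then show "(\<lambda>\<omega>. level T \<omega> s) \<in> borel_measurable (vimage_algebra (space M) (T s) borel)"
    using s by (simp add: level_def)
  show "laplace_after M (vimage_algebra (space M) (T s) borel) (\<lambda>_. s)" by (rule laplace_after_fixed[OF s])
qed (use s in auto)

text \<open>The identity under \<open>M\<close> is applied to A \<inter> E and divided by the
  probability of \<open>E\<close>. This works because \<open>E\<close> is determined by \<sigma> and
  so is itself known at the stopping time.\<close>

lemma after_stopping_time: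
  assumes \<sigma>: "stopping_time F \<sigma>" and E: "E = {\<omega>\<in>space M. 0 < \<sigma> \<omega> \<and> \<sigma> \<omega> < \<infinity>}" "0 < prob E"
  shows "after_time M T \<theta> N J k (uniform_measure M E) (F.pre_sigma \<sigma>) (\<lambda>\<omega>. enn2real (\<sigma> \<omega>))"
proof (intro after_time.intro after_time_axioms.intro)
  note stopping_time_measurable[OF \<sigma>, measurable]
  have E_M [measurable]: "E \<in> sets M" unfolding E(1) by measurable
  have E_pos: "emeasure M E \<noteq> 0" "emeasure M E \<noteq> \<infinity>" using E(2) by (auto simp: emeasure_eq_measure)
  show "ssa M T \<theta> N J k" by (rule ssa_axioms)
  show "prob_space (uniform_measure M E)" using E_pos by (rule prob_space_uniform_measure)
  show "sets (uniform_measure M E) = sets M" by simp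
  show "AE \<omega> in uniform_measure M E. Q \<omega>" if "AE \<omega> in M. Q \<omega>" for Q
    using that by (intro AE_uniform_measureI) auto
  show "subalgebra (uniform_measure M E) (F.pre_sigma \<sigma>)"
    using pre_sigma_subset_M[OF \<sigma>] by (simp add: subalgebra_def F.space_pre_sigma)
  have \<sigma>_pre [measurable]: "\<sigma> \<in> borel_measurable (F.pre_sigma \<sigma>)" by (rule F.measurable_stopping_time_pre_sigma[OF \<sigma>])
  show "(\<lambda>\<omega>. enn2real (\<sigma> \<omega>)) \<in> borel_measurable (F.pre_sigma \<sigma>)" by measurable
  show "(\<lambda>\<omega>. level T \<omega> (enn2real (\<sigma> \<omega>))) \<in> borel_measurable (F.pre_sigma \<sigma>)" by (rule level_stopping_measurable[OF \<sigma>])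
  show "AE \<omega> in uniform_measure M E. 0 < enn2real (\<sigma> \<omega>)"
    by (rule AE_uniform_measureI) (auto simp: E(1) enn2real_positive_iff)
  show "laplace_after (uniform_measure M E) (F.pre_sigma \<sigma>) (\<lambda>\<omega>. enn2real (\<sigma> \<omega>))"
    unfolding laplace_after_def
  proof (intro ballI allI impI)
    fix A n and v l :: "nat \<Rightarrow> real"
    assume A: "A \<in> sets (F.pre_sigma \<sigma>)" and vl: "v 0 = 0 \<and> (\<forall>i<n. v i < v (Suc i)) \<and> (\<forall>i. 0 \<le> l i)"
    have A_M [measurable]: "A \<in> sets M" using A pre_sigma_subset_M[OF \<sigma>] by blast
    have "{\<omega>\<in>space (F.pre_sigma \<sigma>). 0 < \<sigma> \<omega> \<and> \<sigma> \<omega> < \<infinity>} \<in> sets (F.pre_sigma \<sigma>)" by measurable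
    then have "E \<in> sets (F.pre_sigma \<sigma>)" by (simp only: E(1) F.space_pre_sigma)
    then have AE: "A \<inter> E \<in> sets (F.pre_sigma \<sigma>)" using A by blast
    let ?\<tau> = "\<lambda>\<omega>. enn2real (\<sigma> \<omega>)"
    let ?L = "\<lambda>\<omega>. ennreal (exp (- (\<Sum>i<n. l i * (level T \<omega> (?\<tau> \<omega> + v (Suc i)) - level T \<omega> (?\<tau> \<omega> + v i)))))"
    let ?R = "\<lambda>\<omega>. ennreal (exp (- (\<Sum>i<n. \<psi> (l i * (?\<tau> \<omega> + v (Suc i))) - \<psi> (l i * (?\<tau> \<omega> + v i)))))"
    have [measurable]: "(\<lambda>\<omega>. level T \<omega> (?\<tau> \<omega> + x)) \<in> borel_measurable M" for x
      by (rule level_measurable) measurable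
    have [measurable]: "\<psi> \<in> borel_measurable borel" unfolding \<psi>_def by measurable
    have unif: "(\<integral>\<^sup>+\<omega>. indicator A \<omega> * f \<omega> \<partial>uniform_measure M E) = (\<integral>\<^sup>+\<omega>. indicator (A \<inter> E) \<omega> * f \<omega> \<partial>M) / emeasure M E"
      if [measurable]: "f \<in> borel_measurable M" for f
      by (subst nn_integral_uniform_measure) (auto intro!: arg_cong[where f="\<lambda>x. x / emeasure M E"] nn_integral_cong simp: indicator_def)
    have "(\<integral>\<^sup>+\<omega>. indicator A \<omega> * ?L \<omega> \<partial>uniform_measure M E) = (\<integral>\<^sup>+\<omega>. indicator (A \<inter> E) \<omega> * ?L \<omega> \<partial>M) / emeasure M E"
      by (rule unif) measurable
    also have "(\<integral>\<^sup>+\<omega>. indicator (A \<inter> E) \<omega> * ?L \<omega> \<partial>M) = (\<integral>\<^sup>+\<omega>. indicator (A \<inter> E) \<omega> * ?R \<omega> \<partial>M)"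
      by (rule laplace_after_stopping_M[OF \<sigma> AE]) (use vl E(1) in auto)
    also have "(\<integral>\<^sup>+\<omega>. indicator (A \<inter> E) \<omega> * ?R \<omega> \<partial>M) / emeasure M E = (\<integral>\<^sup>+\<omega>. indicator A \<omega> * ?R \<omega> \<partial>uniform_measure M E)"
      by (rule unif[symmetric]) measurable
    finally show "(\<integral>\<^sup>+\<omega>. indicator A \<omega> * ?L \<omega> \<partial>uniform_measure M E) = (\<integral>\<^sup>+\<omega>. indicator A \<omega> * ?R \<omega> \<partial>uniform_measure M E)" .
  qed
qed

end

theorem corollary4p4:
  fixes M :: "'a measure" and T :: "real \<Rightarrow> 'a \<Rightarrow> real" and \<theta> :: real
    and N :: "'b measure" and J :: "'b \<Rightarrow> real"
  assumes "prob_space M"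
    and "SSA1 M T" and "nondecreasing_paths M T" and "no_drift M T"
    and "0 < \<theta>" and "finite_rate M T \<theta>"
    and "generic_jump M T \<theta> N J"
  shows
    "(\<forall>s>0. hold_law \<theta> s =
        density lborel (\<lambda>x. ennreal (\<theta> * x powr (- \<theta> - 1) * s powr \<theta>) * indicator {s<..} x))
     \<and> (\<forall>s>0.
          hold_jump_description M T \<theta> N J (vimage_algebra (space M) (T s) borel) (\<lambda>_. s)
        \<and> homogeneous_markov_chain M borel ({0<..} \<times> {0<..})
            (hold_jump_kernel \<theta> (distr N borel J)) (jump_chain T (\<lambda>_. s))
        \<and> distr M borel (T s) = distr M borel (\<lambda>\<omega>. s * T 1 \<omega>))
     \<and> (\<forall>\<sigma> :: 'a \<Rightarrow> ennreal.
          let E = {\<omega>\<in>space M. 0 < \<sigma> \<omega> \<and> \<sigma> \<omega> < \<infinity>};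
              P = uniform_measure M E;
              \<tau> = (\<lambda>\<omega>. enn2real (\<sigma> \<omega>))
          in stopping_time (natural_filtration M T) \<sigma> \<and> 0 < measure M E \<longrightarrow>
            hold_jump_description P T \<theta> N J
              (filtration.pre_sigma (space M) (natural_filtration M T) \<sigma>) \<tau>
          \<and> homogeneous_markov_chain P borel ({0<..} \<times> {0<..})
              (hold_jump_kernel \<theta> (distr N borel J)) (jump_chain T \<tau>))"
proof -
  obtain k where "key_function M T k" "\<And>x. 0 < x \<Longrightarrow> measure N {\<eta>\<in>space N. x < J \<eta>} = k x / \<theta>"
    using assms(7) by (auto simp: generic_jump_def)
  with assms have "ssa M T \<theta> N J k"
    by (auto simp: ssa_def ssa_axioms_def generic_jump_def)
  then interpret ssa M T \<theta> N J k .
  show ?thesis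
    unfolding Let_def D_def[symmetric]
  proof (intro conjI allI impI)
    fix s :: real assume s: "0 < s"
    show "hold_law \<theta> s = density lborel (\<lambda>x. ennreal (\<theta> * x powr (- \<theta> - 1) * s powr \<theta>) * indicator {s<..} x)"
      using assms(5) s by (rule hold_law_density)
    interpret after_time M T \<theta> N J k M "vimage_algebra (space M) (T s) borel" "\<lambda>_. s"
      by (rule after_fixed_time[OF s])
    show "hold_jump_description M T \<theta> N J (vimage_algebra (space M) (T s) borel) (\<lambda>_. s)"
      by (rule hold_jump_description)
    show "homogeneous_markov_chain M borel ({0<..} \<times> {0<..}) (hold_jump_kernel \<theta> D) (jump_chain T (\<lambda>_. s))"
      by (rule homogeneous_markov_chain)
    show "distr M borel (T s) = distr M borel (\<lambda>\<omega>. s * T 1 \<omega>)" by (rule distr_T[OF s])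
  next
    fix \<sigma> :: "'a \<Rightarrow> ennreal"
    define E where "E = {\<omega>\<in>space M. 0 < \<sigma> \<omega> \<and> \<sigma> \<omega> < \<infinity>}"
    assume "stopping_time F \<sigma> \<and> 0 < measure M {\<omega>\<in>space M. 0 < \<sigma> \<omega> \<and> \<sigma> \<omega> < \<infinity>}"
    then interpret after_time M T \<theta> N J k "uniform_measure M E" "F.pre_sigma \<sigma>" "\<lambda>\<omega>. enn2real (\<sigma> \<omega>)"
      by (intro after_stopping_time) (auto simp: E_def)
    show "hold_jump_description (uniform_measure M {\<omega>\<in>space M. 0 < \<sigma> \<omega> \<and> \<sigma> \<omega> < \<infinity>}) T \<theta> N J (F.pre_sigma \<sigma>) (\<lambda>\<omega>. enn2real (\<sigma> \<omega>))"
      using hold_jump_description by (simp only: E_def)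
    show "homogeneous_markov_chain (uniform_measure M {\<omega>\<in>space M. 0 < \<sigma> \<omega> \<and> \<sigma> \<omega> < \<infinity>}) borel ({0<..} \<times> {0<..}) (hold_jump_kernel \<theta> D) (jump_chain T (\<lambda>\<omega>. enn2real (\<sigma> \<omega>)))"
      using homogeneous_markov_chain by (simp only: E_def)
  qed
qed

end
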